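(* Let $(\mathcal{X},\mathcal{L})$ be a totally degenerating family of polarized abelian varieties over $\Delta^*=\{t\in\mathbb{C}:0<|t|<e^{-1}\}$. For sufficiently large $k>0$, after possibly making a finite base change and shrinking the radius of $\Delta$ (the radius being allowed to depend on $k$), one has the uniform estimate $$\sup_{\mathcal{X}_t}c(t)\left|\phi_t^{\mathrm{CY}}-\phi^{\mathrm{hyb}}_{k,t}\right|=O(k^{-2})$$ for all $t\in\Delta^*$, where $\phi_t^{\mathrm{CY}}$ is the Kähler potential associated with the Calabi--Yau metric on $\mathcal{L}_t$, and $\phi^{\mathrm{hyb}}_{k,t}=c(t)^{-1}\phi^{\mathrm{hyb}}_k(t)$ is the complex balanced metric on $\mathcal L_t$ at level $k$ obtained from the hybrid cpsh metric $\phi_k^{\mathrm{hyb}}$ on $\mathcal{L}^{\mathrm{hyb}}$ whose restriction to $t=0$ is the non-Archimedean balanced metric $\phi_k$ on $\mathcal L_K^{\mathrm{an}}$.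
   Context: **Family.** $K=\mathbb{C}((t))$ with $|t|_K=e^{-1}$, $\Delta=\{|t|<e^{-1}\}$. Let $\|\cdot\|_{\mathrm{hyb}}=\max\{|\cdot|_\infty,|\cdot|_{\mathrm{triv}}\}$ on $\mathbb{C}$ and $\mathscr{A}=\{f=\sum_{\alpha\in\mathbb{Z}}c_\alpha t^\alpha\in K:\sum\|c_\alpha\|_{\mathrm{hyb}}e^{-\alpha}<\infty\}$, a Banach ring whose Berkovich spectrum is $\{|t|\le e^{-1}\}$. The family $\pi:\mathcal{X}\to\Delta^*$ is flat, extends to a proper flat map $\mathscr{X}\to\Delta$ with $\mathscr{X}$ normal, is defined over $\mathscr{A}$, $\mathcal{L}$ is $\pi$-ample, the fibers are abelian varieties, and $(X,L)=(\mathcal{X}_K,\mathcal{L}_K)$ is a totally degenerate polarized abelian variety. "Finite base change" means replacing $t$ by $s$ with $s^m=t$ and the family by its pullback. **Hybrid space and metrics.** $\mathcal{X}^{\mathrm{hyb}}$ is the Berkovich analytification of $\mathcal{X}$ over $\mathscr{A}$, restricted over $\Delta$, with line bundle $\mathcal{L}^{\mathrm{hyb}}$ and $\pi^{\mathrm{hyb}}:\mathcal{X}^{\mathrm{hyb}}\to\Delta$. The fiber over $0$ is $X^{\mathrm{an}}$; for $t\neq0$ it is $\mathcal{X}_t$ over $\mathbb{C}$ with absolute value $|\cdot|_\infty^{c(t)}$, $c(t)=-1/\log|t|_\infty$, so that metrics on $\mathcal{L}^{\mathrm{hyb}}_t$ are metrics on $c(t)\mathcal{L}_t$. Hybrid continuous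 metrics are families of norms on $\mathcal{L}\otimes\mathscr{H}(x)$, $x\in\mathcal{X}^{\mathrm{hyb}}$, with $\phi_s=-\log\|s\|_\phi$ continuous for local trivializing sections $s$. For finitely many $s_i\in H^0(\mathcal{X},k\mathcal{L})$ without common zeros and $\lambda_i\in\mathbb{R}$, $\frac1k\max_i\{\log|s_i|+\lambda_i\}$ is the metric with $\phi_s(x)=\frac1k\max_i\{-\log|(s^k/s_i)(x)|+\lambda_i\}$; hybrid cpsh metrics are uniform limits of decreasing nets of these. $\phi(t)$ is the restriction to the fiber over $t$. **Complex balanced metric.** For a polarized complex manifold $(Y,L)$ of dimension $d$, a metric $\phi$ on $L$ ($\|s\|_\phi=|s|e^{-\phi}$) is balanced at level $k$ if $\phi=\frac1{2k}\log\sum_i|s_i|^2$ for a basis $\{s_i\}$ of $H^0(Y,kL)$ that is, up to a common positive scalar, orthonormal for $\int_Ys\overline{s'}e^{-2k\phi}\omega_\phi^d$, $\omega_\phi$ the curvature form. **The metric $\phi_k$.** $\mathbb{C}_K$ is the completed algebraic closure of $K$. Totally degenerate means: for a free $\mathbb{Z}$-module $M$ of finite rank, $N=\mathrm{Hom}(M,\mathbb{Z})$, $T=\mathrm{Spec}\,\mathbb{Z}[M]$, there is a surjective morphism of analytic groups $p:T_K^{\mathrm{an}}\to X^{\mathrm{an}}$ whose kernel is a lattice in $\mathrm{Hom}(M,K^\times)$ of rank $\operatorname{rank}M$, with $T_K^{\mathrm{an}}/\ker p\simeq X^{\mathrm{an}}$. Fixing a cubical structure on $L$ and a trivialization of $p^*L^{\mathrm{an}}$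 gives a free $\mathbb{Z}$-module $\Lambda$, $a:\Lambda\to K^\times$, bimultiplicative $b:\Lambda\times M\to K^\times$, injective $\Phi:\Lambda\to M$ with finite cokernel, with $a(0)=1$, $a(\lambda+\lambda')=b(\lambda,\Phi(\lambda'))a(\lambda)a(\lambda')$, $q(\lambda,\lambda')=b(\lambda,\Phi(\lambda'))$ symmetric, $-\log|q|_K$ positive definite; $b$ identifies $\Lambda$ with $\ker p$, and sections of $kL$ are functions on $T_K^{\mathrm{an}}$ invariant under $z^m\mapsto a(\lambda)^kb(\lambda,m)z^{m+k\Phi(\lambda)}$. The trivialization is taken with $a(\lambda)^2=q(\lambda,\lambda)$. Fix $a^k_{k\Phi}:M\to\overline K^\times$ (a single symbol) and a symmetric bimultiplicative $b_{k\Phi}:M\times M\to\overline K^\times$ with $a^k_{k\Phi}(k\Phi(\lambda))=a(\lambda)^k$, $b_{k\Phi}(k\Phi(\lambda),m)=b(\lambda,m)$, $a^k_{k\Phi}(m+m')=a^k_{k\Phi}(m)a^k_{k\Phi}(m')b_{k\Phi}(m,m')$, $a^k_{k\Phi}(m)^2=b_{k\Phi}(m,m)$. With lifts $m_\mu\in M$ of $\mu\in\operatorname{coker}(k\Phi)$ and $\theta^{(k)}_{m_\mu}=\sum_\lambda a(\lambda)^kb(\lambda,m_\mu)z^{m_\mu+k\Phi(\lambda)}\in H^0(X,kL)$, the non-Archimedean balanced metric is $\phi_k=\frac1k\max_\mu(\log|\theta^{(k)}_{m_\mu}|+\log|a^k_{k\Phi}(m_\mu)|_{\mathbb{C}_K})$.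 For sufficiently large $k$ (after a finite base change) $\phi_k^{\mathrm{hyb}}$ is a hybrid cpsh metric with $c(t)^{-1}\phi_k^{\mathrm{hyb}}(t)$ complex balanced on $\mathcal{L}_t$ at level $k$ for $t\ne0$ and $\phi_k^{\mathrm{hyb}}(0)=\phi_k$. **Calabi--Yau metrics.** $\phi_t^{\mathrm{CY}}$ is the metric on $\mathcal{L}_t$ whose curvature form is the Ricci-flat Kähler metric in $c_1(\mathcal{L}_t)$, with additive constants normalized so that $\{c(t)\phi_t^{\mathrm{CY}}\}_{t\in\Delta^*}$ extends to a hybrid cpsh metric on $\mathcal{L}^{\mathrm{hyb}}$ whose restriction to $t=0$ is $\phi^{\mathrm{NACY}}$. Here $\phi^{\mathrm{NACY}}$ is the solution, unique up to an additive constant, of $\mathrm{MA}(\phi)=(L^{\dim X})\mu$, with $\mu$ the Haar probability measure on the canonical skeleton $N_{\mathbb{R}}/\mathrm{trop}_K(\ker p)\subset X^{\mathrm{an}}$, where $\mathrm{trop}_K(x)=(m\mapsto-\log|z^m(x)|)$ and $\mathrm{MA}$ is the Chambert-Loir--Ducros Monge--Ampère operator, normalized by $-\log\|1\|_{p^*\phi^{\mathrm{NACY}}}=A_\Phi^\vee\circ\mathrm{trop}_K$, with $A_\Phi(m)=\frac12B_\Phi(m,m)$, $B_\Phi$ the bilinear form on $M_{\mathbb{R}}$ determined by $B_\Phi(\Phi(\lambda),m)=-\log|b(\lambda,m)|_K$, and $A_\Phi^\vee(n)=\max_{m\in M_{\mathbb{R}}}(\langle m,n\rangle-A_\Phi(m))$.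 *)

theory Defs
  imports
    "HOL-Complex_Analysis.Complex_Analysis"
    "HOL-Library.Poly_Mapping"
    "HOL-Algebra.Algebraic_Closure_Type"
begin

section \<open>The field of Laurent series, the convergent subring and the hybrid base\<close>

text \<open>
  Every object below depends on a degree \<open>m \<ge> 1\<close> of a finite base change \<open>s ^ m = t\<close>
  (\<open>m = 1\<close> is the original family).  The type \<open>complex fls\<close> then stands for
  \<open>K_m = \<complex>((s))\<close>, with the absolute value extending the one of \<open>K = \<complex>((t))\<close>, so
  \<open>|s| = exp (- 1 / m)\<close>; the embedding \<open>K \<rightarrow> K_m\<close> is \<open>\<lambda>f. fls_compose_power f m\<close>.
  The function \<open>c\<close> is always taken at the original parameter \<open>t = s ^ m\<close>.
\<close>

definition absK :: "nat \<Rightarrow> complex fls \<Rightarrow> real" where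
  "absK m f = (if f = 0 then 0 else exp (- real_of_int (fls_subdegree f) / real m))"

definition hyb_norm :: "complex \<Rightarrow> real" where
  "hyb_norm z = max (norm z) (if z = 0 then 0 else 1)"

text \<open>The Banach ring of radius \<open>\<rho>\<close> (in terms of \<open>t\<close>); \<open>Aring 1 (exp (-1))\<close> is the ring
  over which the family is defined, smaller \<open>\<rho>\<close> corresponds to shrinking the disc.\<close>
definition Aring :: "nat \<Rightarrow> real \<Rightarrow> complex fls set" where
  "Aring m \<rho> = {f. (\<lambda>\<alpha>::int. hyb_norm (fls_nth f \<alpha>) * \<rho> powr (real_of_int \<alpha> / real m))
                     summable_on UNIV}"

definition cfun :: "complex \<Rightarrow> real" where
  "cfun t = - 1 / ln (norm t)"

text \<open>The multiplicative seminorm on \<open>Aring m \<rho>\<close> which is the point \<open>s\<close> of its Berkovich spectrum.\<close>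
definition base_pt :: "nat \<Rightarrow> complex \<Rightarrow> complex fls \<Rightarrow> real" where
  "base_pt m s f = (if s = 0 then absK m f else norm (eval_fls f s) powr cfun (s ^ m))"

text \<open>The extension of the absolute value of \<open>K\<close> to an algebraic closure:
  \<open>|\<alpha>| = |N(\<alpha>)| ^ (1 / deg \<alpha>)\<close>, the norm being, up to sign, the constant
  coefficient of the minimal polynomial.\<close>
definition abs_ac :: "complex fls alg_closure \<Rightarrow> real" where
  "abs_ac \<alpha> = (THE r. \<exists>p :: complex fls poly. Factorial_Ring.irreducible p \<and> Polynomial.lead_coeff p = 1 \<and>
       poly (map_poly to_ac p) \<alpha> = 0 \<and> r = absK 1 (Polynomial.coeff p 0) powr (1 / real (Polynomial.degree p)))"

section \<open>Polarized projective schemes over the convergent ring\<close>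

text \<open>
  A projective scheme with an ample line bundle over a ring \<open>B\<close> is
  \<open>(Proj R, O(1))\<close> for a graded \<open>B\<close>-algebra \<open>R = B[x_i]/I\<close>, where \<open>x_i\<close> is homogeneous of
  degree \<open>w i \<ge> 1\<close>, \<open>I\<close> is a homogeneous ideal and \<open>O(1)\<close> is invertible.  The weights are needed
  because the line bundle is only ample: the \<open>x_i\<close> are generating sections of its powers.
\<close>

type_synonym 'n coordpoly = "('n \<Rightarrow>\<^sub>0 nat) \<Rightarrow>\<^sub>0 complex fls"

definition pconst :: "complex fls \<Rightarrow> 'n coordpoly" where
  "pconst a = Poly_Mapping.single 0 a"

definition pvar :: "'n \<Rightarrow> 'n coordpoly" where
  "pvar i = Poly_Mapping.single (Poly_Mapping.single i 1) 1"

definition homog :: "('n::finite \<Rightarrow> nat) \<Rightarrow> nat \<Rightarrow> 'n coordpoly \<Rightarrow> bool" where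
  "homog w d f \<longleftrightarrow> (\<forall>e \<in> Poly_Mapping.keys f. (\<Sum>i\<in>UNIV. w i * Poly_Mapping.lookup e i) = d)"

definition polys_over :: "complex fls set \<Rightarrow> 'n coordpoly set" where
  "polys_over B = {f. \<forall>e. Poly_Mapping.lookup f e \<in> B}"

definition hpolys :: "('n::finite \<Rightarrow> nat) \<Rightarrow> complex fls set \<Rightarrow> 'n coordpoly set" where
  "hpolys w B = {f \<in> polys_over B. \<exists>d. homog w d f}"

definition base_change :: "nat \<Rightarrow> 'n coordpoly \<Rightarrow> 'n coordpoly" where
  "base_change m f = Poly_Mapping.map (\<lambda>a. fls_compose_power a m) f"

text \<open>The ideal of \<open>B[x]\<close> generated by the pullback of \<open>I\<close> under \<open>s ^ m = t\<close>.\<close>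
definition ideal_over :: "'n coordpoly set \<Rightarrow> nat \<Rightarrow> complex fls set \<Rightarrow> 'n coordpoly set" where
  "ideal_over I m B =
     {(\<Sum>f\<in>G. h f * base_change m f) | G h. finite G \<and> G \<subseteq> I \<and> (\<forall>f\<in>G. h f \<in> polys_over B)}"

definition homog_ideal :: "('n::finite \<Rightarrow> nat) \<Rightarrow> complex fls set \<Rightarrow> 'n coordpoly set \<Rightarrow> bool" where
  "homog_ideal w B I \<longleftrightarrow> I \<subseteq> polys_over B \<and> 0 \<in> I \<and>
     (\<forall>f\<in>I. \<forall>g\<in>I. f + g \<in> I) \<and> (\<forall>h \<in> polys_over B. \<forall>f\<in>I. h * f \<in> I) \<and>
     (\<forall>f\<in>I. \<exists>G. finite G \<and> G \<subseteq> I \<inter> hpolys w B \<and> f = \<Sum>G)"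

section \<open>Complex fibers\<close>

definition peval :: "'n::finite coordpoly \<Rightarrow> complex \<Rightarrow> complex ^ 'n \<Rightarrow> complex" where
  "peval f s z = (\<Sum>e \<in> Poly_Mapping.keys f.
     eval_fls (Poly_Mapping.lookup f e) s * (\<Prod>i\<in>UNIV. (z $ i) ^ Poly_Mapping.lookup e i))"

definition act :: "('n::finite \<Rightarrow> nat) \<Rightarrow> complex \<Rightarrow> complex ^ 'n \<Rightarrow> complex ^ 'n" where
  "act w c z = (\<chi> i. c ^ w i * z $ i)"

definition euler :: "('n::finite \<Rightarrow> nat) \<Rightarrow> complex ^ 'n \<Rightarrow> complex ^ 'n" where
  "euler w z = (\<chi> i. of_nat (w i) * z $ i)"

text \<open>
  The fiber over \<open>t \<noteq> 0\<close> is the quotient of the cone \<open>ccone I t\<close> by the free action \<open>act w\<close> of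
  \<open>\<complex> - {0}\<close>; the cone is the complement of the zero section in the dual of the line bundle.  Hence
  sections of the \<open>k\<close>-th power of the line bundle are functions on the cone, homogeneous of degree
  \<open>k\<close>, and a metric \<open>\<phi>\<close> is a function with \<open>\<phi> (act w c z) = \<phi> z + ln (norm c)\<close>, where
  \<open>norm (s z) * exp (- k * \<phi> z)\<close> is the norm of the section \<open>s\<close> at the point below \<open>z\<close>.
\<close>
definition ccone :: "'n::finite coordpoly set \<Rightarrow> complex \<Rightarrow> (complex ^ 'n) set" where
  "ccone I t = {z. z \<noteq> 0 \<and> (\<forall>f\<in>I. peval f t z = 0)}"

definition cmetric :: "('n::finite \<Rightarrow> nat) \<Rightarrow> 'n coordpoly set \<Rightarrow> complex \<Rightarrow> (complex ^ 'n \<Rightarrow> real) \<Rightarrow> bool" where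
  "cmetric w I t \<psi> \<longleftrightarrow> (\<forall>z \<in> ccone I t. \<forall>c. c \<noteq> 0 \<longrightarrow> \<psi> (act w c z) = \<psi> z + ln (norm c))"

definition holo_on :: "(complex ^ 'g \<Rightarrow> complex) \<Rightarrow> (complex ^ 'g) set \<Rightarrow> bool" where
  "holo_on f U \<longleftrightarrow> (\<forall>u\<in>U. \<exists>D. (f has_derivative D) (at u) \<and> (\<forall>c v. D (c *s v) = c * D v))"

text \<open>A holomorphic coordinate chart of an open part of the fiber, together with a nowhere
  vanishing section of the dual line bundle over it.\<close>
definition chart :: "('n::finite \<Rightarrow> nat) \<Rightarrow> 'n coordpoly set \<Rightarrow> complex \<Rightarrow>
    (complex ^ 'g::finite) set \<Rightarrow> (complex ^ 'g \<Rightarrow> complex ^ 'n) \<Rightarrow> bool" where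
  "chart w I t U \<sigma> \<longleftrightarrow> open U \<and> (\<forall>i. holo_on (\<lambda>u. \<sigma> u $ i) U) \<and> \<sigma> ` U \<subseteq> ccone I t \<and>
     (\<forall>u\<in>U. \<forall>u'\<in>U. \<forall>c. c \<noteq> 0 \<and> \<sigma> u' = act w c (\<sigma> u) \<longrightarrow> u' = u) \<and>
     (\<forall>u\<in>U. \<forall>v c. frechet_derivative \<sigma> (at u) v = c *s euler w (\<sigma> u) \<longrightarrow> v = 0)"

definition is_lattice :: "(complex ^ 'g::finite) set \<Rightarrow> bool" where
  "is_lattice \<Gamma> \<longleftrightarrow> (\<exists>B. independent B \<and> span B = UNIV \<and>
     \<Gamma> = {(\<Sum>\<gamma>\<in>B. real_of_int (n \<gamma>) *\<^sub>R \<gamma>) | n. True})"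

text \<open>
  The (projective) fiber over \<open>t\<close> is an abelian variety of dimension \<open>CARD('g)\<close>: a complex torus,
  uniformized by \<open>u\<close>.  The last clause says that the scheme-theoretic fiber is smooth: the Zariski
  tangent space of the cone is no larger than the tangent space of the torus plus the direction of
  the orbit.
\<close>
definition abelian_fiber :: "'g::finite itself \<Rightarrow> ('n::finite \<Rightarrow> nat) \<Rightarrow> 'n coordpoly set \<Rightarrow> complex \<Rightarrow> bool" where
  "abelian_fiber g w I t \<longleftrightarrow> (\<exists>(u :: complex ^ 'g \<Rightarrow> complex ^ 'n) \<Gamma>. is_lattice \<Gamma> \<and>
     (\<forall>p. \<exists>U. p \<in> U \<and> chart w I t U u) \<and>
     (\<forall>z \<in> ccone I t. \<exists>p c. c \<noteq> 0 \<and> z = act w c (u p)) \<and>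
     (\<forall>p q. (\<exists>c. c \<noteq> 0 \<and> u q = act w c (u p)) \<longleftrightarrow> q - p \<in> \<Gamma>) \<and>
     (\<forall>p v. (\<forall>f\<in>I. frechet_derivative (peval f t) (at (u p)) v = 0) \<longrightarrow>
        (\<exists>\<xi> c. v = frechet_derivative u (at p) \<xi> + c *s euler w (u p))))"

subsection \<open>Curvature, Ricci-flat and balanced metrics\<close>

primrec Ck_on :: "nat \<Rightarrow> ('a::real_normed_vector \<Rightarrow> real) \<Rightarrow> 'a set \<Rightarrow> bool" where
  "Ck_on 0 f U \<longleftrightarrow> continuous_on U f"
| "Ck_on (Suc n) f U \<longleftrightarrow> (\<forall>x\<in>U. f differentiable (at x)) \<and>
     (\<forall>v. Ck_on n (\<lambda>x. frechet_derivative f (at x) v) U)"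

definition ddir2 :: "(complex ^ 'g::finite \<Rightarrow> real) \<Rightarrow> complex ^ 'g \<Rightarrow> complex ^ 'g \<Rightarrow> complex ^ 'g \<Rightarrow> real" where
  "ddir2 f v v' p = frechet_derivative (\<lambda>x. frechet_derivative f (at x) v') (at p) v"

text \<open>The matrix of \<open>\<partial>\<^sup>2 f / (\<partial> z_j \<partial> conj z_k)\<close>.\<close>
definition complex_hessian :: "(complex ^ 'g::finite \<Rightarrow> real) \<Rightarrow> complex ^ 'g \<Rightarrow> complex ^ 'g ^ 'g" where
  "complex_hessian f p = (\<chi> j k. Complex
     ((ddir2 f (axis j 1) (axis k 1) p + ddir2 f (axis j \<i>) (axis k \<i>) p) / 4)
     ((ddir2 f (axis j 1) (axis k \<i>) p - ddir2 f (axis j \<i>) (axis k 1) p) / 4))"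

definition posdef :: "complex ^ 'g::finite ^ 'g \<Rightarrow> bool" where
  "posdef H \<longleftrightarrow> (\<forall>\<xi>. \<xi> \<noteq> 0 \<longrightarrow> 0 < Re (\<Sum>j\<in>UNIV. \<Sum>k\<in>UNIV. H $ j $ k * \<xi> $ j * cnj (\<xi> $ k)))"

text \<open>In a chart \<open>\<sigma>\<close> the curvature form of the metric \<open>\<psi>\<close> is the complex Hessian of \<open>\<psi> \<circ> \<sigma>\<close> (up to a
  constant), and its Ricci form is minus that of the logarithm of the determinant.\<close>
definition ricci_flat_metric :: "'g::finite itself \<Rightarrow> ('n::finite \<Rightarrow> nat) \<Rightarrow> 'n coordpoly set \<Rightarrow> complex \<Rightarrow>
    (complex ^ 'n \<Rightarrow> real) \<Rightarrow> bool" where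
  "ricci_flat_metric g w I t \<psi> \<longleftrightarrow> cmetric w I t \<psi> \<and>
     (\<forall>(U :: (complex ^ 'g) set) \<sigma>. chart w I t U \<sigma> \<longrightarrow>
        (\<forall>n. Ck_on n (\<psi> \<circ> \<sigma>) U) \<and>
        (\<forall>p\<in>U. posdef (complex_hessian (\<psi> \<circ> \<sigma>) p) \<and>
           complex_hessian (\<lambda>p. ln (Re (det (complex_hessian (\<psi> \<circ> \<sigma>) p)))) p = 0))"

definition hol_sections :: "'g::finite itself \<Rightarrow> ('n::finite \<Rightarrow> nat) \<Rightarrow> 'n coordpoly set \<Rightarrow> complex \<Rightarrow> nat \<Rightarrow>
    (complex ^ 'n \<Rightarrow> complex) set" where
  "hol_sections g w I t k = {s. (\<forall>z. z \<notin> ccone I t \<longrightarrow> s z = 0) \<and>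
     (\<forall>z \<in> ccone I t. \<forall>c. c \<noteq> 0 \<longrightarrow> s (act w c z) = c ^ k * s z) \<and>
     (\<forall>(U :: (complex ^ 'g) set) \<sigma>. chart w I t U \<sigma> \<longrightarrow> holo_on (s \<circ> \<sigma>) U)}"

text \<open>The measure given by the top power of the curvature form of \<open>\<psi>\<close> (up to a constant), as a
  measure on the Borel subsets of the fiber, i.e. on the invariant Borel subsets of the cone.\<close>
definition is_curvature_measure :: "'g::finite itself \<Rightarrow> ('n::finite \<Rightarrow> nat) \<Rightarrow> 'n coordpoly set \<Rightarrow> complex \<Rightarrow>
    (complex ^ 'n \<Rightarrow> real) \<Rightarrow> (complex ^ 'n) measure \<Rightarrow> bool" where
  "is_curvature_measure g w I t \<psi> \<mu> \<longleftrightarrow> space \<mu> = ccone I t \<and>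
     sets \<mu> = {B \<in> sets borel. B \<subseteq> ccone I t \<and> (\<forall>z\<in>B. \<forall>c. c \<noteq> 0 \<longrightarrow> act w c z \<in> B)} \<and>
     (\<forall>(U :: (complex ^ 'g) set) \<sigma>. chart w I t U \<sigma> \<longrightarrow>
        (\<forall>B \<in> sets \<mu>. B \<subseteq> {act w c (\<sigma> p) | c p. c \<noteq> 0 \<and> p \<in> U} \<longrightarrow>
           emeasure \<mu> B =
             (\<integral>\<^sup>+ p \<in> {p \<in> U. \<sigma> p \<in> B}. ennreal (Re (det (complex_hessian (\<psi> \<circ> \<sigma>) p))) \<partial>lborel)))"

definition complex_balanced :: "'g::finite itself \<Rightarrow> ('n::finite \<Rightarrow> nat) \<Rightarrow> 'n coordpoly set \<Rightarrow> complex \<Rightarrow> nat \<Rightarrow>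
    (complex ^ 'n \<Rightarrow> real) \<Rightarrow> bool" where
  "complex_balanced g w I t k \<psi> \<longleftrightarrow>
     (\<exists>(N::nat) S \<mu> \<kappa>. (\<forall>i<N. S i \<in> hol_sections g w I t k) \<and>
        (\<forall>f \<in> hol_sections g w I t k. \<exists>c. \<forall>z. f z = (\<Sum>i<N. c i * S i z)) \<and>
        (\<forall>c. (\<forall>z. (\<Sum>i<N. c i * S i z) = 0) \<longrightarrow> (\<forall>i<N. c i = (0::complex))) \<and>
        (\<forall>z \<in> ccone I t. (\<Sum>i<N. (norm (S i z))\<^sup>2) > 0 \<and>
            \<psi> z = 1 / (2 * real k) * ln (\<Sum>i<N. (norm (S i z))\<^sup>2)) \<and>
        is_curvature_measure g w I t \<psi> \<mu> \<and> \<kappa> > (0::real) \<and>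
        (\<forall>i<N. \<forall>j<N.
           integral\<^sup>L \<mu> (\<lambda>z. S i z * cnj (S j z) * of_real (exp (- 2 * real k * \<psi> z)))
             = (if i = j then of_real \<kappa> else 0)))"

section \<open>The hybrid space and hybrid metrics\<close>

text \<open>
  Let \<open>R\<close> be the graded algebra of the family, base changed to \<open>Aring m \<rho>\<close>.  A point of the
  Berkovich analytification of \<open>Proj R\<close> together with a norm on the fiber of \<open>O(1)\<close> is the same as a
  multiplicative seminorm on the homogeneous elements of \<open>R\<close>, not vanishing on the irrelevant
  ideal; two norms on the same fiber differ by a rescaling \<open>v f \<mapsto> r ^ deg f * v f\<close>.
  \<open>hcone w I m \<rho> s\<close> is the set of these pairs over the point \<open>s\<close> of the base, extended by \<open>0\<close> to
  non-homogeneous arguments; the Berkovich topology is that of pointwise convergence.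
\<close>
type_synonym 'n hpoint = "'n coordpoly \<Rightarrow> real"

definition hcone :: "('n::finite \<Rightarrow> nat) \<Rightarrow> 'n coordpoly set \<Rightarrow> nat \<Rightarrow> real \<Rightarrow> complex \<Rightarrow> 'n hpoint set" where
  "hcone w I m \<rho> s = {v.
     (\<forall>f. 0 \<le> v f) \<and> (\<forall>f. f \<notin> hpolys w (Aring m \<rho>) \<longrightarrow> v f = 0) \<and>
     (\<forall>f \<in> hpolys w (Aring m \<rho>). \<forall>g \<in> hpolys w (Aring m \<rho>). v (f * g) = v f * v g) \<and>
     (\<forall>d. \<forall>f \<in> polys_over (Aring m \<rho>). \<forall>g \<in> polys_over (Aring m \<rho>).
        homog w d f \<and> homog w d g \<longrightarrow> v (f + g) \<le> v f + v g) \<and>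
     (\<forall>a \<in> Aring m \<rho>. v (pconst a) = base_pt m s a) \<and>
     (\<forall>f\<in>I. v (base_change m f) = 0) \<and> (\<exists>i. v (pvar i) \<noteq> 0)}"

definition disc :: "nat \<Rightarrow> real \<Rightarrow> complex set" where
  "disc m \<rho> = {s. norm s ^ m < \<rho>}"

definition hspace :: "('n::finite \<Rightarrow> nat) \<Rightarrow> 'n coordpoly set \<Rightarrow> nat \<Rightarrow> real \<Rightarrow> 'n hpoint set" where
  "hspace w I m \<rho> = (\<Union>s \<in> disc m \<rho>. hcone w I m \<rho> s)"

definition rescaled :: "('n::finite \<Rightarrow> nat) \<Rightarrow> complex fls set \<Rightarrow> real \<Rightarrow> 'n hpoint \<Rightarrow> 'n hpoint \<Rightarrow> bool" where
  "rescaled w B r v v' \<longleftrightarrow> (\<forall>d. \<forall>f \<in> polys_over B. homog w d f \<longrightarrow> v' f = r ^ d * v f)"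

text \<open>A point \<open>z\<close> of the cone of the complex fiber over \<open>s ^ m\<close>, as a point over \<open>s\<close>.\<close>
definition cpoint :: "('n::finite \<Rightarrow> nat) \<Rightarrow> nat \<Rightarrow> real \<Rightarrow> complex \<Rightarrow> complex ^ 'n \<Rightarrow> 'n hpoint" where
  "cpoint w m \<rho> s z f =
     (if f \<in> hpolys w (Aring m \<rho>) then norm (peval f s z) powr cfun (s ^ m) else 0)"

text \<open>\<open>\<phi> v - ln (v f / v g)\<close> is the value of \<open>\<phi>\<^sub>s\<close> for the local trivializing section \<open>s = f / g\<close>.\<close>
definition hyb_cont_metric :: "('n::finite \<Rightarrow> nat) \<Rightarrow> 'n coordpoly set \<Rightarrow> nat \<Rightarrow> real \<Rightarrow> ('n hpoint \<Rightarrow> real) \<Rightarrow> bool" where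
  "hyb_cont_metric w I m \<rho> \<phi> \<longleftrightarrow>
     (\<forall>v \<in> hspace w I m \<rho>. \<forall>v' \<in> hspace w I m \<rho>. \<forall>r>0.
        rescaled w (Aring m \<rho>) r v v' \<longrightarrow> \<phi> v' = \<phi> v + ln r) \<and>
     (\<forall>d. \<forall>f \<in> polys_over (Aring m \<rho>). \<forall>g \<in> polys_over (Aring m \<rho>).
        homog w (Suc d) f \<and> homog w d g \<longrightarrow>
        continuous_on {v \<in> hspace w I m \<rho>. v f \<noteq> 0 \<and> v g \<noteq> 0} (\<lambda>v. \<phi> v - ln (v f / v g)))"

text \<open>A global section of \<open>O(k)\<close> is a family of local sections \<open>h i / pvar i ^ N\<close> on the sets where
  \<open>pvar i\<close> does not vanish, which agree on the overlaps.\<close>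
definition glob_section :: "('n::finite \<Rightarrow> nat) \<Rightarrow> 'n coordpoly set \<Rightarrow> nat \<Rightarrow> real \<Rightarrow> nat \<Rightarrow>
    nat \<Rightarrow> ('n \<Rightarrow> 'n coordpoly) \<Rightarrow> bool" where
  "glob_section w I m \<rho> k N h \<longleftrightarrow>
     (\<forall>i. h i \<in> polys_over (Aring m \<rho>) \<and> homog w (k + N * w i) (h i)) \<and>
     (\<forall>i j. \<exists>N'. (pvar i * pvar j) ^ N' * (pvar j ^ N * h i - pvar i ^ N * h j)
                  \<in> ideal_over I m (Aring m \<rho>))"

definition sec_abs :: "nat \<Rightarrow> ('n \<Rightarrow> 'n coordpoly) \<Rightarrow> 'n hpoint \<Rightarrow> real" where
  "sec_abs N h v = (THE r. \<exists>i. v (pvar i) \<noteq> 0 \<and> r = v (h i) / v (pvar i) ^ N)"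

definition hyb_FS_metric :: "('n::finite \<Rightarrow> nat) \<Rightarrow> 'n coordpoly set \<Rightarrow> nat \<Rightarrow> real \<Rightarrow> ('n hpoint \<Rightarrow> real) \<Rightarrow> bool" where
  "hyb_FS_metric w I m \<rho> \<phi> \<longleftrightarrow>
     (\<exists>k \<ge> 1. \<exists>J :: (nat \<times> ('n \<Rightarrow> 'n coordpoly) \<times> real) set. finite J \<and>
        (\<forall>(N, h, l) \<in> J. glob_section w I m \<rho> k N h) \<and>
        (\<forall>v \<in> hspace w I m \<rho>. (\<exists>(N, h, l) \<in> J. sec_abs N h v \<noteq> 0) \<and>
           \<phi> v = 1 / real k * ln (Max ((\<lambda>(N, h, l). sec_abs N h v * exp l) ` J))))"

text \<open>A decreasing net is given by its range \<open>F\<close>, a downward directed family.\<close>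
definition hyb_cpsh_metric :: "('n::finite \<Rightarrow> nat) \<Rightarrow> 'n coordpoly set \<Rightarrow> nat \<Rightarrow> real \<Rightarrow> ('n hpoint \<Rightarrow> real) \<Rightarrow> bool" where
  "hyb_cpsh_metric w I m \<rho> \<phi> \<longleftrightarrow> hyb_cont_metric w I m \<rho> \<phi> \<and>
     (\<exists>F. (\<forall>\<psi>\<in>F. hyb_FS_metric w I m \<rho> \<psi>) \<and>
        (\<forall>\<psi>\<in>F. \<forall>\<psi>'\<in>F. \<exists>\<eta>\<in>F. \<forall>v \<in> hspace w I m \<rho>. \<eta> v \<le> \<psi> v \<and> \<eta> v \<le> \<psi>' v) \<and>
        (\<forall>\<psi>\<in>F. \<forall>v \<in> hspace w I m \<rho>. \<phi> v \<le> \<psi> v) \<and>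
        (\<forall>\<epsilon>>0. \<exists>\<psi>\<in>F. \<forall>v \<in> hspace w I m \<rho>. \<psi> v \<le> \<phi> v + \<epsilon>))"

section \<open>Totally degenerate abelian varieties\<close>

text \<open>The lattices \<open>M\<close> and \<open>\<Lambda>\<close> are \<open>int ^ 'g\<close>, and \<open>N_R\<close> and \<open>M_R\<close> are \<open>real ^ 'g\<close>, paired by the
  inner product.\<close>

type_synonym 'g laurent_poly = "(int ^ 'g) \<Rightarrow>\<^sub>0 complex fls"
type_synonym 'g laurent_series = "int ^ 'g \<Rightarrow> complex fls"

definition rvec :: "int ^ 'g::finite \<Rightarrow> real ^ 'g" where
  "rvec x = (\<chi> i. real_of_int (x $ i))"

text \<open>The Berkovich analytification of the torus with character lattice \<open>M\<close> over \<open>K_m\<close>.\<close>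
definition torus_an :: "nat \<Rightarrow> ('g::finite laurent_poly \<Rightarrow> real) set" where
  "torus_an m = {x. (\<forall>f. 0 \<le> x f) \<and> (\<forall>f g. x (f * g) = x f * x g) \<and> (\<forall>f g. x (f + g) \<le> x f + x g) \<and>
     (\<forall>a. x (Poly_Mapping.single 0 a) = absK m a)}"

definition trop :: "('g::finite laurent_poly \<Rightarrow> real) \<Rightarrow> real ^ 'g" where
  "trop x = (\<chi> i. - ln (x (Poly_Mapping.single (axis i 1) 1)))"

definition entire :: "'g::finite laurent_series \<Rightarrow> bool" where
  "entire c \<longleftrightarrow> (\<forall>r :: real ^ 'g. ((\<lambda>l. absK 1 (c l) * exp (- (rvec l \<bullet> r))) \<longlongrightarrow> 0) cofinite)"

definition partial_sum :: "nat \<Rightarrow> 'g::finite laurent_series \<Rightarrow> (int ^ 'g) set \<Rightarrow> 'g laurent_poly" where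
  "partial_sum m c F = (\<Sum>l\<in>F. Poly_Mapping.single l (fls_compose_power (c l) m))"

text \<open>The absolute value at \<open>x\<close> of the analytic function which is the limit of the Laurent
  polynomials \<open>G F\<close> over finite sets \<open>F\<close> of exponents.\<close>
definition abs_lim :: "('g::finite laurent_poly \<Rightarrow> real) \<Rightarrow> ((int ^ 'g) set \<Rightarrow> 'g laurent_poly) \<Rightarrow> real" where
  "abs_lim x G = Lim (finite_subsets_at_top UNIV) (\<lambda>F. x (G F))"

definition psubst :: "'n::finite coordpoly \<Rightarrow> ('n \<Rightarrow> 'g::finite laurent_poly) \<Rightarrow> 'g laurent_poly" where
  "psubst f y = (\<Sum>e \<in> Poly_Mapping.keys f.
     Poly_Mapping.single 0 (Poly_Mapping.lookup f e) * (\<Prod>i\<in>UNIV. y i ^ Poly_Mapping.lookup e i))"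

definition twist :: "(int ^ 'g \<Rightarrow> int ^ 'g \<Rightarrow> complex fls) \<Rightarrow> int ^ 'g \<Rightarrow> 'g::finite laurent_poly \<Rightarrow> 'g laurent_poly" where
  "twist b l f = (\<Sum>e \<in> Poly_Mapping.keys f. Poly_Mapping.single e (Poly_Mapping.lookup f e * b l e))"

text \<open>The morphism \<open>p\<close> from the torus, with the trivialization of the pullback of the line bundle, is
  given by the functions \<open>\<tau> i\<close>, pullbacks of the coordinates.  The trivializing section \<open>1\<close> makes the
  image of \<open>x\<close> a pair of a point and a norm, so \<open>\<phi> (unif_map \<dots> x)\<close> is
  \<open>- ln\<close> of the norm of \<open>1\<close> at \<open>x\<close> for the pullback of the metric \<open>\<phi>\<close>.\<close>
definition unif_map :: "('n::finite \<Rightarrow> nat) \<Rightarrow> ('n \<Rightarrow> 'g::finite laurent_series) \<Rightarrow> nat \<Rightarrow> real \<Rightarrow>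
    ('g laurent_poly \<Rightarrow> real) \<Rightarrow> 'n hpoint" where
  "unif_map w \<tau> m \<rho> x f = (if f \<in> hpolys w (Aring m \<rho>)
     then abs_lim x (\<lambda>F. psubst f (\<lambda>i. partial_sum m (\<tau> i) F)) else 0)"

text \<open>Invariance under \<open>z^e \<mapsto> a(l)^k b(l,e) z^(e + k \<Phi>(l))\<close>.\<close>
definition invariant_series :: "(int ^ 'g \<Rightarrow> complex fls) \<Rightarrow> (int ^ 'g \<Rightarrow> int ^ 'g \<Rightarrow> complex fls) \<Rightarrow>
    (int ^ 'g \<Rightarrow> int ^ 'g) \<Rightarrow> nat \<Rightarrow> 'g::finite laurent_series \<Rightarrow> bool" where
  "invariant_series a b \<Phi> k c \<longleftrightarrow> (\<forall>l e. c (e + int k *s \<Phi> l) = a l ^ k * b l e * c e)"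

definition degeneration_data :: "(int ^ 'g \<Rightarrow> complex fls) \<Rightarrow> (int ^ 'g \<Rightarrow> int ^ 'g \<Rightarrow> complex fls) \<Rightarrow>
    (int ^ 'g::finite \<Rightarrow> int ^ 'g) \<Rightarrow> bool" where
  "degeneration_data a b \<Phi> \<longleftrightarrow>
     (\<forall>l l'. \<Phi> (l + l') = \<Phi> l + \<Phi> l') \<and> inj \<Phi> \<and>
     finite (range (\<lambda>e. {e + \<Phi> l | l. True})) \<and>
     (\<forall>l. a l \<noteq> 0) \<and> (\<forall>l e. b l e \<noteq> 0) \<and>
     (\<forall>l l' e. b (l + l') e = b l e * b l' e) \<and> (\<forall>l e e'. b l (e + e') = b l e * b l e') \<and>
     a 0 = 1 \<and> (\<forall>l l'. a (l + l') = b l (\<Phi> l') * a l * a l') \<and>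
     (\<forall>l l'. b l (\<Phi> l') = b l' (\<Phi> l)) \<and>
     (\<forall>Q. bilinear Q \<and> (\<forall>l l'. Q (rvec l) (rvec l') = - ln (absK 1 (b l (\<Phi> l')))) \<longrightarrow>
        (\<forall>y :: real ^ 'g. y \<noteq> 0 \<longrightarrow> Q y y > (0::real))) \<and>
     (\<forall>l. (a l)\<^sup>2 = b l (\<Phi> l))"

text \<open>
  The uniformization of the generic fiber: the map given by \<open>\<tau>\<close> is surjective (also after the base
  changes \<open>K_m\<close>), its fibers are the orbits of the lattice \<open>b\<close>, and it identifies, for each \<open>k \<ge> 1\<close>,
  the sections of the \<open>k\<close>-th power of the line bundle with the invariant analytic functions: two
  sections with the same pullback agree, and every invariant function is locally on the
  set \<open>pvar i \<noteq> 0\<close> of the form \<open>P / pvar i ^ N\<close>.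
\<close>
definition uniformization :: "('n::finite \<Rightarrow> nat) \<Rightarrow> 'n coordpoly set \<Rightarrow> (int ^ 'g \<Rightarrow> complex fls) \<Rightarrow>
    (int ^ 'g \<Rightarrow> int ^ 'g \<Rightarrow> complex fls) \<Rightarrow> (int ^ 'g \<Rightarrow> int ^ 'g) \<Rightarrow> ('n \<Rightarrow> 'g::finite laurent_series) \<Rightarrow> bool" where
  "uniformization w I a b \<Phi> \<tau> \<longleftrightarrow>
     (\<forall>i. entire (\<tau> i) \<and> invariant_series a b \<Phi> (w i) (\<tau> i)) \<and>
     (\<forall>m \<ge> 1. \<forall>\<rho>. 0 < \<rho> \<and> \<rho> \<le> exp (-1) \<longrightarrow>
        (\<forall>x \<in> torus_an m. unif_map w \<tau> m \<rho> x \<in> hcone w I m \<rho> 0) \<and>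
        (\<forall>v \<in> hcone w I m \<rho> 0. \<exists>x \<in> torus_an m. \<exists>r>0.
           rescaled w (Aring m \<rho>) r (unif_map w \<tau> m \<rho> x) v)) \<and>
     (\<forall>x \<in> torus_an 1. \<forall>y \<in> torus_an 1.
        (\<exists>r>0. rescaled w (Aring 1 (exp (-1))) r
           (unif_map w \<tau> 1 (exp (-1)) x) (unif_map w \<tau> 1 (exp (-1)) y)) \<longleftrightarrow>
        (\<exists>l. \<forall>f. y f = x (twist b l f))) \<and>
     (\<forall>d f. homog w d f \<longrightarrow>
        ((\<forall>x \<in> torus_an 1. abs_lim x (\<lambda>F. psubst f (\<lambda>i. partial_sum 1 (\<tau> i) F)) = 0) \<longleftrightarrow>
         (\<exists>N. \<forall>i. pvar i ^ N * f \<in> ideal_over I 1 UNIV))) \<and>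
     (\<forall>k \<ge> 1. \<forall>\<theta>. entire \<theta> \<and> invariant_series a b \<Phi> k \<theta> \<longrightarrow>
        (\<exists>N. \<forall>i. \<exists>P. homog w (k + N * w i) P \<and>
           (\<forall>x \<in> torus_an 1. abs_lim x (\<lambda>F. psubst P (\<lambda>j. partial_sum 1 (\<tau> j) F)
               - partial_sum 1 (\<tau> i) F ^ N * partial_sum 1 \<theta> F) = 0)))"

text \<open>
  A totally degenerating family of polarized abelian varieties of dimension \<open>CARD('g)\<close> over the
  punctured disc of radius \<open>exp (-1)\<close>.  Flatness over the local rings of the
  punctured disc, which are principal, is absence of torsion: \<open>t - t\<^sub>0\<close> is not a zero divisor locally
  on \<open>Proj\<close>.  Invertibility of \<open>O(1)\<close> at a point means that the degrees of the coordinates which do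
  not vanish there have greatest common divisor \<open>1\<close>.
\<close>
definition totally_degenerating_family :: "('n::finite \<Rightarrow> nat) \<Rightarrow> 'n coordpoly set \<Rightarrow> (int ^ 'g \<Rightarrow> complex fls) \<Rightarrow>
    (int ^ 'g \<Rightarrow> int ^ 'g \<Rightarrow> complex fls) \<Rightarrow> (int ^ 'g \<Rightarrow> int ^ 'g) \<Rightarrow> ('n \<Rightarrow> 'g::finite laurent_series) \<Rightarrow> bool" where
  "totally_degenerating_family w I a b \<Phi> \<tau> \<longleftrightarrow>
     (\<forall>i. w i \<ge> 1) \<and> homog_ideal w (Aring 1 (exp (-1))) I \<and>
     (\<forall>v \<in> hspace w I 1 (exp (-1)). Gcd {w i | i. v (pvar i) \<noteq> 0} = 1) \<and>
     (\<forall>t\<^sub>0. 0 < norm t\<^sub>0 \<and> norm t\<^sub>0 < exp (-1) \<longrightarrow>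
        (\<forall>f \<in> polys_over (Aring 1 (exp (-1))). pconst (fls_X - fls_const t\<^sub>0) * f \<in> I \<longrightarrow>
           (\<exists>N. \<forall>i. pvar i ^ N * f \<in> I)) \<and>
        abelian_fiber TYPE('g) w I t\<^sub>0) \<and>
     degeneration_data a b \<Phi> \<and> uniformization w I a b \<Phi> \<tau>"

section \<open>The Calabi--Yau and the balanced metrics\<close>

definition B_form :: "(int ^ 'g \<Rightarrow> int ^ 'g \<Rightarrow> complex fls) \<Rightarrow> (int ^ 'g \<Rightarrow> int ^ 'g) \<Rightarrow>
    real ^ 'g::finite \<Rightarrow> real ^ 'g \<Rightarrow> real" where
  "B_form b \<Phi> = (THE B. bilinear B \<and> (\<forall>l e. B (rvec (\<Phi> l)) (rvec e) = - ln (absK 1 (b l e))))"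

definition A_dual :: "(int ^ 'g \<Rightarrow> int ^ 'g \<Rightarrow> complex fls) \<Rightarrow> (int ^ 'g \<Rightarrow> int ^ 'g) \<Rightarrow>
    real ^ 'g::finite \<Rightarrow> real" where
  "A_dual b \<Phi> n = (SUP y. y \<bullet> n - B_form b \<Phi> y y / 2)"

text \<open>The restriction of \<open>\<phi>\<close> to the fiber over \<open>0\<close> is the non-Archimedean Calabi--Yau metric with its
  normalization.  As the uniformization is surjective, this equation determines the restriction.\<close>
definition restricts_to_NACY :: "('n::finite \<Rightarrow> nat) \<Rightarrow> (int ^ 'g \<Rightarrow> int ^ 'g \<Rightarrow> complex fls) \<Rightarrow>
    (int ^ 'g \<Rightarrow> int ^ 'g) \<Rightarrow> ('n \<Rightarrow> 'g::finite laurent_series) \<Rightarrow> ('n hpoint \<Rightarrow> real) \<Rightarrow> bool" where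
  "restricts_to_NACY w b \<Phi> \<tau> \<phi> \<longleftrightarrow>
     (\<forall>x \<in> torus_an 1. \<phi> (unif_map w \<tau> 1 (exp (-1)) x) = A_dual b \<Phi> (trop x))"

definition calabi_yau_metrics :: "('n::finite \<Rightarrow> nat) \<Rightarrow> 'n coordpoly set \<Rightarrow> (int ^ 'g \<Rightarrow> int ^ 'g \<Rightarrow> complex fls) \<Rightarrow>
    (int ^ 'g \<Rightarrow> int ^ 'g) \<Rightarrow> ('n \<Rightarrow> 'g::finite laurent_series) \<Rightarrow> (complex \<Rightarrow> complex ^ 'n \<Rightarrow> real) \<Rightarrow> bool" where
  "calabi_yau_metrics w I b \<Phi> \<tau> \<phi>CY \<longleftrightarrow>
     (\<forall>t. 0 < norm t \<and> norm t < exp (-1) \<longrightarrow> ricci_flat_metric TYPE('g) w I t (\<phi>CY t)) \<and>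
     (\<exists>\<phi>. hyb_cpsh_metric w I 1 (exp (-1)) \<phi> \<and>
        (\<forall>t. 0 < norm t \<and> norm t < exp (-1) \<longrightarrow>
           (\<forall>z \<in> ccone I t. \<phi> (cpoint w 1 (exp (-1)) t z) = cfun t * \<phi>CY t z)) \<and>
        restricts_to_NACY w b \<Phi> \<tau> \<phi>)"

text \<open>\<open>ak\<close> and \<open>bk\<close> are \<open>a^k\<^sub>k\<^sub>\<Phi>\<close> and \<open>b\<^sub>k\<^sub>\<Phi>\<close>; \<open>S\<close> is the set of lifts of the elements of the
  cokernel of \<open>k \<Phi>\<close>.\<close>
definition balanced_data :: "(int ^ 'g \<Rightarrow> complex fls) \<Rightarrow> (int ^ 'g \<Rightarrow> int ^ 'g \<Rightarrow> complex fls) \<Rightarrow>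
    (int ^ 'g::finite \<Rightarrow> int ^ 'g) \<Rightarrow> nat \<Rightarrow> (int ^ 'g \<Rightarrow> complex fls alg_closure) \<Rightarrow>
    (int ^ 'g \<Rightarrow> int ^ 'g \<Rightarrow> complex fls alg_closure) \<Rightarrow> (int ^ 'g) set \<Rightarrow> bool" where
  "balanced_data a b \<Phi> k ak bk S \<longleftrightarrow>
     (\<forall>e. ak e \<noteq> 0) \<and> (\<forall>e e'. bk e e' \<noteq> 0) \<and> (\<forall>e e'. bk e e' = bk e' e) \<and>
     (\<forall>e e' e''. bk (e + e') e'' = bk e e'' * bk e' e'') \<and>
     (\<forall>l. ak (int k *s \<Phi> l) = to_ac (a l ^ k)) \<and>
     (\<forall>l e. bk (int k *s \<Phi> l) e = to_ac (b l e)) \<and>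
     (\<forall>e e'. ak (e + e') = ak e * ak e' * bk e e') \<and> (\<forall>e. (ak e)\<^sup>2 = bk e e) \<and>
     (\<forall>e. \<exists>!e'. e' \<in> S \<and> (\<exists>l. e = e' + int k *s \<Phi> l))"

text \<open>The coefficients of \<open>\<Sum>l. a(l)^k b(l,e) z^(e + k \<Phi>(l))\<close>; the sum below has at most one term.\<close>
definition theta :: "(int ^ 'g \<Rightarrow> complex fls) \<Rightarrow> (int ^ 'g \<Rightarrow> int ^ 'g \<Rightarrow> complex fls) \<Rightarrow>
    (int ^ 'g::finite \<Rightarrow> int ^ 'g) \<Rightarrow> nat \<Rightarrow> int ^ 'g \<Rightarrow> 'g laurent_series" where
  "theta a b \<Phi> k e e' = (\<Sum>l | e' = e + int k *s \<Phi> l. a l ^ k * b l e)"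

definition na_balanced :: "(int ^ 'g \<Rightarrow> complex fls) \<Rightarrow> (int ^ 'g \<Rightarrow> int ^ 'g \<Rightarrow> complex fls) \<Rightarrow>
    (int ^ 'g::finite \<Rightarrow> int ^ 'g) \<Rightarrow> nat \<Rightarrow> (int ^ 'g \<Rightarrow> complex fls alg_closure) \<Rightarrow> (int ^ 'g) set \<Rightarrow>
    nat \<Rightarrow> ('g laurent_poly \<Rightarrow> real) \<Rightarrow> real" where
  "na_balanced a b \<Phi> k ak S m x =
     1 / real k * ln (Max ((\<lambda>e. abs_lim x (partial_sum m (theta a b \<Phi> k e)) * abs_ac (ak e)) ` S))"

text \<open>\<open>\<phi>\<close> is a hybrid cpsh metric on the base change of degree \<open>m\<close>, over the disc of radius \<open>\<rho>\<close>, whose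
  rescaled restrictions to the complex fibers are balanced at level \<open>k\<close>, and whose restriction to the
  fiber over \<open>0\<close> is the non-Archimedean balanced metric.\<close>
definition hybrid_balanced :: "('n::finite \<Rightarrow> nat) \<Rightarrow> 'n coordpoly set \<Rightarrow> (int ^ 'g \<Rightarrow> complex fls) \<Rightarrow>
    (int ^ 'g \<Rightarrow> int ^ 'g \<Rightarrow> complex fls) \<Rightarrow> (int ^ 'g \<Rightarrow> int ^ 'g) \<Rightarrow> ('n \<Rightarrow> 'g::finite laurent_series) \<Rightarrow>
    nat \<Rightarrow> (int ^ 'g \<Rightarrow> complex fls alg_closure) \<Rightarrow> (int ^ 'g) set \<Rightarrow>
    nat \<Rightarrow> real \<Rightarrow> ('n hpoint \<Rightarrow> real) \<Rightarrow> bool" where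
  "hybrid_balanced w I a b \<Phi> \<tau> k ak S m \<rho> \<phi> \<longleftrightarrow> hyb_cpsh_metric w I m \<rho> \<phi> \<and>
     (\<forall>s. s \<noteq> 0 \<and> s \<in> disc m \<rho> \<longrightarrow>
        complex_balanced TYPE('g) w I (s ^ m) k (\<lambda>z. \<phi> (cpoint w m \<rho> s z) / cfun (s ^ m))) \<and>
     (\<forall>x \<in> torus_an m. \<phi> (unif_map w \<tau> m \<rho> x) = na_balanced a b \<Phi> k ak S m x)"

end

theory Submission
  imports Defs
begin

text \<open>The two metrics live over different bases: the Calabi-Yau one over the original disc,
  the balanced one over a base change of degree \<open>m\<close> and a possibly smaller disc. They
  are compared upstairs, by restricting seminorms along the base change; on the torus this leaves
  the tropicalization of a point unchanged. Metrics are functions on a cone, whose points carry a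
  norm on the fiber of the line bundle, and this cone is not compact, even over a small disc. The
  difference of two metrics is constant on the orbits of rescaling, so it suffices to look at points
  whose largest coordinate has norm one, and near the center these stay in a compact box of
  seminorms. The constant comes from the dimension and from an upper bound of
  \<open>B_form b \<Phi>\<close> alone, so it serves all \<open>k\<close>, all base changes and all
  choices of representatives. Compactness says nothing about the size of the radius
  \<open>r\<close>, which may therefore vary with \<open>k\<close>.\<close>

text \<open>
  On the central fiber the balanced metric is the maximum over the lattice \<open>(1/k) M\<close> of the affine functions
  whose supremum over \<open>M\<^sub>\<real>\<close> is \<open>A_dual\<close>. A lattice point nearest to the real maximum point is at
  distance \<open>O(1/k)\<close> from it, and the functions are quadratic in the slope, so the two metrics differ by
  \<open>O(k\<^sup>-\<^sup>2)\<close>. The difference of the two hybrid metrics is a function on the hybrid space, which is proper over the disc; by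
  continuity and compactness the bound on the central fiber persists, up to \<open>k\<^sup>-\<^sup>2\<close>, on the nearby fibers.
\<close>

section \<open>Evaluation of polynomial mappings\<close>

text \<open>One formula covers both the evaluation \<open>peval\<close> at a point of a complex
  fiber and the base change of coefficients, so that additivity and multiplicativity are proved once
  for both.\<close>

definition pm_eval :: "('a::zero \<Rightarrow> 'r::comm_ring_1) \<Rightarrow> ('k \<Rightarrow> 'r) \<Rightarrow> ('k \<Rightarrow>\<^sub>0 'a) \<Rightarrow> 'r" where
  "pm_eval c M f = (\<Sum>e\<in>Poly_Mapping.keys f. c (Poly_Mapping.lookup f e) * M e)"

lemma poly_mapping_eq_sum_single:
  "f = (\<Sum>e\<in>Poly_Mapping.keys f. Poly_Mapping.single e (Poly_Mapping.lookup f e))"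
  by (rule poly_mapping_eqI)
    (auto simp: lookup_sum lookup_single when_def in_keys_iff sum.delta)

text \<open>The coefficient map is a homomorphism only on the subset \<open>B\<close>, because
  \<open>eval_fls\<close> respects sums and products only for series which converge at the
  point.\<close>

locale coeff_hom =
  fixes B :: "'a::comm_ring_1 set" and c :: "'a \<Rightarrow> 'r::comm_ring_1" and M :: "'k::comm_monoid_add \<Rightarrow> 'r"
  assumes B0: "0 \<in> B" and Badd: "\<And>x y. x \<in> B \<Longrightarrow> y \<in> B \<Longrightarrow> x + y \<in> B"
    and Bmult: "\<And>x y. x \<in> B \<Longrightarrow> y \<in> B \<Longrightarrow> x * y \<in> B"
    and c0: "c 0 = 0" and cadd: "\<And>x y. x \<in> B \<Longrightarrow> y \<in> B \<Longrightarrow> c (x + y) = c x + c y"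
    and cmult: "\<And>x y. x \<in> B \<Longrightarrow> y \<in> B \<Longrightarrow> c (x * y) = c x * c y"
    and Madd: "\<And>e e'. M (e + e') = M e * M e'"
begin

lemma pm_eval_superset:
  assumes "finite A" "Poly_Mapping.keys f \<subseteq> A"
  shows "pm_eval c M f = (\<Sum>e\<in>A. c (Poly_Mapping.lookup f e) * M e)"
  unfolding pm_eval_def by (rule sum.mono_neutral_left[OF assms]) (auto simp: in_keys_iff c0)

lemma pm_eval_0 [simp]: "pm_eval c M 0 = 0"
  by (simp add: pm_eval_def)

lemma pm_eval_single: "pm_eval c M (Poly_Mapping.single e a) = c a * M e"
  by (cases "a = 0") (auto simp: pm_eval_def c0)

lemma pm_eval_add:
  assumes "\<forall>e. Poly_Mapping.lookup f e \<in> B" "\<forall>e. Poly_Mapping.lookup g e \<in> B"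
  shows "pm_eval c M (f + g) = pm_eval c M f + pm_eval c M g"
proof -
  let ?A = "Poly_Mapping.keys f \<union> Poly_Mapping.keys g"
  have fin: "finite ?A" by simp
  have "pm_eval c M (f + g) = (\<Sum>e\<in>?A. c (Poly_Mapping.lookup (f + g) e) * M e)"
    by (rule pm_eval_superset[OF fin keys_add])
  also have "\<dots> = pm_eval c M f + pm_eval c M g"
    using assms by (simp add: pm_eval_superset[OF fin] lookup_add cadd algebra_simps sum.distrib)
  finally show ?thesis .
qed

lemma lookup_sum_in:
  assumes "\<And>i. i \<in> A \<Longrightarrow> \<forall>e. Poly_Mapping.lookup (F i) e \<in> B"
  shows "Poly_Mapping.lookup (sum F A) e \<in> B"
  using assms by (induction A rule: infinite_finite_induct) (auto simp: B0 Badd lookup_add)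

lemma pm_eval_sum:
  assumes "\<And>i. i \<in> A \<Longrightarrow> \<forall>e. Poly_Mapping.lookup (F i) e \<in> B"
  shows "pm_eval c M (sum F A) = (\<Sum>i\<in>A. pm_eval c M (F i))"
  using assms
proof (induction A rule: infinite_finite_induct)
  case (insert x A)
  have "pm_eval c M (F x + sum F A) = pm_eval c M (F x) + pm_eval c M (sum F A)"
    by (rule pm_eval_add) (use insert.prems in \<open>auto intro!: lookup_sum_in\<close>)
  then show ?case using insert by simp
qed auto

lemma mult_eq_sum_single:
  "f * g = (\<Sum>(e, e')\<in>Poly_Mapping.keys f \<times> Poly_Mapping.keys g.
     Poly_Mapping.single (e + e') (Poly_Mapping.lookup f e * Poly_Mapping.lookup g e'))"
  for f g :: "'k \<Rightarrow>\<^sub>0 'a"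
proof -
  have "f * g = (\<Sum>e\<in>Poly_Mapping.keys f. Poly_Mapping.single e (Poly_Mapping.lookup f e)) *
    (\<Sum>e\<in>Poly_Mapping.keys g. Poly_Mapping.single e (Poly_Mapping.lookup g e))"
    using poly_mapping_eq_sum_single by metis
  then show ?thesis
    by (simp add: sum_product sum.cartesian_product mult_single)
qed

lemma lookup_mult_in:
  assumes "\<forall>e. Poly_Mapping.lookup f e \<in> B" "\<forall>e. Poly_Mapping.lookup g e \<in> B"
  shows "Poly_Mapping.lookup (f * g :: 'k \<Rightarrow>\<^sub>0 'a) e \<in> B"
  unfolding mult_eq_sum_single
  by (rule lookup_sum_in) (use assms in \<open>auto simp: lookup_single when_def Bmult B0\<close>)

lemma pm_eval_mult:
  assumes "\<forall>e. Poly_Mapping.lookup f e \<in> B" "\<forall>e. Poly_Mapping.lookup g e \<in> B"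
  shows "pm_eval c M (f * g) = pm_eval c M f * pm_eval c M g"
proof -
  have "pm_eval c M (f * g) = (\<Sum>(e, e')\<in>Poly_Mapping.keys f \<times> Poly_Mapping.keys g.
     pm_eval c M (Poly_Mapping.single (e + e') (Poly_Mapping.lookup f e * Poly_Mapping.lookup g e')))"
    unfolding mult_eq_sum_single case_prod_unfold
    by (rule pm_eval_sum) (use assms in \<open>auto simp: lookup_single when_def Bmult B0\<close>)
  also have "\<dots> = pm_eval c M f * pm_eval c M g"
    unfolding pm_eval_single unfolding pm_eval_def sum_product sum.cartesian_product
    using assms by (intro sum.cong refl) (simp only: case_prod_unfold cmult Madd mult_ac)
  finally show ?thesis .
qed

end

section \<open>Base change of polynomial mappings\<close>

text \<open>This is \<open>base_change\<close> with arbitrary exponents: Laurent polynomials on the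
  torus have to be base changed as well.\<close>

definition pm_base_change :: "nat \<Rightarrow> ('k \<Rightarrow>\<^sub>0 complex fls) \<Rightarrow> ('k \<Rightarrow>\<^sub>0 complex fls)" where
  "pm_base_change m f = Poly_Mapping.map (\<lambda>a. fls_compose_power a m) f"

lemma base_change_eq: "base_change m f = pm_base_change m f"
  by (simp add: base_change_def pm_base_change_def)

lemma lookup_pm_base_change [simp]:
  "Poly_Mapping.lookup (pm_base_change m f) e = fls_compose_power (Poly_Mapping.lookup f e) m"
  unfolding pm_base_change_def by (simp add: Poly_Mapping.map.rep_eq when_def)

lemma fls_compose_power_eq_0_iff [simp]:
  "m > 0 \<Longrightarrow> fls_compose_power f m = 0 \<longleftrightarrow> f = 0"
proof
  assume m: "m > 0" and "fls_compose_power f m = 0"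
  then have "fls_nth (fls_compose_power f m) (int m * n) = 0" for n by simp
  then have "fls_nth f n = 0" for n using m by (simp add: fls_nth_compose_power)
  then show "f = 0" by (simp add: fls_eq_iff)
qed simp

lemma keys_pm_base_change [simp]:
  "m > 0 \<Longrightarrow> Poly_Mapping.keys (pm_base_change m f) = Poly_Mapping.keys f"
  by (auto simp: in_keys_iff)

lemma pm_base_change_single [simp]:
  "pm_base_change m (Poly_Mapping.single e a) = Poly_Mapping.single e (fls_compose_power a m)"
  by (rule poly_mapping_eqI) (auto simp: lookup_single when_def)

lemma pm_base_change_0 [simp]: "pm_base_change m 0 = 0"
  by (rule poly_mapping_eqI) auto

lemma pm_base_change_add [simp]: "pm_base_change m (f + g) = pm_base_change m f + pm_base_change m g"
  by (rule poly_mapping_eqI) (auto simp: lookup_add)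

lemma pm_base_change_sum: "pm_base_change m (sum F A) = (\<Sum>i\<in>A. pm_base_change m (F i))"
  by (induction A rule: infinite_finite_induct) auto

interpretation pm_bc: coeff_hom "UNIV :: complex fls set"
  "\<lambda>a. Poly_Mapping.single 0 (fls_compose_power a m)"
  "\<lambda>e::'k::comm_monoid_add. Poly_Mapping.single e (1 :: complex fls)" for m
  by unfold_locales (auto simp: mult_single single_add)

text \<open>Base change is itself an evaluation with values in the ring of polynomial mappings, so
  this is an instance of \<open>pm_eval_mult\<close>.\<close>

lemma pm_base_change_mult [simp]:
  fixes f g :: "'k::comm_monoid_add \<Rightarrow>\<^sub>0 complex fls"
  shows "pm_base_change m (f * g) = pm_base_change m f * pm_base_change m g"
proof -
  have *: "pm_base_change m f = pm_eval (\<lambda>a. Poly_Mapping.single 0 (fls_compose_power a m))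
    (\<lambda>e. Poly_Mapping.single e 1) f" for f :: "'k \<Rightarrow>\<^sub>0 complex fls"
  proof -
    have "pm_base_change m f = pm_base_change m (\<Sum>e\<in>Poly_Mapping.keys f. Poly_Mapping.single e (Poly_Mapping.lookup f e))"
      using poly_mapping_eq_sum_single[of f] by simp
    then show ?thesis by (simp add: pm_base_change_sum pm_eval_def mult_single)
  qed
  show ?thesis by (simp add: * pm_bc.pm_eval_mult)
qed

lemma pm_base_change_1 [simp]:
  "m > 0 \<Longrightarrow> pm_base_change m (1 :: 'k::comm_monoid_add \<Rightarrow>\<^sub>0 complex fls) = 1"
  using pm_base_change_single[of m 0 1] by simp

lemma pm_base_change_power [simp]:
  fixes f :: "'k::comm_monoid_add \<Rightarrow>\<^sub>0 complex fls"
  shows "m > 0 \<Longrightarrow> pm_base_change m (f ^ n) = pm_base_change m f ^ n"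
  by (induction n) auto

lemma pm_base_change_prod:
  fixes F :: "'i \<Rightarrow> 'k::comm_monoid_add \<Rightarrow>\<^sub>0 complex fls"
  shows "m > 0 \<Longrightarrow> pm_base_change m (prod F A) = (\<Prod>i\<in>A. pm_base_change m (F i))"
  by (induction A rule: infinite_finite_induct) auto

lemma pm_base_change_psubst:
  "m > 0 \<Longrightarrow> pm_base_change m (psubst f y) = psubst (base_change m f) (\<lambda>i. pm_base_change m (y i))"
  by (simp add: psubst_def pm_base_change_sum pm_base_change_prod base_change_eq)

lemma pm_base_change_partial_sum:
  "m > 0 \<Longrightarrow> pm_base_change m (partial_sum 1 c F) = partial_sum m c F"
proof -
  have "fls_compose_power f 1 = f" for f :: "complex fls"
    by (rule fls_eqI) (simp add: fls_nth_compose_power)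
  then show "m > 0 \<Longrightarrow> ?thesis" by (simp add: partial_sum_def pm_base_change_sum)
qed

section \<open>The convergent ring\<close>

lemma hyb_norm_nonneg [simp]: "0 \<le> hyb_norm z"
  and hyb_norm_0 [simp]: "hyb_norm 0 = 0"
  and norm_le_hyb_norm: "norm z \<le> hyb_norm z"
  by (auto simp: hyb_norm_def)

lemma hyb_norm_add: "hyb_norm (x + y) \<le> hyb_norm x + hyb_norm y"
  using norm_triangle_ineq[of x y] by (auto simp: hyb_norm_def)

lemma hyb_norm_mult: "hyb_norm (x * y) \<le> hyb_norm x * hyb_norm y"
proof (cases "x = 0 \<or> y = 0")
  case False
  have "1 * 1 \<le> max (norm x) 1 * max (norm y) 1" by (intro mult_mono) auto
  moreover have "norm x * norm y \<le> max (norm x) 1 * max (norm y) 1" by (intro mult_mono) auto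
  ultimately show ?thesis using False by (auto simp: hyb_norm_def norm_mult)
qed auto

lemma hyb_norm_sum: "hyb_norm (sum f A) \<le> (\<Sum>i\<in>A. hyb_norm (f i))"
  by (induction A rule: infinite_finite_induct) (auto intro: order_trans[OF hyb_norm_add])

lemma Aring_0 [simp]: "0 \<in> Aring m \<rho>"
  by (simp add: Aring_def)

lemma Aring_finite_support:
  assumes "finite {\<alpha>. fls_nth f \<alpha> \<noteq> 0}"
  shows "f \<in> Aring m \<rho>"
  unfolding Aring_def mem_Collect_eq
  by (rule iffD2[OF summable_on_cong_neutral summable_on_finite[OF assms]]) auto

lemma Aring_1 [simp]: "1 \<in> Aring m \<rho>"
  by (rule Aring_finite_support) (rule finite_subset[of _ "{0}"], auto)

lemma Aring_add:
  assumes "f \<in> Aring m \<rho>" "g \<in> Aring m \<rho>" shows "f + g \<in> Aring m \<rho>"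
proof -
  have "(\<lambda>\<alpha>::int. hyb_norm (fls_nth f \<alpha>) * \<rho> powr (real_of_int \<alpha> / real m) +
      hyb_norm (fls_nth g \<alpha>) * \<rho> powr (real_of_int \<alpha> / real m)) summable_on UNIV"
    using assms by (intro summable_on_add) (auto simp: Aring_def)
  then have "(\<lambda>\<alpha>::int. hyb_norm (fls_nth (f + g) \<alpha>) * \<rho> powr (real_of_int \<alpha> / real m)) summable_on UNIV"
    by (rule summable_on_comparison_test)
      (auto simp flip: distrib_right intro!: mult_right_mono hyb_norm_add)
  then show ?thesis by (simp add: Aring_def)
qed

text \<open>Submultiplicativity of \<open>hyb_norm\<close> dominates the terms of the product by the
  terms of a Cauchy product. A finite part of the latter, reindexed by pairs of exponents, lies in a
  finite rectangle, and the sum over a rectangle is at most the product of the two total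
  sums.\<close>

lemma Aring_mult:
  assumes f: "f \<in> Aring m \<rho>" and g: "g \<in> Aring m \<rho>" and \<rho>: "\<rho> > 0" shows "f * g \<in> Aring m \<rho>"
proof -
  define T :: "complex fls \<Rightarrow> int \<Rightarrow> real" where
    "T h \<alpha> = hyb_norm (fls_nth h \<alpha>) * \<rho> powr (real_of_int \<alpha> / real m)" for h \<alpha>
  have T0: "0 \<le> T h \<alpha>" for h \<alpha> by (simp add: T_def)
  have sf: "T f summable_on UNIV" and sg: "T g summable_on UNIV"
    using f g by (auto simp: Aring_def T_def[abs_def])
  have pow: "\<rho> powr (real_of_int \<gamma> / real m) = \<rho> powr (real_of_int i / real m) * \<rho> powr (real_of_int (\<gamma> - i) / real m)" for \<gamma> i
    using \<rho> by (simp flip: powr_add add_divide_distrib)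
  have Tm: "T (f * g) \<gamma> \<le> (\<Sum>i=fls_subdegree f..\<gamma> - fls_subdegree g. T f i * T g (\<gamma> - i))" for \<gamma>
  proof -
    have "hyb_norm (fls_nth (f * g) \<gamma>) \<le>
        (\<Sum>i=fls_subdegree f..\<gamma> - fls_subdegree g. hyb_norm (fls_nth f i) * hyb_norm (fls_nth g (\<gamma> - i)))"
      unfolding fls_times_nth(2)
      by (rule order_trans[OF hyb_norm_sum]) (intro sum_mono hyb_norm_mult)
    then have "T (f * g) \<gamma> \<le> (\<Sum>i=fls_subdegree f..\<gamma> - fls_subdegree g. hyb_norm (fls_nth f i) * hyb_norm (fls_nth g (\<gamma> - i))) * \<rho> powr (real_of_int \<gamma> / real m)"
      unfolding T_def by (intro mult_right_mono) auto
    also have "\<dots> = (\<Sum>i=fls_subdegree f..\<gamma> - fls_subdegree g. T f i * T g (\<gamma> - i))"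
      unfolding sum_distrib_right T_def proof (intro sum.cong refl)
      fix i
      show "hyb_norm (fls_nth f i) * hyb_norm (fls_nth g (\<gamma> - i)) * \<rho> powr (real_of_int \<gamma> / real m) =
        hyb_norm (fls_nth f i) * \<rho> powr (real_of_int i / real m) *
        (hyb_norm (fls_nth g (\<gamma> - i)) * \<rho> powr (real_of_int (\<gamma> - i) / real m))"
        unfolding pow[of \<gamma> i] by (simp only: mult_ac)
    qed
    finally show ?thesis .
  qed
  have "T (f * g) summable_on UNIV"
  proof (rule nonneg_bdd_above_summable_on)
    show "0 \<le> T (f * g) x" for x by (rule T0)
    show "bdd_above (sum (T (f * g)) ` {F. F \<subseteq> UNIV \<and> finite F})"
    proof (rule bdd_aboveI2)
      fix G assume "G \<in> {F. F \<subseteq> (UNIV::int set) \<and> finite F}"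
      then have fin: "finite G" by simp
      define P where "P = (SIGMA \<gamma>:G. {fls_subdegree f..\<gamma> - fls_subdegree g})"
      define h where "h = (\<lambda>(\<gamma>::int, i::int). (i, \<gamma> - i))"
      have finP: "finite P" unfolding P_def using fin by auto
      have inj: "inj_on h P" by (auto simp: inj_on_def h_def)
      have "sum (T (f * g)) G \<le> (\<Sum>\<gamma>\<in>G. \<Sum>i=fls_subdegree f..\<gamma> - fls_subdegree g. T f i * T g (\<gamma> - i))"
        by (intro sum_mono Tm)
      also have "\<dots> = (\<Sum>(\<gamma>, i)\<in>P. T f i * T g (\<gamma> - i))"
        unfolding P_def by (rule sum.Sigma) (use fin in auto)
      also have "\<dots> = (\<Sum>(i, j)\<in>h ` P. T f i * T g j)"
        by (subst sum.reindex[OF inj]) (auto simp: h_def case_prod_unfold)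
      also have "\<dots> \<le> (\<Sum>(i, j)\<in>fst ` h ` P \<times> snd ` h ` P. T f i * T g j)"
        by (intro sum_mono2 subset_fst_snd) (use finP in \<open>auto simp: T0\<close>)
      also have "\<dots> = sum (T f) (fst ` h ` P) * sum (T g) (snd ` h ` P)"
        by (simp add: sum_product sum.cartesian_product)
      also have "\<dots> \<le> infsum (T f) UNIV * infsum (T g) UNIV"
        using finP by (intro mult_mono finite_sum_le_infsum sf sg infsum_nonneg sum_nonneg) (auto simp: T0)
      finally show "sum (T (f * g)) G \<le> infsum (T f) UNIV * infsum (T g) UNIV" .
    qed
  qed
  then show ?thesis by (simp add: Aring_def T_def[abs_def])
qed

lemma disc_norm_less:
  assumes "s \<in> disc m \<rho>" "m \<ge> 1" "\<rho> > 0"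
  shows "norm s < \<rho> powr (1 / real m)"
proof (rule power_less_imp_less_base)
  have "(\<rho> powr (1 / real m)) ^ m = \<rho> powr (real m * (1 / real m))"
    using assms by (simp add: powr_power)
  then show "norm s ^ m < (\<rho> powr (1 / real m)) ^ m"
    using assms by (simp add: disc_def)
qed simp

text \<open>As \<open>hyb_norm\<close> dominates the complex norm, the part with nonnegative
  exponents converges at the radius \<open>\<rho> powr (1 / real m)\<close>, and the points of the
  disc lie strictly inside.\<close>

lemma Aring_conv_radius:
  assumes f: "f \<in> Aring m \<rho>" and s: "s \<in> disc m \<rho>" and m: "m \<ge> 1" and \<rho>: "\<rho> > 0"
  shows "ereal (norm s) < fls_conv_radius f"
proof -
  define R where "R = \<rho> powr (1 / real m)"
  have R: "R > 0" using \<rho> by (simp add: R_def)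
  have Rn: "R ^ n = \<rho> powr (real n / real m)" for n
    using \<rho> by (simp add: R_def powr_power)
  have "(\<lambda>\<alpha>::int. hyb_norm (fls_nth f \<alpha>) * \<rho> powr (real_of_int \<alpha> / real m)) summable_on range int"
    using f unfolding Aring_def by (auto intro: summable_on_subset_banach)
  then have "(\<lambda>n::nat. hyb_norm (fls_nth f (int n)) * R ^ n) summable_on UNIV"
    by (subst (asm) summable_on_reindex) (auto simp: o_def Rn)
  then have "summable (\<lambda>n::nat. hyb_norm (fls_nth f (int n)) * R ^ n)"
    by (rule summable_on_imp_summable)
  then have "summable (\<lambda>n. fls_nth f (int n) * of_real R ^ n)"
    by (rule summable_comparison_test[rotated])
      (use R in \<open>auto simp: norm_mult norm_power norm_le_hyb_norm intro!: exI[of _ 0] mult_right_mono\<close>)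
  then have "fls_conv_radius f \<ge> ereal R"
    using conv_radius_geI[of "\<lambda>n. fls_nth f (int n)" "of_real R"] R
    by (simp add: fls_conv_radius_def fps_conv_radius_def)
  moreover have "norm s < R" using disc_norm_less[OF s m \<rho>] by (simp add: R_def)
  ultimately show ?thesis by (meson ereal_less(2) less_ereal.simps(1) order.strict_trans2)
qed

text \<open>Shrinking the radius decreases the terms with nonnegative exponents and increases the
  others, of which there are only finitely many. The exponents of the composite are multiples of
  \<open>m\<close>, which cancels the denominator \<open>m\<close> in the weights.\<close>

lemma Aring_compose_power:
  assumes f: "f \<in> Aring 1 (exp (-1))" and m: "m \<ge> 1" and \<rho>: "0 < \<rho>" "\<rho> \<le> exp (-1)"
  shows "fls_compose_power f m \<in> Aring m \<rho>"
proof -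
  have 1: "(\<lambda>\<beta>::int. hyb_norm (fls_nth f \<beta>) * \<rho> powr real_of_int \<beta>) summable_on {0..}"
  proof (rule summable_on_comparison_test)
    show "(\<lambda>\<beta>::int. hyb_norm (fls_nth f \<beta>) * exp (-1) powr real_of_int \<beta>) summable_on {0..}"
      using f unfolding Aring_def by (auto intro: summable_on_subset_banach)
  qed (use \<rho> in \<open>auto intro!: mult_left_mono powr_mono2\<close>)
  have 2: "(\<lambda>\<beta>::int. hyb_norm (fls_nth f \<beta>) * \<rho> powr real_of_int \<beta>) summable_on {..<0}"
  proof -
    have "(\<lambda>\<beta>::int. hyb_norm (fls_nth f \<beta>) * \<rho> powr real_of_int \<beta>) summable_on {fls_subdegree f..<0}"
      by (rule summable_on_finite) simp
    then show ?thesis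
      by (rule iffD1[OF summable_on_cong_neutral, rotated -1]) (auto simp: fls_eq0_below_subdegree)
  qed
  have "(\<lambda>\<beta>::int. hyb_norm (fls_nth f \<beta>) * \<rho> powr real_of_int \<beta>) summable_on ({0..} \<union> {..<0})"
    by (rule summable_on_Un_disjoint[OF 1 2]) auto
  also have "({0..} \<union> {..<0}) = (UNIV :: int set)" by auto
  finally have *: "(\<lambda>\<beta>::int. hyb_norm (fls_nth f \<beta>) * \<rho> powr real_of_int \<beta>) summable_on UNIV" .
  have inj: "inj (\<lambda>\<beta>::int. int m * \<beta>)" using m by (auto simp: inj_on_def)
  have "(\<lambda>\<alpha>::int. hyb_norm (fls_nth (fls_compose_power f m) \<alpha>) * \<rho> powr (real_of_int \<alpha> / real m))
     summable_on range (\<lambda>\<beta>. int m * \<beta>)"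
    unfolding summable_on_reindex[OF inj] using * m by (simp add: o_def fls_nth_compose_power)
  then show ?thesis unfolding Aring_def mem_Collect_eq
    by (rule iffD1[OF summable_on_cong_neutral, rotated -1])
      (use m in \<open>auto simp: fls_nth_compose_power image_iff dvd_def\<close>)
qed

lemma fls_subdegree_compose_power:
  assumes "m \<ge> 1" "f \<noteq> 0"
  shows "fls_subdegree (fls_compose_power f m) = int m * fls_subdegree f"
proof (rule fls_subdegree_eqI)
  show "fls_nth (fls_compose_power f m) (int m * fls_subdegree f) \<noteq> 0"
    using assms by (simp add: fls_nth_compose_power)
  fix k assume "k < int m * fls_subdegree f"
  then show "fls_nth (fls_compose_power f m) k = 0"
    using assms by (auto simp: fls_nth_compose_power dvd_def fls_eq0_below_subdegree)
qed

lemma absK_compose_power: "m \<ge> 1 \<Longrightarrow> absK m (fls_compose_power f m) = absK 1 f"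
  by (auto simp: absK_def fls_subdegree_compose_power)

text \<open>The expansion of the composite is that of \<open>f\<close> at \<open>s ^ m\<close> with
  zero terms inserted at the indices not divisible by \<open>m\<close>; \<open>h\<close> is its
  sequence of terms, counted from the subdegree.\<close>

lemma eval_fls_compose_power:
  assumes m: "m \<ge> 1" and s: "s \<noteq> 0" and conv: "ereal (norm (s ^ m)) < fls_conv_radius f"
  shows "eval_fls (fls_compose_power f m) s = eval_fls f (s ^ m)"
proof (cases "f = 0")
  case False
  define n where "n = fls_subdegree f"
  have "(\<lambda>k. fls_nth f (int k + n) * (s ^ m) powi (int k + n)) sums eval_fls f (s ^ m)"
    unfolding n_def by (rule sums_eval_fls) (use conv s in auto)
  moreover have "(s ^ m) powi j = s powi (int m * j)" for j
    by (simp add: power_int_power)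
  ultimately have *: "(\<lambda>k. fls_nth f (int k + n) * s powi (int m * (int k + n))) sums eval_fls f (s ^ m)"
    by simp
  define h where "h = (\<lambda>j. fls_nth (fls_compose_power f m) (int j + int m * n) * s powi (int j + int m * n))"
  have sm: "strict_mono (\<lambda>k::nat. m * k)" using m by (auto intro!: strict_monoI)
  have z: "h j = 0" if "j \<notin> range (\<lambda>k. m * k)" for j
  proof -
    have "\<not> int m dvd int j + int m * n"
      using that by (subst dvd_add_left_iff) (auto simp: image_iff elim!: dvdE)
    then show ?thesis using m by (simp add: h_def fls_nth_compose_power)
  qed
  have "(\<lambda>k. h (m * k)) = (\<lambda>k. fls_nth f (int k + n) * s powi (int m * (int k + n)))"
  proof
    fix k
    have e: "int (m * k) + int m * n = int m * (int k + n)" by (simp add: distrib_left)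
    show "h (m * k) = fls_nth f (int k + n) * s powi (int m * (int k + n))"
      unfolding h_def e using m by (simp add: fls_nth_compose_power)
  qed
  then have "h sums eval_fls f (s ^ m)"
    using * sums_mono_reindex[OF sm, of h] z by simp
  then show ?thesis unfolding h_def
    by (intro eval_fls_eq) (use s m False in \<open>auto simp: fls_subdegree_compose_power n_def\<close>)
qed simp

section \<open>The points of the base and their limit at the center\<close>

text \<open>The upper bound is where the radius \<open>exp (-1)\<close> enters: a norm raised to a
  power between 0 and 1 still satisfies the triangle inequality.\<close>

lemma cfun_bounds:
  assumes "t \<noteq> 0" "norm t < exp (-1)" shows "0 < cfun t" "cfun t < 1"
proof -
  have "ln (norm t) < ln (exp (-1))" using assms by (subst ln_less_cancel_iff) auto
  then have "ln (norm t) < -1" by simp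
  then show "0 < cfun t" "cfun t < 1" by (auto simp: cfun_def field_simps)
qed

lemma disc_power: "s \<in> disc m \<rho> \<Longrightarrow> \<rho> \<le> exp (-1) \<Longrightarrow> s ^ m \<in> disc 1 (exp (-1))"
  by (auto simp: disc_def norm_power)

lemma base_pt_compose_power:
  assumes a: "a \<in> Aring 1 (exp (-1))" and m: "m \<ge> 1" and s: "s \<in> disc m \<rho>" and \<rho>: "\<rho> \<le> exp (-1)"
  shows "base_pt m s (fls_compose_power a m) = base_pt 1 (s ^ m) a"
  using m Aring_conv_radius[OF a disc_power[OF s \<rho>]]
  by (auto simp: base_pt_def absK_compose_power eval_fls_compose_power)

text \<open>Write \<open>f\<close> as the product of the \<open>d\<close>-th power of the variable
  and a power series \<open>F\<close> with nonzero constant term. Since \<open>cfun (s ^ m)\<close>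
  is \<open>- 1 / (m * ln (norm s))\<close>, the contribution of \<open>F\<close> to the exponent is
  \<open>ln (norm (F s))\<close> divided by something tending to minus infinity, and that of the
  monomial is exactly \<open>- d / m\<close>.\<close>

lemma base_pt_tendsto:
  assumes f: "f \<in> Aring m \<rho>" and m: "m \<ge> 1" and \<rho>: "\<rho> > 0"
  shows "((\<lambda>s. base_pt m s f) \<longlongrightarrow> absK m f) (at 0)"
proof (cases "f = 0")
  case True
  have "eventually (\<lambda>s. base_pt m s f = absK m f) (at 0)"
    using True by (auto simp: base_pt_def absK_def eventually_at_filter)
  then show ?thesis by (rule tendsto_eventually)
next
  case False
  define d where "d = fls_subdegree f"
  define F where "F = fls_base_factor_to_fps f"
  have "(0::complex) \<in> disc m \<rho>" using m \<rho> by (simp add: disc_def power_0_left)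
  from Aring_conv_radius[OF f this m \<rho>] have "fps_conv_radius F > 0"
    by (simp add: F_def fls_conv_radius_altdef zero_ereal_def)
  then have "isCont (eval_fps F) 0"
    by (intro continuous_eval_fps) (auto simp: zero_ereal_def)
  then have lim: "((eval_fps F) \<longlongrightarrow> fps_nth F 0) (at 0)"
    by (simp add: isCont_def eval_fps_at_0)
  have F0: "fps_nth F 0 \<noteq> 0" using False by (simp add: F_def)
  have ev: "eventually (\<lambda>s. eval_fps F s \<noteq> 0) (at 0)"
    using tendsto_imp_eventually_ne[OF lim F0] .
  have lninf: "filterlim (\<lambda>s::complex. ln (norm s)) at_bot (at 0)"
    by (rule filterlim_compose[OF ln_at_0]) (auto simp: filterlim_at tendsto_norm_zero eventually_at_filter intro!: tendsto_norm_zero)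
  have "((\<lambda>s. ln (norm (eval_fps F s)) / ln (norm s)) \<longlongrightarrow> 0) (at 0)"
    by (rule tendsto_divide_0[OF tendsto_ln[OF tendsto_norm[OF lim]]
          filterlim_mono[OF lninf at_bot_le_at_infinity order.refl]]) (use F0 in auto)
  then have "((\<lambda>s. exp (- (ln (norm (eval_fps F s)) / ln (norm s)) / real m - real_of_int d / real m)) \<longlongrightarrow>
      exp (- 0 / real m - real_of_int d / real m)) (at 0)"
    by (intro tendsto_intros) (use m in auto)
  moreover have "eventually (\<lambda>s. exp (- (ln (norm (eval_fps F s)) / ln (norm s)) / real m - real_of_int d / real m) = base_pt m s f) (at 0)"
  proof -
    have "eventually (\<lambda>s::complex. ln (norm s) < 0) (at 0)"
      using lninf by (auto simp: filterlim_at_bot_dense)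
    moreover have "eventually (\<lambda>s::complex. s \<noteq> 0) (at 0)" by (simp add: eventually_at_filter)
    ultimately show ?thesis using ev
    proof eventually_elim
      case (elim s)
      have "norm (eval_fls f s) = norm (eval_fps F s) * norm s powr real_of_int d"
        using elim by (simp add: eval_fls_def F_def d_def norm_mult norm_power_int powr_real_of_int')
      then have "ln (norm (eval_fls f s)) = ln (norm (eval_fps F s)) + real_of_int d * ln (norm s)"
        using elim by (simp add: ln_mult ln_powr)
      moreover have "eval_fls f s \<noteq> 0" using elim by (auto simp: eval_fls_def F_def)
      moreover have "cfun (s ^ m) = - 1 / (real m * ln (norm s))"
        using elim by (simp add: cfun_def norm_power ln_realpow)
      moreover have "- 1 / (real m * ln (norm s)) * (ln (norm (eval_fps F s)) + real_of_int d * ln (norm s)) =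
          - (ln (norm (eval_fps F s)) / ln (norm s)) / real m - real_of_int d / real m"
        using elim m by (simp add: field_simps)
      ultimately show ?case using elim
        by (simp add: base_pt_def powr_def)
    qed
  qed
  ultimately have "((\<lambda>s. base_pt m s f) \<longlongrightarrow> exp (- 0 / real m - real_of_int d / real m)) (at 0)"
    using tendsto_cong by fast
  then show ?thesis using False by (simp add: absK_def d_def)
qed

section \<open>Homogeneous polynomials\<close>

lemma homog_mult:
  assumes "homog w d f" "homog w d' g" shows "homog w (d + d') (f * g)"
  unfolding homog_def
proof
  fix e assume "e \<in> Poly_Mapping.keys (f * g)"
  then obtain e1 e2 where "e = e1 + e2" "e1 \<in> Poly_Mapping.keys f" "e2 \<in> Poly_Mapping.keys g"
    using keys_mult by blast
  then show "(\<Sum>i\<in>UNIV. w i * Poly_Mapping.lookup e i) = d + d'"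
    using assms by (auto simp: homog_def lookup_add distrib_left sum.distrib)
qed

lemma homog_add: "homog w d f \<Longrightarrow> homog w d g \<Longrightarrow> homog w d (f + g)"
  using keys_add[of f g] by (auto simp: homog_def)

lemma homog_pconst: "homog w 0 (pconst a)"
  by (auto simp: homog_def pconst_def)

lemma homog_1: "homog w 0 1"
  by (auto simp: homog_def)

lemma homog_pvar: "homog w (w i) (pvar i)"
proof -
  have "(\<Sum>j\<in>UNIV. w j * Poly_Mapping.lookup (Poly_Mapping.single i 1) j) = (\<Sum>j\<in>UNIV. if j = i then w i else 0)"
    by (rule sum.cong) (auto simp: lookup_single when_def)
  then show ?thesis by (auto simp: homog_def pvar_def)
qed

lemma homog_power: "homog w d f \<Longrightarrow> homog w (n * d) (f ^ n)"
  by (induction n) (auto simp: homog_1 intro: homog_mult)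

lemma homog_prod:
  assumes "\<And>i. i \<in> A \<Longrightarrow> homog w (d i) (F i)"
  shows "homog w (sum d A) (prod F A)"
  using assms by (induction A rule: infinite_finite_induct) (auto intro: homog_mult homog_1)

lemma homog_base_change: "m \<ge> 1 \<Longrightarrow> homog w d (base_change m f) \<longleftrightarrow> homog w d f"
  by (simp add: homog_def base_change_eq)

lemma coeff_hom_peval:
  assumes m: "m \<ge> 1" and \<rho>: "\<rho> > 0" and s: "s \<in> disc m \<rho>" "s \<noteq> 0"
  shows "coeff_hom (Aring m \<rho>) (\<lambda>a. eval_fls a s) (\<lambda>e. \<Prod>i\<in>UNIV. ((z :: complex ^ 'n::finite) $ i) ^ Poly_Mapping.lookup e i)"
  by unfold_locales
    (use assms in \<open>auto simp: Aring_add Aring_mult lookup_add power_add prod.distrib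
        intro!: eval_fls_add eval_fls_mult Aring_conv_radius\<close>)

lemma peval_eq_pm_eval:
  "peval f s z = pm_eval (\<lambda>a. eval_fls a s) (\<lambda>e. \<Prod>i\<in>UNIV. (z $ i) ^ Poly_Mapping.lookup e i) f"
  by (simp add: peval_def pm_eval_def)

text \<open>Evaluation by zero: it serves only to make the closure lemmas of the locale, which speak
  of \<open>B\<close>, available for \<open>Aring\<close>.\<close>

lemma coeff_hom_Aring:
  "\<rho> > 0 \<Longrightarrow> coeff_hom (Aring m \<rho>) (\<lambda>_. 0::real) (\<lambda>_::('n \<Rightarrow>\<^sub>0 nat). 0)"
  by unfold_locales (auto simp: Aring_add Aring_mult)

lemma polys_over_add: "\<lbrakk>f \<in> polys_over (Aring m \<rho>); g \<in> polys_over (Aring m \<rho>)\<rbrakk> \<Longrightarrow> f + g \<in> polys_over (Aring m \<rho>)"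
  by (auto simp: polys_over_def lookup_add Aring_add)

lemma polys_over_mult:
  "\<lbrakk>f \<in> polys_over (Aring m \<rho>); g \<in> polys_over (Aring m \<rho>); \<rho> > 0\<rbrakk> \<Longrightarrow> f * g \<in> polys_over (Aring m \<rho>)"
  using coeff_hom.lookup_mult_in[OF coeff_hom_Aring] by (auto simp: polys_over_def)

lemma polys_over_pconst: "a \<in> Aring m \<rho> \<Longrightarrow> pconst a \<in> polys_over (Aring m \<rho>)"
  by (auto simp: polys_over_def pconst_def lookup_single when_def)

lemma polys_over_pvar: "pvar i \<in> polys_over (Aring m \<rho>)"
  by (auto simp: polys_over_def pvar_def lookup_single when_def)

lemma polys_over_1: "1 \<in> polys_over (Aring m \<rho>)"
  by (auto simp: polys_over_def lookup_one when_def)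

lemma polys_over_power: "\<lbrakk>f \<in> polys_over (Aring m \<rho>); \<rho> > 0\<rbrakk> \<Longrightarrow> f ^ n \<in> polys_over (Aring m \<rho>)"
  by (induction n) (auto intro: polys_over_mult polys_over_1)

lemma polys_over_prod:
  assumes "\<And>i. i \<in> A \<Longrightarrow> F i \<in> polys_over (Aring m \<rho>)" "\<rho> > 0"
  shows "prod F A \<in> polys_over (Aring m \<rho>)"
  using assms(1) by (induction A rule: infinite_finite_induct) (auto intro: polys_over_mult polys_over_1 assms(2))

lemma polys_over_base_change:
  "\<lbrakk>f \<in> polys_over (Aring 1 (exp (-1))); m \<ge> 1; 0 < \<rho>; \<rho> \<le> exp (-1)\<rbrakk> \<Longrightarrow> base_change m f \<in> polys_over (Aring m \<rho>)"
  by (auto simp: polys_over_def base_change_eq Aring_compose_power)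

lemma hpolysI: "f \<in> polys_over B \<Longrightarrow> homog w d f \<Longrightarrow> f \<in> hpolys w B"
  by (auto simp: hpolys_def)

lemma hpolys_mult:
  "\<lbrakk>f \<in> hpolys w (Aring m \<rho>); g \<in> hpolys w (Aring m \<rho>); \<rho> > 0\<rbrakk> \<Longrightarrow> f * g \<in> hpolys w (Aring m \<rho>)"
  by (auto simp: hpolys_def intro: polys_over_mult homog_mult)

lemma hpolys_pconst: "a \<in> Aring m \<rho> \<Longrightarrow> pconst a \<in> hpolys w (Aring m \<rho>)"
  by (rule hpolysI[OF polys_over_pconst homog_pconst])

lemma hpolys_pvar: "pvar i \<in> hpolys w (Aring m \<rho>)"
  by (rule hpolysI[OF polys_over_pvar homog_pvar])

lemma hpolys_base_change:
  "\<lbrakk>f \<in> hpolys w (Aring 1 (exp (-1))); m \<ge> 1; 0 < \<rho>; \<rho> \<le> exp (-1)\<rbrakk> \<Longrightarrow> base_change m f \<in> hpolys w (Aring m \<rho>)"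
  by (auto simp: hpolys_def homog_base_change polys_over_base_change)

lemma base_change_mult: "base_change m (f * g) = base_change m f * base_change m g"
  and base_change_add: "base_change m (f + g) = base_change m f + base_change m g"
  by (simp_all add: base_change_eq)

lemma base_change_pvar: "m \<ge> 1 \<Longrightarrow> base_change m (pvar i) = pvar i"
  by (simp add: base_change_eq pvar_def)

lemma base_change_pconst: "base_change m (pconst a) = pconst (fls_compose_power a m)"
  by (simp add: base_change_eq pconst_def)

lemma base_change_1: "base_change 1 f = f"
  by (rule poly_mapping_eqI, rule fls_eqI) (simp add: base_change_eq fls_nth_compose_power)

section \<open>Evaluation on the cone\<close>

lemma peval_add:
  assumes "m \<ge> 1" "\<rho> > 0" "s \<in> disc m \<rho>" "s \<noteq> 0" "f \<in> polys_over (Aring m \<rho>)" "g \<in> polys_over (Aring m \<rho>)"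
  shows "peval (f + g) s z = peval f s z + peval g s z"
  using coeff_hom.pm_eval_add[OF coeff_hom_peval[OF assms(1-4)]] assms(5,6)
  by (simp add: peval_eq_pm_eval polys_over_def)

lemma peval_sum:
  assumes "m \<ge> 1" "\<rho> > 0" "s \<in> disc m \<rho>" "s \<noteq> 0" "\<And>i. i \<in> A \<Longrightarrow> F i \<in> polys_over (Aring m \<rho>)"
  shows "peval (sum F A) s z = (\<Sum>i\<in>A. peval (F i) s z)"
  using coeff_hom.pm_eval_sum[OF coeff_hom_peval[OF assms(1-4)], of A F] assms(5)
  by (simp add: peval_eq_pm_eval polys_over_def)

lemma peval_mult:
  assumes "m \<ge> 1" "\<rho> > 0" "s \<in> disc m \<rho>" "s \<noteq> 0" "f \<in> polys_over (Aring m \<rho>)" "g \<in> polys_over (Aring m \<rho>)"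
  shows "peval (f * g) s z = peval f s z * peval g s z"
  using coeff_hom.pm_eval_mult[OF coeff_hom_peval[OF assms(1-4)]] assms(5,6)
  by (simp add: peval_eq_pm_eval polys_over_def)

lemma peval_pconst: "peval (pconst a) s z = eval_fls a s"
  by (cases "a = 0") (auto simp: peval_def pconst_def)

lemma peval_pvar: "peval (pvar i) s z = z $ i"
proof -
  have "(\<Prod>j\<in>UNIV. (z $ j) ^ Poly_Mapping.lookup (Poly_Mapping.single i 1) j) = (\<Prod>j\<in>UNIV. if j = i then z $ i else 1)"
    by (rule prod.cong) (auto simp: lookup_single when_def)
  then show ?thesis by (auto simp: peval_def pvar_def eval_fls_def)
qed

lemma peval_base_change:
  assumes f: "f \<in> polys_over (Aring 1 (exp (-1)))" and m: "m \<ge> 1" and s: "s \<in> disc m \<rho>" "s \<noteq> 0" and \<rho>: "\<rho> \<le> exp (-1)"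
  shows "peval (base_change m f) s z = peval f (s ^ m) z"
proof -
  have "eval_fls (fls_compose_power (Poly_Mapping.lookup f e) m) s = eval_fls (Poly_Mapping.lookup f e) (s ^ m)" for e
    by (rule eval_fls_compose_power[OF m s(2)])
      (use f in \<open>auto intro!: Aring_conv_radius[of _ 1 "exp (-1)"] disc_power[OF s(1) \<rho>] simp: polys_over_def\<close>)
  then show ?thesis using m by (simp add: peval_def base_change_eq)
qed

lemma peval_act:
  assumes "homog w d f" shows "peval f s (act w c z) = c ^ d * peval f s z"
proof -
  have "(\<Prod>i\<in>UNIV. (act w c z $ i) ^ Poly_Mapping.lookup e i) = c ^ d * (\<Prod>i\<in>UNIV. (z $ i) ^ Poly_Mapping.lookup e i)"
    if "e \<in> Poly_Mapping.keys f" for e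
    using assms that by (auto simp: act_def power_mult_distrib prod.distrib homog_def
        simp flip: power_mult power_sum)
  then show ?thesis unfolding peval_def sum_distrib_left
    by (intro sum.cong) (auto simp: algebra_simps)
qed

text \<open>A member of \<open>I\<close> need not be homogeneous, but it is a sum of homogeneous
  members of \<open>I\<close>, and each of these is only multiplied by a power of \<open>c\<close>
  under the action.\<close>

lemma act_in_ccone:
  assumes I: "homog_ideal w (Aring 1 (exp (-1))) I" and t: "t \<noteq> 0" "norm t < exp (-1)"
    and z: "z \<in> ccone I t" and c: "c \<noteq> 0"
  shows "act w c z \<in> ccone I t"
proof -
  have td: "t \<in> disc 1 (exp (-1))" using t by (simp add: disc_def)
  have "peval f t (act w c z) = 0" if "f \<in> I" for f
  proof -
    have "\<forall>f\<in>I. \<exists>G. finite G \<and> G \<subseteq> I \<inter> hpolys w (Aring 1 (exp (-1))) \<and> f = \<Sum>G"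
      using I unfolding homog_ideal_def by (elim conjE)
    then obtain G where G: "finite G" "G \<subseteq> I \<inter> hpolys w (Aring 1 (exp (-1)))" "f = \<Sum>G"
      using \<open>f \<in> I\<close> by meson
    have "peval f t (act w c z) = (\<Sum>g\<in>G. peval g t (act w c z))"
      unfolding G(3) by (rule peval_sum[OF _ _ td t(1)]) (use G(2) in \<open>auto simp: hpolys_def\<close>)
    also have "\<dots> = 0"
    proof (rule sum.neutral, rule ballI)
      fix g assume "g \<in> G"
      then obtain d where "homog w d g" "g \<in> I" using G by (auto simp: hpolys_def)
      then show "peval g t (act w c z) = 0" using z by (simp add: peval_act ccone_def)
    qed
    finally show ?thesis .
  qed
  moreover have "act w c z \<noteq> 0"
    using z c by (auto simp: act_def ccone_def vec_eq_iff)
  ultimately show ?thesis by (simp add: ccone_def)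
qed

section \<open>Points of the complex cones as seminorms\<close>

text \<open>After division by \<open>x + y\<close> both summands lie in the unit interval, where
  \<open>u\<close> is at most \<open>u powr c\<close>.\<close>

lemma powr_add_le:
  fixes x y c :: real
  assumes "0 \<le> x" "0 \<le> y" "0 < c" "c \<le> 1"
  shows "(x + y) powr c \<le> x powr c + y powr c"
proof (cases "x + y = 0")
  case False
  then have p: "x + y > 0" using assms by auto
  have *: "u \<le> u powr c" if "0 \<le> u" "u \<le> 1" for u
    using that assms powr_mono'[of c 1 u] by (cases "u = 0") auto
  have "1 = x / (x + y) + y / (x + y)" using p by (simp flip: add_divide_distrib)
  also have "\<dots> \<le> (x / (x + y)) powr c + (y / (x + y)) powr c"
    using assms p by (intro add_mono *) (auto simp: field_simps)
  also have "\<dots> = (x powr c + y powr c) / (x + y) powr c"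
    using assms p by (simp add: powr_divide add_divide_distrib)
  finally show ?thesis using p by (simp add: field_simps)
qed (use assms in auto)

lemma hcone_mult:
  "\<lbrakk>v \<in> hcone w I m \<rho> s; f \<in> hpolys w (Aring m \<rho>); g \<in> hpolys w (Aring m \<rho>)\<rbrakk> \<Longrightarrow> v (f * g) = v f * v g"
  unfolding hcone_def by blast

lemma hcone_add:
  "\<lbrakk>v \<in> hcone w I m \<rho> s; f \<in> polys_over (Aring m \<rho>); g \<in> polys_over (Aring m \<rho>); homog w d f; homog w d g\<rbrakk>
    \<Longrightarrow> v (f + g) \<le> v f + v g"
  unfolding hcone_def by blast

lemma hcone_pconst: "\<lbrakk>v \<in> hcone w I m \<rho> s; a \<in> Aring m \<rho>\<rbrakk> \<Longrightarrow> v (pconst a) = base_pt m s a"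
  unfolding hcone_def by blast

lemma hcone_ideal: "\<lbrakk>v \<in> hcone w I m \<rho> s; f \<in> I\<rbrakk> \<Longrightarrow> v (base_change m f) = 0"
  unfolding hcone_def by blast

lemma hcone_pvar: "v \<in> hcone w I m \<rho> s \<Longrightarrow> \<exists>i. v (pvar i) \<noteq> 0"
  unfolding hcone_def by blast

lemma hcone_nonneg: "v \<in> hcone w I m \<rho> s \<Longrightarrow> 0 \<le> v f"
  unfolding hcone_def by blast

lemma cpoint_in_hcone:
  assumes I: "I \<subseteq> polys_over (Aring 1 (exp (-1)))" and m: "m \<ge> 1" and \<rho>: "0 < \<rho>" "\<rho> \<le> exp (-1)"
    and s: "s \<in> disc m \<rho>" "s \<noteq> 0" and z: "z \<in> ccone I (s ^ m)"
  shows "cpoint w m \<rho> s z \<in> hcone w I m \<rho> s"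
proof -
  have c: "0 < cfun (s ^ m)" "cfun (s ^ m) < 1"
    using cfun_bounds[of "s ^ m"] disc_power[OF s(1) \<rho>(2)] s(2) by (auto simp: disc_def)
  obtain i where i: "z $ i \<noteq> 0" using z by (auto simp: ccone_def vec_eq_iff)
  show ?thesis unfolding hcone_def mem_Collect_eq
  proof (intro conjI allI impI ballI)
    fix f g assume fg: "f \<in> hpolys w (Aring m \<rho>)" "g \<in> hpolys w (Aring m \<rho>)"
    have "f * g \<in> hpolys w (Aring m \<rho>)"
      by (rule hpolys_mult[OF fg \<rho>(1)])
    moreover have "peval (f * g) s z = peval f s z * peval g s z"
      by (rule peval_mult[OF m \<rho>(1) s]) (use fg in \<open>auto simp: hpolys_def\<close>)
    ultimately show "cpoint w m \<rho> s z (f * g) = cpoint w m \<rho> s z f * cpoint w m \<rho> s z g"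
      using fg by (simp add: cpoint_def norm_mult powr_mult)
  next
    fix d f g assume fg: "f \<in> polys_over (Aring m \<rho>)" "g \<in> polys_over (Aring m \<rho>)" "homog w d f \<and> homog w d g"
    then have "f \<in> hpolys w (Aring m \<rho>)" "g \<in> hpolys w (Aring m \<rho>)" "f + g \<in> hpolys w (Aring m \<rho>)"
      by (auto intro!: hpolysI polys_over_add homog_add)
    moreover have "norm (peval (f + g) s z) powr cfun (s ^ m) \<le> (norm (peval f s z) + norm (peval g s z)) powr cfun (s ^ m)"
      unfolding peval_add[OF m \<rho>(1) s fg(1,2)] using c by (intro powr_mono2 norm_triangle_ineq) auto
    moreover have "\<dots> \<le> norm (peval f s z) powr cfun (s ^ m) + norm (peval g s z) powr cfun (s ^ m)"
      using c by (intro powr_add_le) auto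
    ultimately show "cpoint w m \<rho> s z (f + g) \<le> cpoint w m \<rho> s z f + cpoint w m \<rho> s z g"
      by (simp add: cpoint_def)
  next
    fix f assume "f \<in> I"
    then have "peval (base_change m f) s z = 0"
      using I z by (subst peval_base_change[OF _ m s \<rho>(2)]) (auto simp: ccone_def)
    then show "cpoint w m \<rho> s z (base_change m f) = 0" by (simp add: cpoint_def)
  next
    show "\<exists>i. cpoint w m \<rho> s z (pvar i) \<noteq> 0"
      using i by (intro exI[of _ i]) (auto simp: cpoint_def hpolys_pvar peval_pvar)
  qed (use s in \<open>auto simp: cpoint_def base_pt_def hpolys_pconst peval_pconst\<close>)
qed

lemma cpoint_act:
  assumes "c \<noteq> 0"
  shows "rescaled w (Aring m \<rho>) (norm c powr cfun (s ^ m)) (cpoint w m \<rho> s z) (cpoint w m \<rho> s (act w c z))"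
  unfolding rescaled_def
proof (intro allI ballI impI)
  fix d f assume f: "f \<in> polys_over (Aring m \<rho>)" "homog w d f"
  have "norm (c ^ d) powr cfun (s ^ m) = (norm c powr cfun (s ^ m)) ^ d"
    using assms by (simp add: norm_power powr_powr powr_power mult.commute flip: powr_realpow)
  then show "cpoint w m \<rho> s (act w c z) f = (norm c powr cfun (s ^ m)) ^ d * cpoint w m \<rho> s z f"
    using f by (simp add: cpoint_def hpolysI peval_act norm_mult powr_mult)
qed

text \<open>Meant for monomials in the coordinates which do not vanish at \<open>v\<close>:
  quotients of such monomials trivialize the line bundle near \<open>v\<close>. The value at 1 is
  nonzero because it acts as an identity on some nonzero \<open>v (pvar i)\<close>.\<close>

lemma hcone_prod_nonzero:
  assumes v: "v \<in> hcone w I m \<rho> s" and \<rho>: "\<rho> > 0" and "\<And>i. i \<in> A \<Longrightarrow> v (pvar i) \<noteq> 0" and "finite A"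
  shows "v (\<Prod>i\<in>A. pvar i ^ p i) \<noteq> 0"
proof -
  have mult: "v (f * g) = v f * v g" if "f \<in> hpolys w (Aring m \<rho>)" "g \<in> hpolys w (Aring m \<rho>)" for f g
    using hcone_mult[OF v that] .
  have 1: "1 \<in> hpolys w (Aring m \<rho>)" by (rule hpolysI[OF polys_over_1 homog_1])
  have pw: "pvar i ^ n \<in> hpolys w (Aring m \<rho>)" for i n
    by (rule hpolysI[OF polys_over_power[OF polys_over_pvar \<rho>] homog_power[OF homog_pvar]])
  have "\<exists>i. v (pvar i) \<noteq> 0" by (rule hcone_pvar[OF v])
  then have v1: "v 1 \<noteq> 0" using mult[OF 1 hpolys_pvar] by auto
  have vp: "v (pvar i ^ n) \<noteq> 0" if "v (pvar i) \<noteq> 0" for i n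
    using that by (induction n) (auto simp: v1 mult[OF hpolys_pvar pw])
  show ?thesis using \<open>finite A\<close> assms(3)
  proof (induction A)
    case (insert i A)
    have "(\<Prod>i\<in>A. pvar i ^ p i) \<in> hpolys w (Aring m \<rho>)"
      by (rule hpolysI[OF polys_over_prod[OF polys_over_power[OF polys_over_pvar \<rho>] \<rho>]
            homog_prod[OF homog_power[OF homog_pvar]]])
    with insert show ?case by (simp add: mult[OF pw] vp)
  qed (simp add: v1)
qed

section \<open>Restriction of seminorms along the base change\<close>

text \<open>The projection from the base-changed hybrid space to the original one. The value 0
  elsewhere is the convention of \<open>hcone\<close> for non-homogeneous arguments.\<close>

definition restrict_pt :: "('n::finite \<Rightarrow> nat) \<Rightarrow> nat \<Rightarrow> 'n hpoint \<Rightarrow> 'n hpoint" where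
  "restrict_pt w m v f = (if f \<in> hpolys w (Aring 1 (exp (-1))) then v (base_change m f) else 0)"

lemma restrict_pt_in_hcone:
  assumes m: "m \<ge> 1" and \<rho>: "0 < \<rho>" "\<rho> \<le> exp (-1)" and s: "s \<in> disc m \<rho>"
    and v: "v \<in> hcone w I m \<rho> s"
  shows "restrict_pt w m v \<in> hcone w I 1 (exp (-1)) (s ^ m)"
  unfolding hcone_def mem_Collect_eq
proof (intro conjI allI impI ballI)
  note bc = hpolys_base_change[OF _ m \<rho>]
  show "0 \<le> restrict_pt w m v f" for f using hcone_nonneg[OF v] by (simp add: restrict_pt_def)
  fix f
  show "restrict_pt w m v f = 0" if "f \<notin> hpolys w (Aring 1 (exp (-1)))" using that by (simp add: restrict_pt_def)
  show "restrict_pt w m v (f * g) = restrict_pt w m v f * restrict_pt w m v g"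
    if "f \<in> hpolys w (Aring 1 (exp (-1)))" "g \<in> hpolys w (Aring 1 (exp (-1)))" for g
    using that hcone_mult[OF v bc[OF that(1)] bc[OF that(2)]] hpolys_mult[OF that] by (simp add: restrict_pt_def base_change_mult)
  show "restrict_pt w m v (base_change 1 f) = 0" if "f \<in> I"
    using hcone_ideal[OF v that] unfolding restrict_pt_def base_change_1 by simp
next
  fix d f g assume fg: "f \<in> polys_over (Aring 1 (exp (-1)))" "g \<in> polys_over (Aring 1 (exp (-1)))" "homog w d f \<and> homog w d g"
  then have "f \<in> hpolys w (Aring 1 (exp (-1)))" "g \<in> hpolys w (Aring 1 (exp (-1)))" "f + g \<in> hpolys w (Aring 1 (exp (-1)))"
    by (auto intro!: hpolysI polys_over_add homog_add)
  moreover have "v (base_change m f + base_change m g) \<le> v (base_change m f) + v (base_change m g)"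
    by (rule hcone_add[OF v polys_over_base_change[OF fg(1) m \<rho>] polys_over_base_change[OF fg(2) m \<rho>], of d])
      (use fg(3) in \<open>auto simp: homog_base_change[OF m]\<close>)
  ultimately show "restrict_pt w m v (f + g) \<le> restrict_pt w m v f + restrict_pt w m v g"
    by (simp add: restrict_pt_def base_change_add)
next
  fix a assume a: "a \<in> Aring 1 (exp (-1))"
  then show "restrict_pt w m v (pconst a) = base_pt 1 (s ^ m) a"
    using hcone_pconst[OF v Aring_compose_power[OF a m \<rho>]] base_pt_compose_power[OF a m s \<rho>(2)]
    by (simp add: restrict_pt_def hpolys_pconst base_change_pconst)
next
  show "\<exists>i. restrict_pt w m v (pvar i) \<noteq> 0"
    using hcone_pvar[OF v] m by (simp add: restrict_pt_def hpolys_pvar base_change_pvar)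
qed

lemma restrict_pt_pvar: "m \<ge> 1 \<Longrightarrow> restrict_pt w m v (pvar i) = v (pvar i)"
  by (simp add: restrict_pt_def hpolys_pvar base_change_pvar)

lemma restrict_pt_cpoint:
  assumes m: "m \<ge> 1" and \<rho>: "0 < \<rho>" "\<rho> \<le> exp (-1)" and s: "s \<in> disc m \<rho>" "s \<noteq> 0"
  shows "restrict_pt w m (cpoint w m \<rho> s z) = cpoint w 1 (exp (-1)) (s ^ m) z"
proof
  fix f
  show "restrict_pt w m (cpoint w m \<rho> s z) f = cpoint w 1 (exp (-1)) (s ^ m) z f"
  proof (cases "f \<in> hpolys w (Aring 1 (exp (-1)))")
    case True
    then have "peval (base_change m f) s z = peval f (s ^ m) z"
      by (intro peval_base_change[OF _ m s \<rho>(2)]) (auto simp: hpolys_def)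
    with True hpolys_base_change[OF True m \<rho>] show ?thesis
      by (simp add: restrict_pt_def cpoint_def)
  qed (simp add: restrict_pt_def cpoint_def)
qed

lemma restrict_pt_rescaled:
  assumes m: "m \<ge> 1" and \<rho>: "0 < \<rho>" "\<rho> \<le> exp (-1)" and "rescaled w (Aring m \<rho>) r v v'"
  shows "rescaled w (Aring 1 (exp (-1))) r (restrict_pt w m v) (restrict_pt w m v')"
  unfolding rescaled_def
proof (intro allI ballI impI)
  fix d f assume f: "f \<in> polys_over (Aring 1 (exp (-1)))" "homog w d f"
  then have "v' (base_change m f) = r ^ d * v (base_change m f)"
    using assms(4) polys_over_base_change[OF f(1) m \<rho>] homog_base_change[OF m] unfolding rescaled_def by blast
  then show "restrict_pt w m v' f = r ^ d * restrict_pt w m v f"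
    using hpolysI[OF f] by (simp add: restrict_pt_def)
qed

text \<open>Base change commutes with the substitution of partial sums, so both sides agree for
  every finite set of exponents, before any limit is taken.\<close>

lemma restrict_pt_unif_map:
  assumes m: "m \<ge> 1" and \<rho>: "0 < \<rho>" "\<rho> \<le> exp (-1)"
  shows "restrict_pt w m (unif_map w \<tau> m \<rho> x) = unif_map w \<tau> 1 (exp (-1)) (x \<circ> pm_base_change m)"
proof
  fix f
  have "abs_lim x (\<lambda>F. psubst (base_change m f) (\<lambda>i. partial_sum m (\<tau> i) F)) =
      abs_lim (x \<circ> pm_base_change m) (\<lambda>F. psubst f (\<lambda>i. partial_sum 1 (\<tau> i) F))"
    using m by (simp add: abs_lim_def o_def pm_base_change_psubst pm_base_change_partial_sum del: One_nat_def)
  then show "restrict_pt w m (unif_map w \<tau> m \<rho> x) f = unif_map w \<tau> 1 (exp (-1)) (x \<circ> pm_base_change m) f"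
    using hpolys_base_change[OF _ m \<rho>] unfolding restrict_pt_def unif_map_def by metis
qed

lemma torus_an_base_change:
  assumes m: "m \<ge> 1" and x: "x \<in> torus_an m"
  shows "x \<circ> pm_base_change m \<in> torus_an 1" "trop (x \<circ> pm_base_change m) = trop x"
  using m x absK_compose_power[OF m] by (auto simp: torus_an_def trop_def)

section \<open>Compactness near the central fiber\<close>

lemma tendsto_fun_iff:
  fixes f :: "'c \<Rightarrow> 'a \<Rightarrow> 'b::topological_space"
  shows "(f \<longlongrightarrow> l) F \<longleftrightarrow> (\<forall>i. ((\<lambda>n. f n i) \<longlongrightarrow> l i) F)"
  using limitin_componentwise[of "\<lambda>_::'a. euclidean :: 'b topology" UNIV f l F]
  by (simp add: euclidean_product_topology limitin_canonical_iff)

text \<open>Tychonoff's theorem, for the topology of pointwise convergence.\<close>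

lemma compact_box: "compact (PiE UNIV (\<lambda>f. {0..B f :: real}))"
proof -
  have "compactin (product_topology (\<lambda>_. euclidean) UNIV) (PiE UNIV (\<lambda>f. {0..B f}))"
    unfolding compactin_PiE by simp
  then show ?thesis by (simp add: euclidean_product_topology)
qed

text \<open>The seminorms are functions on an uncountable set of polynomials, and a compact product
  with so many factors need not be sequentially compact. A filter finer than
  \<open>sequentially\<close> takes the place of a convergent subsequence.\<close>

lemma compact_sequence_cluster_filter:
  fixes v :: "nat \<Rightarrow> 'a::topological_space"
  assumes "compact K" "\<And>n. v n \<in> K"
  obtains x H where "H \<noteq> bot" "H \<le> sequentially" "(v \<longlongrightarrow> x) H"
proof -
  have "filtermap v sequentially \<noteq> bot" "eventually (\<lambda>x. x \<in> K) (filtermap v sequentially)"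
    using assms(2) by (auto simp: filtermap_bot_iff eventually_filtermap)
  then obtain x where x: "inf (nhds x) (filtermap v sequentially) \<noteq> bot"
    using assms(1) unfolding compact_filter by blast
  \<comment> \<open>Pulling back the neighborhoods of the cluster point forces convergence;
    properness is exactly the statement that \<open>x\<close> is a cluster point.\<close>
  define H where "H = inf (filtercomap v (nhds x)) sequentially"
  have "H \<noteq> bot"
  proof
    assume "H = bot"
    then have "eventually (\<lambda>_. False) H" by simp
    then obtain P Q where PQ: "eventually P (filtercomap v (nhds x))" "eventually Q sequentially"
      "\<And>n. P n \<Longrightarrow> Q n \<Longrightarrow> False"
      unfolding H_def eventually_inf by auto
    then obtain P' where P': "eventually P' (nhds x)" "\<And>n. P' (v n) \<Longrightarrow> P n"
      by (auto simp: eventually_filtercomap)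
    have "eventually (\<lambda>y. \<exists>n. Q n \<and> y = v n) (filtermap v sequentially)"
      unfolding eventually_filtermap by (rule eventually_mono[OF PQ(2)]) auto
    then have "eventually (\<lambda>_. False) (inf (nhds x) (filtermap v sequentially))"
      unfolding eventually_inf using P' PQ(3) by blast
    then show False using x by (simp add: trivial_limit_def)
  qed
  moreover have "H \<le> sequentially" by (simp add: H_def)
  moreover have "filtermap v H \<le> nhds x"
    unfolding H_def by (meson filtermap_filtercomap filtermap_mono inf_le1 order_trans)
  ultimately show ?thesis using that by (auto simp: filterlim_def)
qed

text \<open>Bezout's identity with the negative coefficients moved to the other side: the
  coefficients are exponents of two monomials, which must be natural numbers.\<close>

lemma Gcd_eq_nat_combination:
  assumes "finite J" "\<And>i. i \<in> J \<Longrightarrow> (w i :: nat) \<ge> 1"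
  shows "\<exists>p q. (\<Sum>i\<in>J. p i * w i) = (\<Sum>i\<in>J. q i * w i) + Gcd (w ` J)"
  using assms
proof (induction J)
  case (insert j J)
  then obtain p q where pq: "(\<Sum>i\<in>J. p i * w i) = (\<Sum>i\<in>J. q i * w i) + Gcd (w ` J)" by auto
  obtain x y where xy: "w j * x = Gcd (w ` J) * y + gcd (w j) (Gcd (w ` J))"
    using bezout_nat[of "w j"] insert.prems by fastforce
  \<comment> \<open>In \<open>xy\<close> the old greatest common divisor stands on the side of the
    new one, so the old identity, multiplied by \<open>y\<close>, is used in the reverse direction
    and \<open>p\<close> and \<open>q\<close> change places.\<close>
  let ?P = "\<lambda>i. if i = j then x else y * q i" and ?Q = "\<lambda>i. if i = j then 0 else y * p i"
  have "(\<Sum>i\<in>J. ?P i * w i) = y * (\<Sum>i\<in>J. q i * w i)" "(\<Sum>i\<in>J. ?Q i * w i) = y * (\<Sum>i\<in>J. p i * w i)"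
    unfolding sum_distrib_left using insert.hyps by (auto intro!: sum.cong)
  then have "(\<Sum>i\<in>insert j J. ?P i * w i) = (\<Sum>i\<in>insert j J. ?Q i * w i) + Gcd (w ` insert j J)"
    using insert.hyps xy by (simp add: pq algebra_simps)
  then show ?case by (intro exI)
qed simp

lemma powr_sum_le:
  fixes x :: "'i \<Rightarrow> real"
  assumes "finite A" "\<And>i. i \<in> A \<Longrightarrow> 0 \<le> x i" "0 < c" "c \<le> 1"
  shows "(\<Sum>i\<in>A. x i) powr c \<le> (\<Sum>i\<in>A. x i powr c)"
  using assms(1,2)
proof (induction A)
  case (insert i A)
  have "(x i + sum x A) powr c \<le> x i powr c + sum x A powr c"
    by (rule powr_add_le) (use insert assms in \<open>auto intro: sum_nonneg\<close>)
  with insert show ?case by fastforce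
qed simp

lemma exists_normalized:
  assumes w: "\<And>i. w i \<ge> (1::nat)" and z: "(z :: complex ^ 'n::finite) \<noteq> 0"
  obtains c where "c \<noteq> 0" "\<And>i. norm (act w c z $ i) \<le> 1" "\<exists>i. norm (act w c z $ i) = 1"
proof -
  \<comment> \<open>This weighted maximum scales by \<open>norm c\<close> under
    \<open>act w c\<close>; dividing by it normalizes \<open>z\<close>.\<close>
  define R where "R = Max (range (\<lambda>i. root (w i) (norm (z $ i))))"
  have fin: "finite (range (\<lambda>i. root (w i) (norm (z $ i))))" by simp
  have le: "root (w i) (norm (z $ i)) \<le> R" for i unfolding R_def by (rule Max_ge[OF fin]) simp
  have "R \<in> range (\<lambda>i. root (w i) (norm (z $ i)))" unfolding R_def by (rule Max_in[OF fin]) simp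
  then obtain i0 where i0: "R = root (w i0) (norm (z $ i0))" by blast
  obtain i1 where "z $ i1 \<noteq> 0" using z by (auto simp: vec_eq_iff)
  then have "0 < root (w i1) (norm (z $ i1))" using w[of i1] by (simp add: real_root_gt_zero)
  then have R: "R > 0" using le[of i1] by simp
  have nz: "norm (z $ i) = root (w i) (norm (z $ i)) ^ w i" for i
    using w[of i] by (simp add: real_root_pow_pos2)
  let ?c = "complex_of_real (1 / R)"
  have act: "norm (act w ?c z $ i) = (root (w i) (norm (z $ i)) / R) ^ w i" for i
    using R nz[of i] by (simp add: act_def norm_mult norm_power norm_divide power_divide)
  show ?thesis
  proof (rule that[of ?c])
    show "?c \<noteq> 0" using R by simp
    show "norm (act w ?c z $ i) \<le> 1" for i
      unfolding act using R le[of i] w[of i] by (intro power_le_one) auto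
    show "\<exists>i. norm (act w ?c z $ i) = 1"
      unfolding act using R by (intro exI[of _ i0]) (simp flip: i0)
  qed
qed

text \<open>On normalized points the monomials have norm at most one, so the bound involves only the
  coefficients. By \<open>base_pt_tendsto\<close> it converges as \<open>s\<close> tends to 0, which
  yields one bound for a whole sequence of points.\<close>

lemma cpoint_le:
  fixes z :: "complex ^ 'n::finite"
  assumes s: "s \<noteq> 0" "norm (s ^ m) < exp (-1)" and z: "\<And>i. norm (z $ i) \<le> 1"
  shows "cpoint w m \<rho> s z f \<le> (\<Sum>e\<in>Poly_Mapping.keys f. base_pt m s (Poly_Mapping.lookup f e))"
proof -
  have c: "0 < cfun (s ^ m)" "cfun (s ^ m) < 1"
    using cfun_bounds[of "s ^ m"] s by auto
  have "norm (\<Prod>i\<in>UNIV. (z $ i) ^ Poly_Mapping.lookup e i) \<le> 1" for e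
    unfolding prod_norm[symmetric] by (intro prod_le_1) (auto simp: norm_power intro!: power_le_one z)
  then have "norm (peval f s z) \<le> (\<Sum>e\<in>Poly_Mapping.keys f. norm (eval_fls (Poly_Mapping.lookup f e) s) * 1)"
    unfolding peval_def by (intro sum_norm_le) (auto simp: norm_mult intro!: mult_left_le)
  then have "norm (peval f s z) powr cfun (s ^ m) \<le> (\<Sum>e\<in>Poly_Mapping.keys f. norm (eval_fls (Poly_Mapping.lookup f e) s)) powr cfun (s ^ m)"
    using c by (intro powr_mono2) auto
  also have "\<dots> \<le> (\<Sum>e\<in>Poly_Mapping.keys f. norm (eval_fls (Poly_Mapping.lookup f e) s) powr cfun (s ^ m))"
    using c by (intro powr_sum_le) auto
  finally show ?thesis using s
    by (auto simp: cpoint_def base_pt_def intro: sum_nonneg)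
qed

text \<open>The defining equations and inequalities pass to pointwise limits. The only open
  condition is that some coordinate does not vanish, and the normalization keeps it from being
  lost.\<close>

lemma cpoint_sequence_limit_in_hcone:
  fixes v :: "nat \<Rightarrow> 'n::finite hpoint"
  assumes m: "m \<ge> 1" and \<rho>: "0 < \<rho>" and H: "H \<noteq> bot" "H \<le> sequentially"
    and s: "filterlim s (at 0) sequentially" and v: "\<And>n. v n \<in> hcone w I m \<rho> (s n)"
    and norm: "\<And>n. \<exists>i. v n (pvar i) = 1" and lim: "(v \<longlongrightarrow> x) H"
  shows "x \<in> hcone w I m \<rho> 0"
proof -
  have T: "((\<lambda>n. v n f) \<longlongrightarrow> x f) H" for f
    using lim by (simp add: tendsto_fun_iff)
  have sH: "filterlim s (at 0) H" using s H(2) filterlim_mono by blast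
  note unique = tendsto_unique[OF H(1)]
  show ?thesis unfolding hcone_def mem_Collect_eq
  proof (intro conjI allI impI ballI)
    show "0 \<le> x f" for f
      by (rule tendsto_lowerbound[OF T _ H(1)]) (use hcone_nonneg[OF v] in auto)
  next
    fix f assume "f \<notin> hpolys w (Aring m \<rho>)"
    then have "v n f = 0" for n using v[of n] unfolding hcone_def by blast
    then show "x f = 0" using unique[OF T[of f], of 0] by simp
  next
    fix f g assume "f \<in> hpolys w (Aring m \<rho>)" "g \<in> hpolys w (Aring m \<rho>)"
    then have "v n (f * g) = v n f * v n g" for n by (rule hcone_mult[OF v])
    then show "x (f * g) = x f * x g"
      using unique[OF T[of "f * g"] ] tendsto_mult[OF T[of f] T[of g]] by simp
  next
    fix d f g assume fg: "f \<in> polys_over (Aring m \<rho>)" "g \<in> polys_over (Aring m \<rho>)" "homog w d f \<and> homog w d g"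
    then have "v n (f + g) \<le> v n f + v n g" for n using hcone_add[OF v] by blast
    then show "x (f + g) \<le> x f + x g"
      by (intro tendsto_le[OF H(1) tendsto_add[OF T[of f] T[of g]] T[of "f + g"]]) auto
  next
    fix a assume a: "a \<in> Aring m \<rho>"
    have "((\<lambda>n. base_pt m (s n) a) \<longlongrightarrow> absK m a) H"
      by (rule filterlim_compose[OF base_pt_tendsto[OF a m \<rho>] sH])
    then have "((\<lambda>n. v n (pconst a)) \<longlongrightarrow> absK m a) H"
      using hcone_pconst[OF v a] by simp
    then show "x (pconst a) = base_pt m 0 a"
      using unique[OF T[of "pconst a"]] by (simp add: base_pt_def)
  next
    fix f assume "f \<in> I"
    then have "v n (base_change m f) = 0" for n by (rule hcone_ideal[OF v])
    then show "x (base_change m f) = 0" using unique[OF T[of "base_change m f"], of 0] by simp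
  next
    have "((\<lambda>n. \<Sum>i\<in>UNIV. v n (pvar i)) \<longlongrightarrow> (\<Sum>i\<in>UNIV. x (pvar i))) H"
      by (intro tendsto_sum T)
    \<comment> \<open>The coordinate of value one may change with \<open>n\<close>, so the sum of
      all coordinates is followed instead.\<close>
    moreover have "1 \<le> (\<Sum>i\<in>UNIV. v n (pvar i))" for n
    proof -
      obtain i where "v n (pvar i) = 1" using norm by blast
      then show ?thesis
        using member_le_sum[of i UNIV "\<lambda>i. v n (pvar i)"] hcone_nonneg[OF v] by simp
    qed
    ultimately have "1 \<le> (\<Sum>i\<in>UNIV. x (pvar i))"
      by (intro tendsto_lowerbound[OF _ _ H(1)]) auto
    then show "\<exists>i. x (pvar i) \<noteq> 0"
      by (metis not_one_le_zero sum.neutral)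
  qed
qed

text \<open>Both metrics change by the same \<open>ln r\<close>, so their difference does not see
  the chosen norm on the fiber of the line bundle.\<close>

lemma hcone_rescale_invariant:
  assumes \<phi>1: "hyb_cont_metric w I 1 (exp (-1)) \<phi>1" and \<phi>2: "hyb_cont_metric w I m \<rho> \<phi>2"
    and m: "m \<ge> 1" and \<rho>: "0 < \<rho>" "\<rho> \<le> exp (-1)" and s: "s \<in> disc m \<rho>"
    and v: "v \<in> hcone w I m \<rho> s" "v' \<in> hcone w I m \<rho> s" and r: "r > 0" "rescaled w (Aring m \<rho>) r v v'"
  shows "\<phi>1 (restrict_pt w m v') - \<phi>2 v' = \<phi>1 (restrict_pt w m v) - \<phi>2 v"
proof -
  have "v \<in> hspace w I m \<rho>" "v' \<in> hspace w I m \<rho>" using v s by (auto simp: hspace_def)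
  then have 2: "\<phi>2 v' = \<phi>2 v + ln r" using \<phi>2 r unfolding hyb_cont_metric_def by blast
  have "restrict_pt w m v \<in> hspace w I 1 (exp (-1))" "restrict_pt w m v' \<in> hspace w I 1 (exp (-1))"
    using restrict_pt_in_hcone[OF m \<rho> s] v disc_power[OF s \<rho>(2)] unfolding hspace_def by blast+
  then have "\<phi>1 (restrict_pt w m v') = \<phi>1 (restrict_pt w m v) + ln r"
    using \<phi>1 r(1) restrict_pt_rescaled[OF m \<rho> r(2)] unfolding hyb_cont_metric_def by blast
  with 2 show ?thesis by simp
qed

text \<open>If every radius failed, there would be normalized points violating the bound over
  parameters tending to 0. Their seminorms cluster at a point of the central cone, and continuity of
  the difference carries the violation to that point.\<close>

proposition metric_difference_near_central_fiber:
  fixes w :: "'n::finite \<Rightarrow> nat"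
  assumes w: "\<And>i. w i \<ge> 1" and I: "homog_ideal w (Aring 1 (exp (-1))) I"
    and gcd: "\<forall>v \<in> hspace w I 1 (exp (-1)). Gcd {w i | i. v (pvar i) \<noteq> 0} = 1"
    and m: "m \<ge> 1" and \<rho>: "0 < \<rho>" "\<rho> \<le> exp (-1)"
    and \<phi>1: "hyb_cont_metric w I 1 (exp (-1)) \<phi>1" and \<phi>2: "hyb_cont_metric w I m \<rho> \<phi>2"
    and central: "\<And>v. v \<in> hcone w I m \<rho> 0 \<Longrightarrow> \<bar>\<phi>1 (restrict_pt w m v) - \<phi>2 v\<bar> \<le> K" and \<epsilon>: "\<epsilon> > 0"
  shows "\<exists>r. 0 < r \<and> r \<le> \<rho> \<and> (\<forall>s. s \<noteq> 0 \<and> s \<in> disc m r \<longrightarrow> (\<forall>z \<in> ccone I (s ^ m).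
    \<bar>\<phi>1 (cpoint w 1 (exp (-1)) (s ^ m) z) - \<phi>2 (cpoint w m \<rho> s z)\<bar> \<le> K + \<epsilon>))"
proof (rule ccontr)
  assume contr: "\<not> ?thesis"
  define D where "D v = \<phi>1 (restrict_pt w m v) - \<phi>2 v" for v
  have "\<exists>s z. s \<noteq> 0 \<and> s \<in> disc m (\<rho> / real (Suc n)) \<and> z \<in> ccone I (s ^ m) \<and>
      (\<forall>i. norm (z $ i) \<le> 1) \<and> (\<exists>i. norm (z $ i) = 1) \<and> K + \<epsilon> < \<bar>D (cpoint w m \<rho> s z)\<bar>" for n
  proof -
    have r: "0 < \<rho> / real (Suc n)" "\<rho> / real (Suc n) \<le> \<rho>" using \<rho> by (auto simp: field_simps)
    then obtain s z where s: "s \<noteq> 0" "s \<in> disc m (\<rho> / real (Suc n))" and z: "z \<in> ccone I (s ^ m)"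
      and gt: "\<not> \<bar>\<phi>1 (cpoint w 1 (exp (-1)) (s ^ m) z) - \<phi>2 (cpoint w m \<rho> s z)\<bar> \<le> K + \<epsilon>"
      using contr by blast
    have sd: "s \<in> disc m \<rho>" using s(2) r by (auto simp: disc_def)
    have "z \<noteq> 0" using z by (simp add: ccone_def)
    then obtain c where c: "c \<noteq> 0" "\<And>i. norm (act w c z $ i) \<le> 1" "\<exists>i. norm (act w c z $ i) = 1"
      by (rule exists_normalized[of w z, OF w]) blast
    have sm: "s ^ m \<noteq> 0" "norm (s ^ m) < exp (-1)"
      using s disc_power[OF sd \<rho>(2)] by (auto simp: disc_def)
    have z': "act w c z \<in> ccone I (s ^ m)" by (rule act_in_ccone[OF I sm z c(1)])
    have IA: "I \<subseteq> polys_over (Aring 1 (exp (-1)))" using I unfolding homog_ideal_def by (elim conjE)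
    note hc = cpoint_in_hcone[OF IA m \<rho> sd s(1)]
    have "D (cpoint w m \<rho> s (act w c z)) = D (cpoint w m \<rho> s z)"
      unfolding D_def using c(1)
      by (intro hcone_rescale_invariant[OF \<phi>1 \<phi>2 m \<rho> sd hc[OF z] hc[OF z'] _ cpoint_act[OF c(1)]]) simp
    then have "K + \<epsilon> < \<bar>D (cpoint w m \<rho> s (act w c z))\<bar>"
      using gt unfolding D_def restrict_pt_cpoint[OF m \<rho> sd s(1)] by simp
    then show ?thesis using s z' c by blast
  qed
  then obtain s and z :: "nat \<Rightarrow> complex ^ 'n" where s0: "\<And>n. s n \<noteq> 0" and sn: "\<And>n. s n \<in> disc m (\<rho> / real (Suc n))"
    and z: "\<And>n. z n \<in> ccone I (s n ^ m)" and z1: "\<And>n i. norm (z n $ i) \<le> 1"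
    and z2: "\<And>n. \<exists>i. norm (z n $ i) = 1" and D: "\<And>n. K + \<epsilon> < \<bar>D (cpoint w m \<rho> (s n) (z n))\<bar>"
    by metis
  define v where "v n = cpoint w m \<rho> (s n) (z n)" for n
  have sd: "s n \<in> disc m \<rho>" for n
  proof -
    have "\<rho> / real (Suc n) \<le> \<rho>" using \<rho> by (auto simp: field_simps)
    then show ?thesis using sn[of n] by (auto simp: disc_def)
  qed
  have slt: "norm (s n ^ m) < exp (-1)" for n using disc_power[OF sd \<rho>(2)] by (simp add: disc_def)
  have s_lim: "filterlim s (at 0) sequentially"
  proof -
    have "(\<lambda>n. \<rho> / real (Suc n)) \<longlonglongrightarrow> 0" by (rule LIMSEQ_Suc[OF lim_const_over_n])
    then have "(\<lambda>n. norm (s n) ^ m) \<longlonglongrightarrow> 0"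
      by (rule tendsto_sandwich[OF _ _ tendsto_const, rotated -1])
        (use sn in \<open>auto simp: disc_def intro!: always_eventually less_imp_le\<close>)
    then have "(\<lambda>n. root m (norm (s n) ^ m)) \<longlonglongrightarrow> root m 0" by (rule tendsto_real_root)
    then have "(\<lambda>n. norm (s n)) \<longlonglongrightarrow> 0" using m by (simp add: real_root_power_cancel)
    then have "s \<longlonglongrightarrow> 0" by (rule tendsto_norm_zero_cancel)
    then show ?thesis using s0 by (simp add: filterlim_at)
  qed
  have IA: "I \<subseteq> polys_over (Aring 1 (exp (-1)))" using I unfolding homog_ideal_def by (elim conjE)
  have vh: "v n \<in> hcone w I m \<rho> (s n)" for n
    unfolding v_def by (rule cpoint_in_hcone[OF IA m \<rho> sd s0 z])
  have v1: "\<exists>i. v n (pvar i) = 1" for n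
  proof -
    obtain i where "norm (z n $ i) = 1" using z2 by blast
    then show ?thesis by (intro exI[of _ i]) (simp add: v_def cpoint_def hpolys_pvar peval_pvar)
  qed
  have "\<exists>B. \<forall>n. v n f \<le> B" for f
  proof (cases "f \<in> hpolys w (Aring m \<rho>)")
    case True
    have "(\<lambda>n. \<Sum>e\<in>Poly_Mapping.keys f. base_pt m (s n) (Poly_Mapping.lookup f e)) \<longlonglongrightarrow>
        (\<Sum>e\<in>Poly_Mapping.keys f. absK m (Poly_Mapping.lookup f e))"
      using True by (intro tendsto_sum filterlim_compose[OF base_pt_tendsto[OF _ m \<rho>(1)] s_lim])
        (auto simp: hpolys_def polys_over_def)
    then have "Bseq (\<lambda>n. \<Sum>e\<in>Poly_Mapping.keys f. base_pt m (s n) (Poly_Mapping.lookup f e))"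
      by (intro convergent_imp_Bseq convergentI)
    then obtain B where "\<And>n. norm (\<Sum>e\<in>Poly_Mapping.keys f. base_pt m (s n) (Poly_Mapping.lookup f e)) \<le> B"
      unfolding Bseq_def by blast
    moreover have "v n f \<le> (\<Sum>e\<in>Poly_Mapping.keys f. base_pt m (s n) (Poly_Mapping.lookup f e))" for n
      unfolding v_def by (rule cpoint_le[OF s0 slt z1])
    ultimately have "v n f \<le> B" for n by (smt (verit) real_norm_def)
    then show ?thesis by blast
  qed (auto simp: v_def cpoint_def)
  then obtain B where "\<And>f n. v n f \<le> B f" by metis
  then have "v n \<in> PiE UNIV (\<lambda>f. {0..B f})" for n using hcone_nonneg[OF vh] by auto
  from compact_sequence_cluster_filter[OF compact_box this]
  obtain x H where H: "H \<noteq> bot" "H \<le> sequentially" and lim: "(v \<longlongrightarrow> x) H" .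
  have x: "x \<in> hcone w I m \<rho> 0"
    by (rule cpoint_sequence_limit_in_hcone[OF m \<rho>(1) H s_lim vh v1 lim])
  define y where "y = restrict_pt w m x"
  define u where "u n = restrict_pt w m (v n)" for n
  have d0: "(0::complex) \<in> disc m \<rho>" using m \<rho> by (simp add: disc_def power_0_left)
  have xs: "x \<in> hspace w I m \<rho>" and vs: "v n \<in> hspace w I m \<rho>" for n
    using x d0 vh sd by (auto simp: hspace_def)
  have ys: "y \<in> hspace w I 1 (exp (-1))"
    using restrict_pt_in_hcone[OF m \<rho> d0 x] disc_power[OF d0 \<rho>(2)] unfolding hspace_def y_def by blast
  have us: "u n \<in> hspace w I 1 (exp (-1))" for n
    using restrict_pt_in_hcone[OF m \<rho> sd vh] disc_power[OF sd \<rho>(2)] unfolding hspace_def u_def by blast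
  have u_lim: "(u \<longlongrightarrow> y) H"
    unfolding tendsto_fun_iff u_def y_def restrict_pt_def using lim by (auto simp: tendsto_fun_iff)
  \<comment> \<open>Continuity of a metric is only available relative to a section of degree one of
    the form \<open>f / g\<close>. The weights of the coordinates not vanishing at \<open>x\<close>
    have greatest common divisor 1, so there are monomials \<open>f\<close> and \<open>g\<close> in
    them whose degrees differ by one, and both are nonzero near \<open>x\<close>.\<close>
  define J where "J = {i. x (pvar i) \<noteq> 0}"
  have "{w i | i. y (pvar i) \<noteq> 0} = w ` J" by (auto simp: y_def restrict_pt_pvar[OF m] J_def)
  then have "Gcd (w ` J) = 1" using gcd ys by auto
  then obtain p q where pq: "(\<Sum>i\<in>J. p i * w i) = Suc (\<Sum>i\<in>J. q i * w i)"
    using Gcd_eq_nat_combination[of J w] w by auto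
  define f g where "f = (\<Prod>i\<in>J. pvar i ^ p i :: 'n coordpoly)" and "g = (\<Prod>i\<in>J. pvar i ^ q i :: 'n coordpoly)"
  have po: "f \<in> polys_over (Aring m' \<rho>')" "g \<in> polys_over (Aring m' \<rho>')" if "\<rho>' > 0" for m' \<rho>'
    unfolding f_def g_def using that by (intro polys_over_prod polys_over_power polys_over_pvar; simp)+
  have hg: "homog w (Suc (\<Sum>i\<in>J. q i * w i)) f" "homog w (\<Sum>i\<in>J. q i * w i) g"
    unfolding f_def g_def pq[symmetric] by (intro homog_prod homog_power homog_pvar)+
  have fgx: "x f \<noteq> 0" "x g \<noteq> 0"
    unfolding f_def g_def by (rule hcone_prod_nonzero[OF x \<rho>(1)]; simp add: J_def)+
  have bc: "base_change m f = f" "base_change m g = g"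
    using m by (simp_all add: f_def g_def base_change_eq pm_base_change_prod pvar_def)
  have res: "restrict_pt w m t f = t f" "restrict_pt w m t g = t g" for t
    using hpolysI[OF po(1) hg(1)] hpolysI[OF po(2) hg(2)] by (simp_all add: restrict_pt_def bc)
  have c1: "continuous_on {v \<in> hspace w I 1 (exp (-1)). v f \<noteq> 0 \<and> v g \<noteq> 0} (\<lambda>v. \<phi>1 v - ln (v f / v g))"
    using \<phi>1 po[of "exp (-1)" 1] hg unfolding hyb_cont_metric_def by auto
  have c2: "continuous_on {v \<in> hspace w I m \<rho>. v f \<noteq> 0 \<and> v g \<noteq> 0} (\<lambda>v. \<phi>2 v - ln (v f / v g))"
    using \<phi>2 po[OF \<rho>(1)] hg unfolding hyb_cont_metric_def by blast
  have ev: "eventually (\<lambda>n. v n f \<noteq> 0 \<and> v n g \<noteq> 0) H"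
    using lim fgx by (auto simp: tendsto_fun_iff intro!: eventually_conj tendsto_imp_eventually_ne)
  have "((\<lambda>n. \<phi>1 (u n) - ln (u n f / u n g)) \<longlongrightarrow> \<phi>1 y - ln (y f / y g)) H"
    by (rule continuous_on_tendsto_compose[OF c1 u_lim])
      (use ys us fgx ev in \<open>auto simp: u_def y_def res\<close>)
  moreover have "((\<lambda>n. \<phi>2 (v n) - ln (v n f / v n g)) \<longlongrightarrow> \<phi>2 x - ln (x f / x g)) H"
    by (rule continuous_on_tendsto_compose[OF c2 lim]) (use xs vs fgx ev in auto)
  ultimately have "((\<lambda>n. (\<phi>1 (u n) - ln (u n f / u n g)) - (\<phi>2 (v n) - ln (v n f / v n g)))
      \<longlongrightarrow> (\<phi>1 y - ln (y f / y g)) - (\<phi>2 x - ln (x f / x g))) H"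
    by (rule tendsto_diff)
  \<comment> \<open>The monomials \<open>f\<close> and \<open>g\<close> are fixed by base change, so
    the same logarithm was subtracted from both metrics and cancels.\<close>
  then have "((\<lambda>n. D (v n)) \<longlongrightarrow> D x) H"
    by (simp add: D_def u_def y_def res)
  then have "((\<lambda>n. \<bar>D (v n)\<bar>) \<longlongrightarrow> \<bar>D x\<bar>) H" by (rule tendsto_rabs)
  then have "K + \<epsilon> \<le> \<bar>D x\<bar>"
    by (rule tendsto_lowerbound[OF _ _ H(1)]) (use D in \<open>auto simp: v_def intro!: always_eventually less_imp_le\<close>)
  then show False using central[OF x] \<epsilon> by (simp add: D_def)
qed

section \<open>Absolute values of radicals\<close>

lemma absK_mult: "absK m (f * g) = absK m f * absK m g"
  by (auto simp: absK_def diff_divide_distrib simp flip: exp_add)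

lemma absK_0 [simp]: "absK m 0 = 0"
  and absK_1 [simp]: "absK m 1 = 1"
  and absK_nonneg [simp]: "0 \<le> absK m f"
  and absK_eq_0_iff [simp]: "absK m f = 0 \<longleftrightarrow> f = 0"
  by (auto simp: absK_def)

lemma absK_pos_iff [simp]: "0 < absK m f \<longleftrightarrow> f \<noteq> 0"
  by (simp add: less_le)

lemma absK_power: "absK m (f ^ n) = absK m f ^ n"
  by (induction n) (auto simp: absK_mult)

lemma absK_minus_1 [simp]: "absK m (- 1) = 1"
  by (simp add: absK_def)

lemma map_poly_to_ac_mult: "map_poly to_ac (p * q) = map_poly to_ac p * map_poly to_ac q"
  by (rule poly_eqI) (simp add: coeff_map_poly coeff_mult to_ac_sum)

lemma map_poly_to_ac_diff: "map_poly to_ac (p - q) = map_poly to_ac p - map_poly to_ac q"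
  by (rule poly_eqI) (simp add: coeff_map_poly)

text \<open>All roots of \<open>p\<close> in the closure are \<open>n\<close>-th roots of
  \<open>\<beta>\<close>, since \<open>p\<close> divides \<open>q\<close>. Up to sign the constant
  coefficient is the product of these \<open>d\<close> roots, so its \<open>n\<close>-th power is
  \<open>\<beta> ^ d\<close> up to sign, an identity in the ground field to which
  \<open>absK\<close> applies.\<close>

lemma abs_ac_candidate_eq:
  fixes p :: "complex fls poly"
  assumes \<alpha>: "\<alpha> ^ n = to_ac \<beta>" and n: "n \<ge> 1" and \<beta>: "\<beta> \<noteq> 0"
    and p: "Factorial_Ring.irreducible p" "Polynomial.lead_coeff p = 1" "poly (map_poly to_ac p) \<alpha> = 0"
    and dvd: "p dvd q" and q: "\<And>\<gamma>. poly (map_poly to_ac q) \<gamma> = 0 \<Longrightarrow> \<gamma> ^ n = to_ac \<beta>"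
  shows "absK 1 (Polynomial.coeff p 0) powr (1 / real (Polynomial.degree p)) = absK 1 \<beta> powr (1 / real n)"
proof -
  define d where "d = Polynomial.degree p"
  have p0: "p \<noteq> 0" using p(2) by auto
  have "d \<noteq> 0"
  proof
    assume "d = 0"
    then have "is_unit p" using p0 unfolding d_def by (metis is_unit_triv is_unit_iff_degree)
    then show False using p(1) by (simp add: Factorial_Ring.irreducible_def)
  qed
  define P where "P = map_poly to_ac p"
  have P: "P \<noteq> 0" "Polynomial.degree P = d" "Polynomial.lead_coeff P = 1"
    unfolding P_def d_def using p(2) p0 by (auto simp: degree_map_poly coeff_map_poly map_poly_eq_0_iff)
  obtain A where A: "size A = d" "P = (\<Prod>x\<in>#A. [:- x, 1:])"
    using alg_closed_imp_factorization[OF P(1)] P by auto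
  have root: "x ^ n = to_ac \<beta>" if "x \<in># A" for x
  proof -
    have "poly P x = 0" unfolding A(2) using that by (auto simp: poly_prod_mset prod_mset_zero_iff)
    then have "poly (map_poly to_ac q) x = 0"
      using dvd by (auto simp: P_def map_poly_to_ac_mult)
    then show ?thesis by (rule q)
  qed
  have "to_ac (Polynomial.coeff p 0) = poly P 0"
    by (simp add: P_def poly_0_coeff_0 coeff_map_poly)
  also have "\<dots> = (\<Prod>x\<in>#A. - x)" unfolding A(2) by (simp add: poly_prod_mset)
  finally have "to_ac (Polynomial.coeff p 0) ^ n = (\<Prod>x\<in>#A. - x) ^ n" by simp
  also have "\<dots> = (\<Prod>x\<in>#A. (- x) ^ n)" by (induction A)
      (simp_all only: image_mset_add_mset prod_mset.add_mset image_mset_empty prod_mset_empty power_mult_distrib power_one)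
  also have "\<dots> = (\<Prod>x\<in>#A. to_ac ((- 1) ^ n * \<beta>))"
  proof (rule arg_cong[of _ _ prod_mset], rule image_mset_cong)
    fix x assume "x \<in># A"
    then show "(- x) ^ n = to_ac ((- 1) ^ n * \<beta>)" using root power_minus[of x n] by simp
  qed
  also have "\<dots> = to_ac (((- 1) ^ n * \<beta>) ^ d)" by (simp add: A(1))
  finally have "to_ac (Polynomial.coeff p 0 ^ n) = to_ac (((- 1) ^ n * \<beta>) ^ d)" by simp
  then have "Polynomial.coeff p 0 ^ n = ((- 1) ^ n * \<beta>) ^ d" by (simp only: to_ac_eq_iff)
  then have "absK 1 (Polynomial.coeff p 0 ^ n) = absK 1 (((- 1) ^ n * \<beta>) ^ d)" by simp
  then have eq: "absK 1 (Polynomial.coeff p 0) ^ n = absK 1 \<beta> ^ d"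
    by (simp add: absK_power absK_mult)
  have pos: "absK 1 \<beta> > 0" using \<beta> by simp
  have "Polynomial.coeff p 0 \<noteq> 0"
  proof
    assume "Polynomial.coeff p 0 = 0"
    then have "absK 1 \<beta> ^ d = 0" using eq n by (simp add: power_0_left)
    then show False using \<beta> by simp
  qed
  then have "absK 1 (Polynomial.coeff p 0) > 0" by simp
  then have "real n * ln (absK 1 (Polynomial.coeff p 0)) = real d * ln (absK 1 \<beta>)"
    using arg_cong[OF eq, of ln] pos by (simp add: ln_realpow)
  then have "1 / real d * ln (absK 1 (Polynomial.coeff p 0)) = 1 / real n * ln (absK 1 \<beta>)"
    using n \<open>d \<noteq> 0\<close> by (simp add: field_simps)
  then show ?thesis using pos \<open>absK 1 (Polynomial.coeff p 0) > 0\<close>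
    by (simp add: powr_def d_def)
qed

lemma exists_minimal_polynomial:
  fixes \<alpha> :: "complex fls alg_closure"
  assumes "q0 \<noteq> 0" "poly (map_poly to_ac q0) \<alpha> = 0"
  obtains r where "Factorial_Ring.irreducible r" "Polynomial.lead_coeff r = 1" "poly (map_poly to_ac r) \<alpha> = 0"
    "\<And>q. poly (map_poly to_ac q) \<alpha> = 0 \<Longrightarrow> r dvd q"
proof -
  let ?ev = "\<lambda>q. poly (map_poly to_ac q) \<alpha>"
  obtain r0 where r0: "r0 \<noteq> 0" "?ev r0 = 0"
    and min: "\<And>q. q \<noteq> 0 \<Longrightarrow> ?ev q = 0 \<Longrightarrow> Polynomial.degree r0 \<le> Polynomial.degree q"
    using exists_least_iff[of "\<lambda>n. \<exists>q. q \<noteq> 0 \<and> ?ev q = 0 \<and> Polynomial.degree q = n"] assms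
    by (metis linorder_not_le)
  define r where "r = Polynomial.smult (inverse (Polynomial.lead_coeff r0)) r0"
  have r: "r \<noteq> 0" "Polynomial.lead_coeff r = 1" "Polynomial.degree r = Polynomial.degree r0"
    using r0(1) by (auto simp: r_def)
  have "r = [:inverse (Polynomial.lead_coeff r0):] * r0" by (simp add: r_def)
  then have evr: "?ev r = 0" by (simp only: map_poly_to_ac_mult poly_mult r0(2)) simp
  have dv: "r dvd q" if "?ev q = 0" for q
  proof (rule ccontr)
    assume "\<not> r dvd q"
    then have nz: "q mod r \<noteq> 0" by (simp add: dvd_eq_mod_eq_0)
    have "q mod r = q - q div r * r" by (simp add: minus_div_mult_eq_mod)
    then have "?ev (q mod r) = 0" using that evr by (simp add: map_poly_to_ac_mult map_poly_to_ac_diff)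
    then have "Polynomial.degree r0 \<le> Polynomial.degree (q mod r)" by (rule min[OF nz])
    moreover have "Polynomial.degree (q mod r) < Polynomial.degree r" using degree_mod_less[OF r(1), of q] nz by auto
    ultimately show False using r(3) by simp
  qed
  have "Factorial_Ring.irreducible r"
  proof (rule Factorial_Ring.irreducibleI[OF r(1)])
    show "\<not> r dvd 1"
    proof
      assume "r dvd 1"
      then obtain k where k: "1 = r * k" by (elim dvdE)
      have "?ev (r * k) = 0" using evr by (simp add: map_poly_to_ac_mult)
      then have "?ev 1 = 0" unfolding k[symmetric] .
      then show False by (simp add: map_poly_1')
    qed
    fix a b assume ab: "r = a * b"
    have nz: "a \<noteq> 0" "b \<noteq> 0" using r(1) ab by auto
    have deg: "Polynomial.degree r = Polynomial.degree a + Polynomial.degree b"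
      unfolding ab using nz by (rule Polynomial.degree_mult_eq)
    have "?ev a * ?ev b = 0" using evr by (simp add: ab map_poly_to_ac_mult)
    then consider "?ev a = 0" | "?ev b = 0" by auto
    then show "a dvd 1 \<or> b dvd 1"
    proof cases
      case 1
      then have "Polynomial.degree b = 0" using min[OF nz(1)] deg r(3) by simp
      then show ?thesis using nz by (simp add: is_unit_iff_degree)
    next
      case 2
      then have "Polynomial.degree a = 0" using min[OF nz(2)] deg r(3) by simp
      then show ?thesis using nz by (simp add: is_unit_iff_degree)
    qed
  qed
  then show ?thesis using that r(2) evr dv by blast
qed

text \<open>The minimal polynomial shows that the description in \<open>abs_ac\<close> has a
  witness. Any other irreducible candidate is divisible by the minimal polynomial, hence associated
  to it, and so divides the polynomial with roots the \<open>n\<close>-th roots of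
  \<open>\<beta>\<close>; thus all candidates give one value.\<close>

lemma abs_ac_root:
  assumes \<alpha>: "\<alpha> ^ n = to_ac \<beta>" and n: "n \<ge> 1" and \<beta>: "\<beta> \<noteq> 0"
  shows "abs_ac \<alpha> = absK 1 \<beta> powr (1 / real n)"
proof -
  define q where "q = Polynomial.monom 1 n - [:\<beta>:]"
  have ev: "poly (map_poly to_ac q) \<gamma> = \<gamma> ^ n - to_ac \<beta>" for \<gamma>
    by (simp add: q_def map_poly_to_ac_diff map_poly_monom poly_monom map_poly_pCons)
  have "Polynomial.coeff q n = 1" using n by (cases n) (auto simp: q_def)
  then have q0: "q \<noteq> 0" by auto
  obtain r where r: "Factorial_Ring.irreducible r" "Polynomial.lead_coeff r = 1" "poly (map_poly to_ac r) \<alpha> = 0"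
    "\<And>q. poly (map_poly to_ac q) \<alpha> = 0 \<Longrightarrow> r dvd q"
    using exists_minimal_polynomial[OF q0, of \<alpha>] \<alpha> ev by auto
  have *: "absK 1 (Polynomial.coeff p 0) powr (1 / real (Polynomial.degree p)) = absK 1 \<beta> powr (1 / real n)"
    if p: "Factorial_Ring.irreducible p" "Polynomial.lead_coeff p = 1" "poly (map_poly to_ac p) \<alpha> = 0" for p
  proof (rule abs_ac_candidate_eq[OF \<alpha> n \<beta> p])
    have "r dvd p" by (rule r(4)[OF p(3)])
    moreover have "\<not> is_unit r" using r(1) by (simp add: Factorial_Ring.irreducible_def)
    ultimately have "p dvd r" using Factorial_Ring.irreducibleD'[OF p(1)] by blast
    then show "p dvd q" using r(4)[of q] ev \<alpha> dvd_trans by force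
  qed (simp add: ev)
  show ?thesis unfolding abs_ac_def
    by (rule the_equality) (use r(1-3) * in metis)+
qed

section \<open>Points of the analytic torus\<close>

locale torus_point =
  fixes m :: nat and x :: "'g::finite laurent_poly \<Rightarrow> real"
  assumes x: "x \<in> torus_an m"
begin

lemma nonneg [simp]: "0 \<le> x f"
  and mult: "x (f * g) = x f * x g"
  and triangle: "x (f + g) \<le> x f + x g"
  and const: "x (Poly_Mapping.single 0 a) = absK m a"
  using x by (auto simp: torus_an_def)

lemma one: "x 1 = 1"
  using const[of 1] by simp

lemma zero: "x 0 = 0"
  using const[of 0] by simp

lemma power: "x (f ^ n) = x f ^ n"
  by (induction n) (auto simp: one mult)

text \<open>Nonzero complex constants have absolute value one. This bound on the integers is what
  turns the triangle inequality into the ultrametric one.\<close>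

lemma of_nat_le: "x (of_nat n) \<le> 1"
proof -
  have "(of_nat n :: 'g laurent_poly) = Poly_Mapping.single 0 (of_nat n)" by simp
  then have "x (of_nat n) = absK m (of_nat n)" by (metis const)
  then show ?thesis by (simp add: absK_def)
qed

lemma minus: "x (- f) = x f"
proof -
  have "- f = Poly_Mapping.single 0 (- 1) * f" by (simp add: single_uminus)
  then show ?thesis by (simp add: mult const)
qed

lemma sum_le_sum: "x (sum h A) \<le> (\<Sum>i\<in>A. x (h i))"
  by (induction A rule: infinite_finite_induct) (auto simp: zero intro: order_trans[OF triangle])

text \<open>The binomial coefficients have norm at most one, so the \<open>n\<close>-th power of the left side is
  at most \<open>n + 1\<close> times that of the right side.\<close>
lemma ultrametric: "x (f + g) \<le> max (x f) (x g)"
proof (rule ccontr)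
  define M where "M = max (x f) (x g)"
  assume "\<not> ?thesis"
  then have gt: "M < x (f + g)" unfolding M_def by (simp only: not_le)
  have M0: "0 \<le> M" by (simp add: M_def le_max_iff_disj)
  have bound: "x (f + g) ^ n \<le> real (Suc n) * M ^ n" for n
  proof -
    have "x (f + g) ^ n = x (\<Sum>k\<le>n. of_nat (n choose k) * f ^ k * g ^ (n - k))"
      by (simp add: binomial_ring flip: power)
    also have "\<dots> \<le> (\<Sum>k\<le>n. x (of_nat (n choose k) * f ^ k * g ^ (n - k)))" by (rule sum_le_sum)
    also have "\<dots> \<le> (\<Sum>k\<le>n. M ^ n)"
    proof (rule sum_mono)
      fix k assume "k \<in> {..n}"
      then have "M ^ n = 1 * M ^ k * M ^ (n - k)" by (simp flip: power_add)
      moreover have "x (of_nat (n choose k)) * x f ^ k * x g ^ (n - k) \<le> 1 * M ^ k * M ^ (n - k)"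
        using M0 by (intro mult_mono power_mono of_nat_le mult_nonneg_nonneg zero_le_power) (auto simp: M_def)
      ultimately show "x (of_nat (n choose k) * f ^ k * g ^ (n - k)) \<le> M ^ n" by (simp add: mult power)
    qed
    finally show ?thesis by simp
  qed
  define q where "q = M / x (f + g)"
  have pos: "x (f + g) > 0" using gt M0 by simp
  have q: "0 \<le> q" "q < 1" using gt M0 pos by (auto simp: q_def)
  have "1 \<le> real (Suc n) * q ^ n" for n
    using bound[of n] pos by (simp add: q_def power_divide field_simps)
  moreover have "(\<lambda>n. real (Suc n) * q ^ n) \<longlonglongrightarrow> 0"
  proof -
    have "(\<lambda>n. real n * q ^ n + q ^ n) \<longlonglongrightarrow> 0 + 0"
      using q by (intro tendsto_add powser_times_n_limit_0 LIMSEQ_power_zero) auto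
    then show ?thesis by (simp add: algebra_simps)
  qed
  ultimately have "(1::real) \<le> 0" by (intro tendsto_lowerbound[of _ 0 sequentially 1]) auto
  then show False by simp
qed

lemma sum_le:
  assumes "\<And>i. i \<in> A \<Longrightarrow> x (h i) \<le> c" "0 \<le> c"
  shows "x (sum h A) \<le> c"
  using assms(1)
  by (induction A rule: infinite_finite_induct) (auto simp: zero assms(2) intro: order_trans[OF ultrametric])

lemma add_eq: "x g < x f \<Longrightarrow> x (f + g) = x f"
  using ultrametric[of f g] ultrametric[of "f + g" "- g"] by (auto simp: minus)

text \<open>Gives \<open>Lim\<close> a meaning for theta series. If some partial sum contains all
  terms of size at least \<epsilon> and is itself of size at least \<epsilon>, the remaining terms
  are too small to change its value. If this never happens, the values tend to 0.\<close>

lemma sum_lim_exists: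
  assumes fin: "\<And>\<epsilon>. \<epsilon> > 0 \<Longrightarrow> finite {e. x (h e) \<ge> \<epsilon>}"
  shows "\<exists>L. ((\<lambda>F. x (sum h F)) \<longlongrightarrow> L) (finite_subsets_at_top UNIV)"
proof (cases "\<exists>\<epsilon> F0. 0 < \<epsilon> \<and> finite F0 \<and> {e. x (h e) \<ge> \<epsilon>} \<subseteq> F0 \<and> x (sum h F0) \<ge> \<epsilon>")
  case True
  then obtain \<epsilon> F0 where F0: "0 < \<epsilon>" "finite F0" "{e. x (h e) \<ge> \<epsilon>} \<subseteq> F0" "x (sum h F0) \<ge> \<epsilon>" by blast
  have "x (sum h F) = x (sum h F0)" if "finite F" "F0 \<subseteq> F" for F
  proof (cases "F = F0")
    case False
    have "finite (F - F0)" using that by simp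
    define c where "c = Max ((\<lambda>e. x (h e)) ` (F - F0))"
    have ne: "F - F0 \<noteq> {}" using False that by auto
    have "c < \<epsilon>" unfolding c_def using F0(3) \<open>finite (F - F0)\<close> ne
      by (subst Max_less_iff) (auto simp: not_le[symmetric])
    have "x (sum h (F - F0)) \<le> max c 0"
      by (rule sum_le) (use \<open>finite (F - F0)\<close> in \<open>auto simp: c_def le_max_iff_disj\<close>)
    then have "x (sum h (F - F0)) < x (sum h F0)" using \<open>c < \<epsilon>\<close> F0 by linarith
    moreover have "sum h F = sum h F0 + sum h (F - F0)"
      using that by (metis add.commute sum.subset_diff)
    ultimately show ?thesis by (simp add: add_eq)
  qed simp
  then have "eventually (\<lambda>F. x (sum h F) = x (sum h F0)) (finite_subsets_at_top UNIV)"
    unfolding eventually_finite_subsets_at_top using F0(2) by blast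
  then show ?thesis by (intro exI tendsto_eventually)
next
  case False
  have "((\<lambda>F. x (sum h F)) \<longlongrightarrow> 0) (finite_subsets_at_top UNIV)"
  proof (rule tendstoI)
    fix \<epsilon> :: real assume e: "\<epsilon> > 0"
    have "x (sum h F) < \<epsilon>" if F: "finite F" "{e. x (h e) \<ge> \<epsilon>} \<subseteq> F" for F
    proof (rule ccontr)
      assume "\<not> x (sum h F) < \<epsilon>"
      then have "0 < \<epsilon> \<and> finite F \<and> {e. x (h e) \<ge> \<epsilon>} \<subseteq> F \<and> x (sum h F) \<ge> \<epsilon>"
        using e F by (intro conjI) (simp_all only: not_less)
      with False show False by blast
    qed
    then show "eventually (\<lambda>F. dist (x (sum h F)) 0 < \<epsilon>) (finite_subsets_at_top UNIV)"
      unfolding eventually_finite_subsets_at_top using fin[OF e] by auto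
  qed
  then show ?thesis by blast
qed

lemma sum_lim_le:
  assumes fin: "\<And>\<epsilon>. \<epsilon> > 0 \<Longrightarrow> finite {e. x (h e) \<ge> \<epsilon>}" and "\<And>e. x (h e) \<le> c" "0 \<le> c"
  shows "Lim (finite_subsets_at_top UNIV) (\<lambda>F. x (sum h F)) \<le> c"
proof -
  obtain L where L: "((\<lambda>F. x (sum h F)) \<longlongrightarrow> L) (finite_subsets_at_top UNIV)"
    using sum_lim_exists[OF fin] by blast
  have "L \<le> c"
    by (rule tendsto_upperbound[OF L]) (use assms in \<open>auto intro!: always_eventually sum_le\<close>)
  then show ?thesis using tendsto_Lim[OF _ L] by simp
qed

text \<open>A strictly largest term cannot be cancelled, so every partial sum that contains it has
  its value.\<close>

lemma sum_lim_dominant: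
  assumes fin: "\<And>\<epsilon>. \<epsilon> > 0 \<Longrightarrow> finite {e. x (h e) \<ge> \<epsilon>}" and dom: "\<And>e. e \<noteq> e0 \<Longrightarrow> x (h e) < x (h e0)"
    and pos: "x (h e0) > 0"
  shows "Lim (finite_subsets_at_top UNIV) (\<lambda>F. x (sum h F)) = x (h e0)"
proof -
  have "x (sum h F) = x (h e0)" if F: "finite F" "e0 \<in> F" for F
  proof -
    have "x (sum h (F - {e0})) < x (h e0)"
    proof (cases "F - {e0} = {}")
      case False
      define c where "c = Max ((\<lambda>e. x (h e)) ` (F - {e0}))"
      have fF: "finite (F - {e0})" using F by simp
      have "c < x (h e0)" unfolding c_def using fF False dom by (subst Max_less_iff) auto
      moreover have "x (sum h (F - {e0})) \<le> max c 0"
        by (rule sum_le) (use fF in \<open>auto simp: c_def le_max_iff_disj\<close>)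
      ultimately show ?thesis using pos by linarith
    qed (simp only: sum.empty zero pos)
    moreover have "sum h F = h e0 + sum h (F - {e0})" using F by (simp add: sum.remove)
    ultimately show ?thesis by (simp add: add_eq)
  qed
  then have "eventually (\<lambda>F. x (sum h F) = x (h e0)) (finite_subsets_at_top UNIV)"
    unfolding eventually_finite_subsets_at_top by (intro exI[of _ "{e0}"]) auto
  then show ?thesis by (intro tendsto_Lim tendsto_eventually) auto
qed

end

section \<open>Additive functions on integer vectors\<close>

lemma int_vec_eq_sum: "(e :: int ^ 'g::finite) = (\<Sum>i\<in>UNIV. e $ i *s axis i 1)"
  by (auto simp: vec_eq_iff axis_def if_distrib[of "\<lambda>t. _ * t"] cong: if_cong)

lemma additive_scale:
  fixes L :: "int ^ 'g::finite \<Rightarrow> real"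
  assumes "\<And>e e'. L (e + e') = L e + L e'"
  shows "L (n *s e) = real_of_int n * L e"
proof -
  interpret additive L by unfold_locales (rule assms)
  show ?thesis
  proof (induction n rule: int_induct[of _ 0])
    case base
    then show ?case using zero by (simp add: vec_eq_iff)
  next
    case (step1 i)
    then show ?case by (simp add: vector_sadd_rdistrib assms algebra_simps)
  next
    case (step2 i)
    have "L (i *s e) = L ((i - 1) *s e + e)"
      by (rule arg_cong[of _ _ L]) (simp add: vec_eq_iff algebra_simps)
    then have "L ((i - 1) *s e) = real_of_int i * L e - L e"
      unfolding step2.IH assms by simp
    then show ?case by (simp only: of_int_diff of_int_1 left_diff_distrib mult_1)
  qed
qed

lemma additive_eq_sum:
  fixes L :: "int ^ 'g::finite \<Rightarrow> real"
  assumes "\<And>e e'. L (e + e') = L e + L e'"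
  shows "L e = (\<Sum>i\<in>UNIV. real_of_int (e $ i) * L (axis i 1))"
proof -
  interpret additive L by unfold_locales (rule assms)
  have "L e = L (\<Sum>i\<in>UNIV. e $ i *s axis i 1)" using int_vec_eq_sum[of e] by simp
  then show ?thesis by (simp add: sum additive_scale[OF assms])
qed

lemma rvec_add: "rvec (e + e') = rvec e + rvec e'"
  and rvec_scale: "rvec (n *s e) = real_of_int n *\<^sub>R rvec e"
  and rvec_axis: "rvec (axis i 1) = axis i 1"
  by (auto simp: rvec_def vec_eq_iff axis_def)

lemma rvec_nth [simp]: "rvec e $ i = real_of_int (e $ i)"
  by (simp add: rvec_def)

lemma norm_rvec_ge_1: "e \<noteq> 0 \<Longrightarrow> 1 \<le> norm (rvec e)"
proof -
  assume "e \<noteq> 0"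
  then obtain i where "e $ i \<noteq> 0" by (auto simp: vec_eq_iff)
  then have "1 \<le> \<bar>rvec e $ i\<bar>" by simp
  also have "\<dots> \<le> norm (rvec e)" by (rule component_le_norm_cart)
  finally show ?thesis .
qed

lemma finite_int_box: "finite {e :: int ^ 'g::finite. \<forall>i. e $ i \<in> A}" if "finite A"
proof (rule finite_subset)
  show "{e :: int ^ 'g. \<forall>i. e $ i \<in> A} \<subseteq> (\<lambda>f. \<chi> i. f i) ` (PiE UNIV (\<lambda>_. A))"
  proof
    fix e :: "int ^ 'g" assume "e \<in> {e. \<forall>i. e $ i \<in> A}"
    then show "e \<in> (\<lambda>f. \<chi> i. f i) ` (PiE UNIV (\<lambda>_. A))"
      by (intro image_eqI[of _ _ "\<lambda>i. e $ i"]) auto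
  qed
  show "finite ((\<lambda>f. \<chi> i. f i) ` (PiE (UNIV :: 'g set) (\<lambda>_. A)))"
    using that by (intro finite_imageI finite_PiE) auto
qed

text \<open>Discreteness of the lattice; it leads to the finiteness hypothesis of the limit lemmas
  for theta series.\<close>

lemma finite_rvec_ball: "finite {e :: int ^ 'g::finite. norm (rvec e + v) \<le> R}"
proof (rule finite_subset)
  define c where "c = \<lceil>R + norm v\<rceil>"
  show "{e :: int ^ 'g. norm (rvec e + v) \<le> R} \<subseteq> {e. \<forall>i. e $ i \<in> {-c..c}}"
  proof safe
    fix e :: "int ^ 'g" and i assume "norm (rvec e + v) \<le> R"
    then have "norm (rvec e) \<le> R + norm v" using norm_triangle_ineq4[of "rvec e + v" v] by simp
    then have "\<bar>rvec e $ i\<bar> \<le> R + norm v" using component_le_norm_cart[of "rvec e" i] by linarith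
    then have "\<bar>real_of_int (e $ i)\<bar> \<le> R + norm v" by simp
    then show "e $ i \<in> {-c..c}" unfolding c_def by (auto simp: abs_le_iff) linarith+
  qed
qed (rule finite_int_box, simp)

text \<open>Monomials are units, so their values are positive and the logarithm of the value is
  additive in the exponent; on the basis it is minus the coordinate of
  \<open>trop x\<close>.\<close>

lemma (in torus_point) monomial:
  "x (Poly_Mapping.single e a) = absK m a * exp (- (rvec e \<bullet> trop x))"
proof -
  define ch where "ch e = x (Poly_Mapping.single e 1)" for e
  have ch_add: "ch (e + e') = ch e * ch e'" for e e'
    unfolding ch_def by (simp add: mult_single flip: mult)
  have "ch e * ch (- e) = 1" for e
    using ch_add[of e "- e"] one by (simp add: ch_def)
  then have pos: "ch e > 0" for e
    using nonneg[of "Poly_Mapping.single e 1"] by (auto simp: less_le ch_def) (metis mult_zero_left zero_neq_one)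
  have add: "ln (ch (e + e')) = ln (ch e) + ln (ch e')" for e e'
    using pos[of e] pos[of e'] by (simp add: ch_add ln_mult)
  have "ln (ch e) = (\<Sum>i\<in>UNIV. real_of_int (e $ i) * ln (ch (axis i 1)))"
    by (rule additive_eq_sum) (rule add)
  also have "\<dots> = - (rvec e \<bullet> trop x)"
    by (simp add: inner_vec_def trop_def ch_def sum_negf)
  finally have "ch e = exp (- (rvec e \<bullet> trop x))"
    using pos[of e] by (metis exp_ln)
  moreover have "Poly_Mapping.single e a = Poly_Mapping.single 0 a * Poly_Mapping.single e 1"
    by (simp add: mult_single)
  ultimately show ?thesis by (simp add: mult const ch_def)
qed

section \<open>The quadratic form of a degeneration\<close>

locale degeneration =
  fixes a :: "int ^ 'g::finite \<Rightarrow> complex fls" and b :: "int ^ 'g \<Rightarrow> int ^ 'g \<Rightarrow> complex fls"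
    and \<Phi> :: "int ^ 'g \<Rightarrow> int ^ 'g"
  assumes degeneration_data: "degeneration_data a b \<Phi>"
begin

lemma \<Phi>_add: "\<Phi> (l + l') = \<Phi> l + \<Phi> l'"
  and inj_\<Phi>: "inj \<Phi>"
  and finite_coker: "finite (range (\<lambda>e. {e + \<Phi> l | l. True}))"
  and b_nonzero: "b l e \<noteq> 0"
  and b_add_left: "b (l + l') e = b l e * b l' e"
  and b_add_right: "b l (e + e') = b l e * b l e'"
  and b_sym: "b l (\<Phi> l') = b l' (\<Phi> l)"
  and a_square: "(a l)\<^sup>2 = b l (\<Phi> l)"
  using degeneration_data unfolding degeneration_data_def by blast+

lemma posdef_hyp:
  assumes "bilinear Q" "\<And>l l'. Q (rvec l) (rvec l') = - ln (absK 1 (b l (\<Phi> l')))" "y \<noteq> 0"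
  shows "Q y y > 0"
  using degeneration_data assms unfolding degeneration_data_def by blast

definition \<beta> :: "int ^ 'g \<Rightarrow> int ^ 'g \<Rightarrow> real" where
  "\<beta> l e = - ln (absK 1 (b l e))"

lemma \<beta>_add_left: "\<beta> (l + l') e = \<beta> l e + \<beta> l' e"
  and \<beta>_add_right: "\<beta> l (e + e') = \<beta> l e + \<beta> l e'"
  by (simp_all add: \<beta>_def b_add_left b_add_right absK_mult ln_mult b_nonzero)

lemma \<beta>_scale_left: "\<beta> (n *s l) e = real_of_int n * \<beta> l e"
  using additive_scale[of "\<lambda>l. \<beta> l e"] by (simp add: \<beta>_add_left)

lemma \<beta>_scale_right: "\<beta> l (n *s e) = real_of_int n * \<beta> l e"
  using additive_scale[of "\<beta> l"] by (simp add: \<beta>_add_right)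

lemma \<Phi>_0: "\<Phi> 0 = 0"
  using \<Phi>_add[of 0 0] by simp

lemma \<Phi>_minus: "\<Phi> (- l) = - \<Phi> l"
  using \<Phi>_add[of l "- l"] by (simp add: \<Phi>_0 eq_neg_iff_add_eq_0 add.commute)

lemma \<Phi>_diff: "\<Phi> (l - l') = \<Phi> l - \<Phi> l'"
  using \<Phi>_add[of l "- l'"] by (simp add: \<Phi>_minus)

lemma \<Phi>_scale: "\<Phi> (n *s l) = n *s \<Phi> l"
proof (induction n rule: int_induct[of _ 0])
  case base
  have "0 *s v = 0" for v :: "int ^ 'g" by (simp add: vec_eq_iff)
  then show ?case by (simp add: \<Phi>_0)
next
  case (step1 i)
  then show ?case by (simp add: vector_sadd_rdistrib \<Phi>_add)
next
  case (step2 i)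
  have "(i - 1) *s v = i *s v - v" for v :: "int ^ 'g" by (simp add: vec_eq_iff algebra_simps)
  with step2 show ?case by (simp add: \<Phi>_diff)
qed

lemma \<Phi>_sum: "\<Phi> (sum f A) = (\<Sum>i\<in>A. \<Phi> (f i))"
  by (induction A rule: infinite_finite_induct) (auto simp: \<Phi>_0 \<Phi>_add)

text \<open>With \<open>n\<close> cosets, two of the multiples of \<open>e\<close> by 0, ...,
  \<open>n\<close> lie in the same coset, so a positive multiple by at most \<open>n\<close> lies in
  the range. The factorial is a common choice for all \<open>e\<close>.\<close>

lemma exists_multiple_in_range: "\<exists>N::nat. N \<ge> 1 \<and> (\<forall>e. \<exists>l. int N *s e = \<Phi> l)"
proof -
  define C where "C e = {e + \<Phi> l | l. True}" for e
  define n where "n = card (range C)"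
  have fin: "finite (range C)" using finite_coker by (simp add: C_def[abs_def])
  have "\<exists>l. int (fact n) *s e = \<Phi> l" for e
  proof -
    define h where "h i = C (int i *s e)" for i :: nat
    have "card (h ` {0..n}) \<le> n"
      unfolding n_def by (rule card_mono[OF fin]) (auto simp: h_def)
    then have "\<not> inj_on h {0..n}"
      using card_image[of h "{0..n}"] by auto
    then obtain i j where ij: "i < j" "j \<le> n" "h i = h j"
      unfolding inj_on_def by (metis atLeastAtMost_iff linorder_neqE_nat)
    have "int j *s e \<in> C (int j *s e)"
      unfolding C_def by (auto intro: exI[of _ 0] simp: \<Phi>_0)
    then have "int j *s e \<in> C (int i *s e)" using ij by (simp add: h_def)
    then obtain l where "int j *s e = int i *s e + \<Phi> l" by (auto simp: C_def)
    moreover have "int (j - i) *s e = int j *s e - int i *s e"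
      using ij by (simp add: vec_eq_iff of_nat_diff algebra_simps)
    ultimately have l: "int (j - i) *s e = \<Phi> l" by simp
    have "j - i dvd fact n" using ij by (intro dvd_fact) auto
    then obtain q where "fact n = (j - i) * q" by (elim dvdE)
    then have "int (fact n) *s e = int q *s (int (j - i) *s e)"
      by (simp add: vector_smult_assoc algebra_simps flip: of_nat_mult)
    then show ?thesis by (metis l \<Phi>_scale)
  qed
  then show ?thesis by (intro exI[of _ "fact n"]) (auto simp: fact_ge_1)
qed

lemma B_form_unique:
  assumes "bilinear B" "\<And>l e. B (rvec (\<Phi> l)) (rvec e) = \<beta> l e"
    and "bilinear B'" "\<And>l e. B' (rvec (\<Phi> l)) (rvec e) = \<beta> l e"
  shows "B = B'"
proof (rule bilinear_eq_stdbasis[OF assms(1,3)])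
  fix u v :: "real ^ 'g" assume "u \<in> Basis" "v \<in> Basis"
  then obtain i j where uv: "u = axis i 1" "v = axis j 1" by (auto simp: Basis_vec_def)
  obtain N :: nat and l where N: "N \<ge> 1" "int N *s axis i 1 = \<Phi> l"
    using exists_multiple_in_range by metis
  have *: "real N * D u v = D (rvec (\<Phi> l)) (rvec (axis j 1))" if "bilinear D" for D :: "real ^ 'g \<Rightarrow> real ^ 'g \<Rightarrow> real"
    unfolding N(2)[symmetric] rvec_scale rvec_axis uv using bilinear_lmul[OF that] by simp
  have "real N * B u v = real N * B' u v"
    unfolding *[OF assms(1)] *[OF assms(3)] assms(2,4) ..
  then show "B u v = B' u v" using N(1) by simp
qed

text \<open>If \<open>N\<close> times the basis vectors are the images of \<open>\<nu>\<close>, the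
  entries of the matrix are forced to be values of \<open>\<beta>\<close> divided by
  \<open>N\<close>. The required equation follows since, by injectivity of \<open>\<Phi>\<close>,
  the combination of the \<open>\<nu> (axis i 1)\<close> with the coefficients of
  \<open>\<Phi> l\<close> is \<open>int N *s l\<close>.\<close>

lemma B_form_exists: "\<exists>B. bilinear B \<and> (\<forall>l e. B (rvec (\<Phi> l)) (rvec e) = \<beta> l e)"
proof -
  obtain N :: nat and \<nu> where N: "N \<ge> 1" "\<And>e. int N *s e = \<Phi> (\<nu> e)"
    using exists_multiple_in_range by metis
  define B where "B y y' = (\<Sum>i\<in>UNIV. \<Sum>j\<in>UNIV. y $ i * (y' $ j) * (\<beta> (\<nu> (axis i 1)) (axis j 1) / real N))" for y y' :: "real ^ 'g"
  have "bilinear B"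
    unfolding bilinear_def B_def
    by (auto intro!: linearI simp: algebra_simps add_divide_distrib sum.distrib sum_distrib_left)
  moreover have "B (rvec (\<Phi> l)) (rvec e) = \<beta> l e" for l e
  proof -
    have "B (rvec (\<Phi> l)) (rvec e) = (\<Sum>i\<in>UNIV. real_of_int (\<Phi> l $ i) * \<beta> (\<nu> (axis i 1)) e) / real N"
      unfolding B_def additive_eq_sum[of "\<beta> l" e for l, OF \<beta>_add_right]
      by (simp add: sum_distrib_left sum_divide_distrib algebra_simps)
    also have "(\<Sum>i\<in>UNIV. real_of_int (\<Phi> l $ i) * \<beta> (\<nu> (axis i 1)) e) = \<beta> (\<Sum>i\<in>UNIV. \<Phi> l $ i *s \<nu> (axis i 1)) e"
    proof -
      interpret additive "\<lambda>l. \<beta> l e" by unfold_locales (rule \<beta>_add_left)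
      show ?thesis by (simp add: sum \<beta>_scale_left)
    qed
    also have "(\<Sum>i\<in>UNIV. \<Phi> l $ i *s \<nu> (axis i 1)) = int N *s l"
    proof (rule injD[OF inj_\<Phi>])
      have "\<Phi> (\<Sum>i\<in>UNIV. \<Phi> l $ i *s \<nu> (axis i 1)) = (\<Sum>i\<in>UNIV. int N *s (\<Phi> l $ i *s axis i 1))"
        unfolding \<Phi>_sum \<Phi>_scale N(2)[symmetric] by (simp add: vector_smult_assoc mult.commute)
      also have "\<dots> = int N *s (\<Sum>i\<in>UNIV. \<Phi> l $ i *s axis i 1)"
        by (simp add: vec_eq_iff sum_distrib_left mult.assoc)
      also have "\<dots> = \<Phi> (int N *s l)" unfolding \<Phi>_scale int_vec_eq_sum[symmetric] ..
      finally show "\<Phi> (\<Sum>i\<in>UNIV. \<Phi> l $ i *s \<nu> (axis i 1)) = \<Phi> (int N *s l)" .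
    qed
    finally show ?thesis using N(1) by (simp add: \<beta>_scale_left)
  qed
  ultimately show ?thesis by blast
qed

abbreviation B :: "real ^ 'g \<Rightarrow> real ^ 'g \<Rightarrow> real" where "B \<equiv> B_form b \<Phi>"

lemma bilinear_B: "bilinear B"
  and B_rvec: "B (rvec (\<Phi> l)) (rvec e) = \<beta> l e"
proof -
  have "\<exists>!B. bilinear B \<and> (\<forall>l e. B (rvec (\<Phi> l)) (rvec e) = \<beta> l e)"
    using B_form_exists B_form_unique by (intro ex_ex1I) blast+
  from theI'[OF this] show "bilinear B" "B (rvec (\<Phi> l)) (rvec e) = \<beta> l e"
    by (auto simp: B_form_def \<beta>_def)
qed

text \<open>The form with exchanged arguments satisfies the equations that characterize
  \<open>B\<close>: after multiplying \<open>e\<close> into the range of \<open>\<Phi>\<close>, this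
  is the symmetry \<open>b_sym\<close>.\<close>

lemma B_sym: "B y y' = B y' y"
proof -
  have "B (rvec e) (rvec (\<Phi> l)) = \<beta> l e" for l e
  proof -
    obtain N :: nat and l' where N: "N \<ge> 1" "int N *s e = \<Phi> l'"
      using exists_multiple_in_range by metis
    have "real N * B (rvec e) (rvec (\<Phi> l)) = B (rvec (int N *s e)) (rvec (\<Phi> l))"
      unfolding rvec_scale bilinear_lmul[OF bilinear_B] by simp
    also have "\<dots> = \<beta> l (int N *s e)" unfolding N(2) B_rvec by (simp add: \<beta>_def b_sym)
    finally show ?thesis using N(1) by (simp add: \<beta>_scale_right)
  qed
  moreover have "bilinear (\<lambda>y y'. B y' y)" using bilinear_B by (simp add: bilinear_def)
  ultimately have "B = (\<lambda>y y'. B y' y)"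
    by (intro B_form_unique[OF bilinear_B B_rvec]) auto
  then show ?thesis by metis
qed

text \<open>Positivity is assumed for the form pulled back along the real extension \<open>P\<close>
  of \<open>\<Phi>\<close>. As the cokernel of \<open>\<Phi>\<close> is finite, \<open>P\<close> is
  surjective; \<open>y'\<close> is an explicit preimage of \<open>y\<close>.\<close>

lemma B_posdef: assumes "y \<noteq> 0" shows "B y y > 0"
proof -
  define P where "P y = (\<Sum>i\<in>UNIV. y $ i *\<^sub>R rvec (\<Phi> (axis i 1)))" for y :: "real ^ 'g"
  have linP: "linear P" unfolding P_def
    by (auto intro!: linearI simp: scaleR_add_left sum.distrib scaleR_sum_right)
  have P_rvec: "P (rvec l) = rvec (\<Phi> l)" for l
  proof -
    have "\<Phi> l = (\<Sum>i\<in>UNIV. l $ i *s \<Phi> (axis i 1))"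
      using arg_cong[OF int_vec_eq_sum[of l], of \<Phi>] by (simp add: \<Phi>_sum \<Phi>_scale)
    then show ?thesis by (simp add: P_def vec_eq_iff)
  qed
  have bil: "bilinear (\<lambda>y y'. B (P y) (P y'))"
    using bilinear_B linP unfolding bilinear_def by (auto intro: linear_compose[unfolded o_def])
  obtain N :: nat and \<nu> where N: "N \<ge> 1" "\<And>e. int N *s e = \<Phi> (\<nu> e)"
    using exists_multiple_in_range by metis
  define y' where "y' = (\<Sum>i\<in>UNIV. (y $ i / real N) *\<^sub>R rvec (\<nu> (axis i 1)))"
  have "P y' = (\<Sum>i\<in>UNIV. (y $ i / real N) *\<^sub>R rvec (int N *s axis i 1))"
    unfolding y'_def by (simp add: linear_sum[OF linP] linear_scale[OF linP] P_rvec N(2))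
  also have "\<dots> = (\<Sum>i\<in>UNIV. y $ i *\<^sub>R axis i 1)" using N(1) by (simp add: rvec_scale rvec_axis)
  also have "\<dots> = y" using basis_expansion[of y] by (simp add: scalar_mult_eq_scaleR)
  finally have Py: "P y' = y" .
  then have "y' \<noteq> 0" using assms linear_0[OF linP] by auto
  have "B (P y') (P y') > 0"
    by (rule posdef_hyp[OF bil _ \<open>y' \<noteq> 0\<close>]) (simp add: P_rvec B_rvec \<beta>_def)
  then show ?thesis by (simp add: Py)
qed

lemma B_nonneg: "0 \<le> B y y"
  using B_posdef[of y] bilinear_lzero[OF bilinear_B] by (cases "y = 0") auto

section \<open>Bounds for the quadratic form and its Legendre transform\<close>

lemma B_lower_bound: "\<exists>\<mu>>0. \<forall>y. \<mu> * (norm y)\<^sup>2 \<le> B y y"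
proof -
  have bb: "bounded_bilinear B" using bilinear_B by (simp add: bilinear_conv_bounded_bilinear)
  have cont: "continuous_on (sphere 0 1) (\<lambda>y. B y y)"
    by (intro bounded_bilinear.continuous_on[OF bb] continuous_on_id)
  have "sphere 0 1 \<noteq> ({} :: (real ^ 'g) set)" by simp
  then obtain y0 where y0: "y0 \<in> sphere 0 1" "\<And>y. y \<in> sphere 0 1 \<Longrightarrow> B y0 y0 \<le> B y y"
    using continuous_attains_inf[OF compact_sphere _ cont] by blast
  have "B y0 y0 * (norm y)\<^sup>2 \<le> B y y" for y
  proof (cases "y = 0")
    case False
    define u where "u = (1 / norm y) *\<^sub>R y"
    have "u \<in> sphere 0 1" using False by (simp add: u_def)
    then have "B y0 y0 \<le> B u u" by (rule y0(2))
    moreover have "B u u = B y y / (norm y)\<^sup>2"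
      by (simp add: u_def bilinear_lmul[OF bilinear_B] bilinear_rmul[OF bilinear_B] power2_eq_square)
    ultimately show ?thesis using False by (simp add: field_simps)
  qed (simp add: bilinear_lzero[OF bilinear_B])
  moreover have "B y0 y0 > 0" using y0(1) by (intro B_posdef) auto
  ultimately show ?thesis by blast
qed

lemma B_upper_bound: "\<exists>M>0. \<forall>y. B y y \<le> M * (norm y)\<^sup>2"
proof -
  have "bounded_bilinear B" using bilinear_B by (simp add: bilinear_conv_bounded_bilinear)
  from bounded_bilinear.pos_bounded[OF this] obtain M where "M > 0" "\<And>y y'. norm (B y y') \<le> norm y * norm y' * M"
    by blast
  then have "B y y \<le> M * (norm y)\<^sup>2" for y
    using abs_le_D1[of "B y y"] by (simp add: power2_eq_square algebra_simps)
  then show ?thesis using \<open>M > 0\<close> by blast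
qed

lemma B_add_square: "B (y + y') (y + y') = B y y + 2 * B y y' + B y' y'"
  by (simp add: bilinear_ladd[OF bilinear_B] bilinear_radd[OF bilinear_B] B_sym[of y' y])

text \<open>Definiteness makes \<open>B\<close> nondegenerate. The vector \<open>v\<close> is the
  maximum point of the concave function whose supremum is \<open>A_dual b \<Phi> n\<close>, and
  \<open>A_dual_eq\<close> completes the square there.\<close>

lemma B_represents: "\<exists>v. \<forall>y. B v y = n \<bullet> y"
proof -
  define L where "L y = (\<chi> i. B y (axis i 1))" for y
  have linL: "linear L"
    by (auto intro!: linearI simp: L_def vec_eq_iff bilinear_ladd[OF bilinear_B] bilinear_lmul[OF bilinear_B])
  have exp: "B y y' = L y \<bullet> y'" for y y'
  proof -
    have "B y (\<Sum>i\<in>UNIV. y' $ i *\<^sub>R axis i 1) = (\<Sum>i\<in>UNIV. y' $ i *\<^sub>R B y (axis i 1))"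
      using bilinear_B by (simp add: bilinear_def linear_sum linear_scale)
    moreover have "(\<Sum>i\<in>UNIV. y' $ i *\<^sub>R axis i 1) = y'"
      using basis_expansion[of y'] by (simp add: scalar_mult_eq_scaleR)
    ultimately show ?thesis by (simp add: inner_vec_def L_def mult.commute)
  qed
  have "inj L" unfolding linear_injective_0[OF linL]
  proof (intro allI impI)
    fix y assume "L y = 0"
    then have "B y y = 0" by (simp add: exp)
    then show "y = 0" using B_posdef[of y] by force
  qed
  then have "surj L" by (rule linear_injective_imp_surjective[OF linL]) simp
  then obtain v where "L v = n" by (metis surjD)
  then show ?thesis by (metis exp)
qed

lemma A_dual_eq:
  assumes "\<And>y. B v y = n \<bullet> y"
  shows "A_dual b \<Phi> n = B v v / 2"
  unfolding A_dual_def
proof (rule cSup_eq_maximum)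
  have "B v v / 2 = v \<bullet> n - B v v / 2" using assms[of v] by (simp add: inner_commute)
  then show "B v v / 2 \<in> range (\<lambda>y. y \<bullet> n - B y y / 2)" by blast
  fix t assume "t \<in> range (\<lambda>y. y \<bullet> n - B y y / 2)"
  then obtain y where t: "t = y \<bullet> n - B y y / 2" by blast
  have "0 \<le> B (v - y) (v - y)" by (rule B_nonneg)
  also have "\<dots> = B v v - 2 * B v y + B y y"
    by (simp add: bilinear_lsub[OF bilinear_B] bilinear_rsub[OF bilinear_B] B_sym[of y v])
  finally show "t \<le> B v v / 2" unfolding t using assms[of y] by (simp add: inner_commute)
qed

end

section \<open>The non-Archimedean balanced metric\<close>

context degeneration
begin

lemma absK_b: "absK 1 (b l e) = exp (- B (rvec (\<Phi> l)) (rvec e))"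
  unfolding B_rvec \<beta>_def using b_nonzero by simp

lemma absK_a: "absK 1 (a l) = exp (- B (rvec (\<Phi> l)) (rvec (\<Phi> l)) / 2)"
proof -
  have "absK 1 (a l) ^ 2 = (exp (- B (rvec (\<Phi> l)) (rvec (\<Phi> l)) / 2)) ^ 2"
    by (simp add: absK_b a_square del: One_nat_def flip: absK_power exp_double)
  then show ?thesis by (rule power2_eq_imp_eq) auto
qed

text \<open>If \<open>int N *s e = \<Phi> l\<close>, then \<open>ak e ^ (2 * k * N)\<close>,
  \<open>bk e e ^ (k * N)\<close>, \<open>bk (int k *s \<Phi> l) e\<close> and
  \<open>to_ac (b l e)\<close> are equal, so \<open>ak e\<close> is a radical of an element of the
  ground field.\<close>

lemma abs_ac_ak:
  assumes bd: "balanced_data a b \<Phi> k ak bk S" and k: "k \<ge> 1"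
  shows "abs_ac (ak e) = exp (- B (rvec e) (rvec e) / (2 * real k))"
proof -
  obtain N :: nat and l where N: "N \<ge> 1" "int N *s e = \<Phi> l"
    using exists_multiple_in_range by metis
  have bk_add: "bk (e + e') e'' = bk e e'' * bk e' e''" and bk_nz: "bk e e' \<noteq> 0"
    and bk_k: "bk (int k *s \<Phi> l) e = to_ac (b l e)" and ak2: "(ak e)\<^sup>2 = bk e e" for e e' e'' l
    using bd unfolding balanced_data_def by blast+
  have bk0: "bk 0 e' = 1" for e' using bk_add[of 0 0 e'] bk_nz[of 0 e'] by simp
  have bk_pow: "bk (int n *s e) e' = bk e e' ^ n" for n e e'
  proof (induction n)
    case 0
    have "int 0 *s e = 0" by (simp add: vec_eq_iff)
    then show ?case by (simp add: bk0)
  next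
    case (Suc n)
    have "int (Suc n) *s e = e + int n *s e" by (simp add: vec_eq_iff algebra_simps)
    with Suc show ?case by (simp add: bk_add)
  qed
  have "int (k * N) *s e = int k *s \<Phi> l"
    unfolding N(2)[symmetric] by (simp add: vector_smult_assoc)
  then have "to_ac (b l e) = bk e e ^ (k * N)"
    unfolding bk_pow[symmetric] bk_k[symmetric] by simp
  also have "\<dots> = ak e ^ (2 * (k * N))" by (simp only: power_mult ak2)
  finally have pw: "ak e ^ (2 * (k * N)) = to_ac (b l e)" ..
  have "B (rvec (\<Phi> l)) (rvec e) = real N * B (rvec e) (rvec e)"
    unfolding N(2)[symmetric] rvec_scale bilinear_lmul[OF bilinear_B] by simp
  moreover have "abs_ac (ak e) = absK 1 (b l e) powr (1 / real (2 * (k * N)))"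
    by (rule abs_ac_root[OF pw _ b_nonzero]) (use k N(1) in auto)
  ultimately show ?thesis using N(1) k
    by (simp add: absK_b powr_def field_simps del: One_nat_def)
qed

lemma theta_coset:
  assumes "k \<ge> 1" shows "theta a b \<Phi> k e (e + int k *s \<Phi> l) = a l ^ k * b l e"
proof -
  have "{l'. e + int k *s \<Phi> l = e + int k *s \<Phi> l'} = {l}"
  proof (intro equalityI subsetI)
    fix l' assume "l' \<in> {l'. e + int k *s \<Phi> l = e + int k *s \<Phi> l'}"
    then have "\<Phi> l = \<Phi> l'" using assms by (simp add: vec_eq_iff)
    then show "l' \<in> {l}" using injD[OF inj_\<Phi>] by blast
  qed simp
  then show ?thesis by (simp add: theta_def)
qed

lemma theta_outside_coset: "\<nexists>l. e' = e + int k *s \<Phi> l \<Longrightarrow> theta a b \<Phi> k e e' = 0"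
  unfolding theta_def by (rule sum.neutral) blast

text \<open>The factor \<open>abs_ac (ak e)\<close> supplies the missing part of the square of
  \<open>e + k \<Phi>(l)\<close>. The weighted coefficient at \<open>e'\<close> thus no longer
  depends on the representative \<open>e\<close>, and all the theta functions together carry one
  Gaussian on the lattice.\<close>

lemma theta_weight:
  assumes bd: "balanced_data a b \<Phi> k ak bk S" and k: "k \<ge> 1" and e': "e' = e + int k *s \<Phi> l"
  shows "absK 1 (theta a b \<Phi> k e e') * abs_ac (ak e) = exp (- B (rvec e') (rvec e') / (2 * real k))"
proof -
  let ?u = "rvec e" and ?v = "rvec (\<Phi> l)"
  have "absK 1 (theta a b \<Phi> k e e') * abs_ac (ak e) =
      exp (real k * (- B ?v ?v / 2) + - B ?v ?u + - B ?u ?u / (2 * real k))"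
    unfolding e' theta_coset[OF k] absK_mult absK_power absK_a absK_b abs_ac_ak[OF bd k] exp_add exp_of_nat_mult ..
  also have "real k * (- B ?v ?v / 2) + - B ?v ?u + - B ?u ?u / (2 * real k) = - B (rvec e') (rvec e') / (2 * real k)"
    using k unfolding e' rvec_add rvec_scale B_add_square
    by (simp add: bilinear_lmul[OF bilinear_B] bilinear_rmul[OF bilinear_B] B_sym[of ?u ?v] field_simps)
  finally show ?thesis .
qed

lemma representative_unique:
  assumes "balanced_data a b \<Phi> k ak bk S" shows "\<exists>!e'. e' \<in> S \<and> (\<exists>l. e = e' + int k *s \<Phi> l)"
proof -
  have "\<forall>e. \<exists>!e'. e' \<in> S \<and> (\<exists>l. e = e' + int k *s \<Phi> l)"
    using assms unfolding balanced_data_def by (elim conjE)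
  then show ?thesis by (rule spec)
qed

text \<open>The cokernel of \<open>k \<Phi>\<close> is killed by \<open>k * N\<close>, so reducing
  coordinates modulo this number stays in the coset and is injective on representatives. Finiteness
  is needed for the \<open>Max\<close> in \<open>na_balanced\<close>.\<close>

lemma finite_representatives:
  assumes bd: "balanced_data a b \<Phi> k ak bk S" and k: "k \<ge> 1" shows "finite S"
proof -
  obtain N :: nat and \<nu> where N: "N \<ge> 1" "\<And>e. int N *s e = \<Phi> (\<nu> e)"
    using exists_multiple_in_range by metis
  define K where "K = int (k * N)"
  have K: "K > 0" using k N(1) by (simp add: K_def)
  define r where "r e = (\<chi> i. e $ i mod K)" for e :: "int ^ 'g"
  have r: "\<exists>l. e = r e + int k *s \<Phi> l" for e
  proof -
    define q where "q = (\<chi> i. e $ i div K)"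
    have "e = r e + K *s q" by (simp add: vec_eq_iff r_def q_def)
    also have "K *s q = int k *s \<Phi> (\<nu> q)" unfolding N(2)[symmetric] by (simp add: K_def vector_smult_assoc)
    finally show ?thesis by blast
  qed
  note uniq = representative_unique[OF bd]
  have "inj_on r S"
  proof (rule inj_onI)
    fix e e' assume S: "e \<in> S" "e' \<in> S" and eq: "r e = r e'"
    obtain l l' where l: "e = r e + int k *s \<Phi> l" "e' = r e' + int k *s \<Phi> l'" using r by metis
    have 1: "r e = e + int k *s \<Phi> (- l)"
      using arg_cong[OF l(1), of "\<lambda>t. t - int k *s \<Phi> l"] by (simp add: \<Phi>_minus vec_eq_iff)
    have 2: "r e = e' + int k *s \<Phi> (- l')"
      unfolding eq using arg_cong[OF l(2), of "\<lambda>t. t - int k *s \<Phi> l'"] by (simp add: \<Phi>_minus vec_eq_iff)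
    show "e = e'" using uniq[of "r e"] S 1 2 by blast
  qed
  moreover have "finite (r ` S)"
  proof (rule finite_subset)
    show "r ` S \<subseteq> {e. \<forall>i. e $ i \<in> {0..<K}}" using K by (auto simp: r_def)
  qed (rule finite_int_box, simp)
  ultimately show ?thesis by (rule finite_imageD[rotated])
qed

text \<open>The logarithms of the terms of all the theta functions at a point are the values on
  \<open>int ^ 'g\<close> of one concave quadratic function with maximum \<open>k * A_dual b \<Phi> (trop x)\<close>, so the maximal term
  is at a lattice point \<open>e\<close> at bounded distance from the real maximum point. Any other
  maximal term in the same theta function would differ from \<open>e\<close> by a multiple of \<open>k\<close>; hence for large
  \<open>k\<close> there is no cancellation.\<close>
proposition na_balanced_estimate:
  "\<exists>C. \<exists>k\<^sub>0>0. \<forall>k\<ge>k\<^sub>0. \<forall>ak bk S m x. balanced_data a b \<Phi> k ak bk S \<and> m \<ge> 1 \<and> x \<in> torus_an m \<longrightarrow>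
     \<bar>na_balanced a b \<Phi> k ak S m x - A_dual b \<Phi> (trop x)\<bar> \<le> C / (real k)\<^sup>2"
proof -
  obtain \<mu> where \<mu>: "\<mu> > 0" "\<And>y. \<mu> * (norm y)\<^sup>2 \<le> B y y" using B_lower_bound by blast
  obtain M where M: "M > 0" "\<And>y. B y y \<le> M * (norm y)\<^sup>2" using B_upper_bound by blast
  \<comment> \<open>This bounds \<open>d\<close> at the rounded point \<open>e0\<close>, whose
    distance from the real maximum point is at most the number of coordinates.\<close>
  define R where "R = M * (real CARD('g))\<^sup>2"
  \<comment> \<open>Points with \<open>d\<close> at most \<open>R\<close> lie within
    \<open>sqrt (R / \<mu>)\<close> of the maximum point, so two of them have distance less than
    \<open>k\<close>; distinct points of one coset of \<open>k \<Phi>\<close> have distance at least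
    \<open>k\<close>.\<close>
  define k0 where "k0 = Suc (nat \<lceil>2 * sqrt (R / \<mu>)\<rceil>)"
  have norm_le: "norm y \<le> sqrt (T / \<mu>)" if "B y y \<le> T" for y T
  proof -
    have "(norm y)\<^sup>2 \<le> T / \<mu>" using \<mu>(2)[of y] that \<mu>(1) by (simp add: field_simps)
    then show ?thesis using real_le_rsqrt by blast
  qed
  have main: "\<bar>na_balanced a b \<Phi> k ak S m x - A_dual b \<Phi> (trop x)\<bar> \<le> R / 2 / (real k)\<^sup>2"
    if k0: "k \<ge> k0" and bd: "balanced_data a b \<Phi> k ak bk S" and m: "m \<ge> 1" and x: "x \<in> torus_an m" for k ak bk S m x
  proof -
    interpret torus_point m x by unfold_locales (rule x)
    have k: "k \<ge> 1" using k0 by (simp add: k0_def)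
    define n where "n = trop x"
    obtain v where v: "\<And>y. B v y = n \<bullet> y" using B_represents by blast
    define A where "A = B v v / 2"
    have A: "A_dual b \<Phi> (trop x) = A" using A_dual_eq[OF v] by (simp add: A_def n_def)
    \<comment> \<open>Completing the square: \<open>W e\<close> is the logarithm of the weighted
      term at \<open>e\<close>, with real maximum \<open>k * A\<close> at \<open>- k v\<close>, and
      \<open>d e\<close> is the squared distance of \<open>e\<close> from that point for
      \<open>B\<close>.\<close>
    define d where "d e = B (rvec e + real k *\<^sub>R v) (rvec e + real k *\<^sub>R v)" for e
    define W where "W e = real k * A - d e / (2 * real k)" for e
    have W_eq: "W e = - B (rvec e) (rvec e) / (2 * real k) - rvec e \<bullet> n" for e
      using k v[of "rvec e"] unfolding W_def d_def A_def B_add_square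
      by (simp add: bilinear_lmul[OF bilinear_B] bilinear_rmul[OF bilinear_B] B_sym[of "rvec e" v] inner_commute field_simps)
    have fin_d: "finite {e. d e \<le> T}" for T
      by (rule finite_subset[OF _ finite_rvec_ball[of "real k *\<^sub>R v" "sqrt (T / \<mu>)"]])
        (auto simp: d_def intro: norm_le)
    have fin_W: "finite {e. W e \<ge> T}" for T
      by (rule finite_subset[OF _ fin_d[of "2 * real k * (real k * A - T)"]])
        (use k in \<open>auto simp: W_def field_simps\<close>)
    define e0 :: "int ^ 'g" where "e0 = (\<chi> i. \<lfloor>- (real k * v $ i)\<rfloor>)"
    have "norm (rvec e0 + real k *\<^sub>R v) \<le> (\<Sum>i\<in>UNIV. \<bar>(rvec e0 + real k *\<^sub>R v) $ i\<bar>)"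
      by (rule norm_le_l1_cart)
    also have "\<dots> \<le> (\<Sum>i\<in>(UNIV :: 'g set). 1)"
      by (rule sum_mono) (simp add: e0_def, linarith)
    finally have "norm (rvec e0 + real k *\<^sub>R v) \<le> real CARD('g)" by simp
    then have "(norm (rvec e0 + real k *\<^sub>R v))\<^sup>2 \<le> (real CARD('g))\<^sup>2" by (intro power_mono) auto
    then have "d e0 \<le> R" unfolding d_def R_def
      using M(2)[of "rvec e0 + real k *\<^sub>R v"] M(1) by (meson mult_left_mono less_imp_le order_trans)
    then have ne: "{e. d e \<le> R} \<noteq> {}" by blast
    \<comment> \<open>A minimum over this finite nonempty set is a minimum over the whole lattice,
      since outside of it \<open>d\<close> exceeds \<open>R\<close>.\<close>
    have "Min (d ` {e. d e \<le> R}) \<in> d ` {e. d e \<le> R}" using fin_d ne by (intro Min_in) auto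
    then obtain e1 where e1: "d e1 \<le> R" "d e1 = Min (d ` {e. d e \<le> R})" by auto
    have min: "d e1 \<le> d e" for e
    proof (cases "d e \<le> R")
      case True
      then show ?thesis unfolding e1(2) using fin_d by (intro Min_le) auto
    qed (use e1(1) in linarith)
    then have W_le: "W e \<le> W e1" for e using k by (simp add: W_def divide_right_mono)
    have W_less: "W e < W e1" if e: "e = e1 + int k *s \<Phi> l" "e \<noteq> e1" for e l
    proof (rule ccontr)
      assume "\<not> W e < W e1"
      then have "d e \<le> R" using e1(1) k by (simp add: W_def field_simps)
      have "real k *\<^sub>R rvec (\<Phi> l) = (rvec e + real k *\<^sub>R v) - (rvec e1 + real k *\<^sub>R v)"
        unfolding e(1) rvec_add rvec_scale by simp
      then have "norm (real k *\<^sub>R rvec (\<Phi> l)) \<le> norm (rvec e + real k *\<^sub>R v) + norm (rvec e1 + real k *\<^sub>R v)"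
        by (metis norm_triangle_ineq4)
      also have "\<dots> \<le> sqrt (R / \<mu>) + sqrt (R / \<mu>)"
        using \<open>d e \<le> R\<close> e1(1) unfolding d_def by (intro add_mono norm_le)
      also have "\<dots> < real k"
        using k0 of_nat_ceiling[of "2 * sqrt (R / \<mu>)"] by (simp add: k0_def)
      finally have "norm (rvec (\<Phi> l)) < 1" using k by simp
      moreover have "\<Phi> l \<noteq> 0" using e by (auto simp: vec_eq_iff)
      ultimately show False using norm_rvec_ge_1[of "\<Phi> l"] by simp
    qed
    define \<alpha> where "\<alpha> e = abs_ac (ak e)" for e
    have \<alpha>: "\<alpha> e > 0" for e unfolding \<alpha>_def abs_ac_ak[OF bd k] by simp
    define h where "h e e' = Poly_Mapping.single e' (fls_compose_power (theta a b \<Phi> k e e') m)" for e e'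
    have xh: "x (h e e') = exp (W e') / \<alpha> e" if "e' = e + int k *s \<Phi> l" for e e' l
      using theta_weight[OF bd k that] \<alpha>[of e] unfolding h_def monomial absK_compose_power[OF m]
      by (simp add: W_eq n_def exp_diff exp_minus \<alpha>_def field_simps)
    have xh0: "x (h e e') = 0" if "\<nexists>l. e' = e + int k *s \<Phi> l" for e e'
      using theta_outside_coset[OF that] by (simp add: h_def zero)
    have fin_h: "finite {e'. x (h e e') \<ge> \<epsilon>}" if "\<epsilon> > 0" for e \<epsilon>
    proof (rule finite_subset[OF _ fin_W[of "ln (\<epsilon> * \<alpha> e)"]], safe)
      fix e' assume ge: "\<epsilon> \<le> x (h e e')"
      then obtain l where "e' = e + int k *s \<Phi> l" using xh0 \<open>\<epsilon> > 0\<close> by force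
      then have "\<epsilon> * \<alpha> e \<le> exp (W e')" using ge \<alpha>[of e] by (simp add: xh field_simps)
      then show "ln (\<epsilon> * \<alpha> e) \<le> W e'"
        using \<alpha>[of e] \<open>\<epsilon> > 0\<close> by (metis exp_gt_zero ln_exp ln_le_cancel_iff mult_pos_pos)
    qed
    define V where "V e = abs_lim x (partial_sum m (theta a b \<Phi> k e)) * \<alpha> e" for e
    have lim: "abs_lim x (partial_sum m (theta a b \<Phi> k e)) = Lim (finite_subsets_at_top UNIV) (\<lambda>F. x (sum (h e) F))" for e
      by (simp add: abs_lim_def partial_sum_def[abs_def] h_def[abs_def])
    \<comment> \<open>Cancellation within the other theta functions is harmless: only an upper bound
      is needed for them, and the ultrametric inequality gives it.\<close>
    have V_le: "V e \<le> exp (W e1)" for e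
    proof -
      have "abs_lim x (partial_sum m (theta a b \<Phi> k e)) \<le> exp (W e1) / \<alpha> e"
        unfolding lim
      proof (rule sum_lim_le[OF fin_h])
        fix e'
        show "x (h e e') \<le> exp (W e1) / \<alpha> e"
        proof (cases "\<exists>l. e' = e + int k *s \<Phi> l")
          case True
          then show ?thesis using xh W_le[of e'] \<alpha>[of e] by (auto simp: divide_right_mono)
        next
          case False
          then show ?thesis using xh0[OF False] \<alpha>[of e] by simp
        qed
      qed (use \<alpha>[of e] in simp_all)
      then show ?thesis using \<alpha>[of e] by (simp add: V_def field_simps)
    qed
    obtain e2 l2 where e2: "e2 \<in> S" "e1 = e2 + int k *s \<Phi> l2"
      using representative_unique[OF bd, of e1] by blast
    have V_eq: "V e2 = exp (W e1)"
    proof -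
      have "abs_lim x (partial_sum m (theta a b \<Phi> k e2)) = x (h e2 e1)"
        unfolding lim
      proof (rule sum_lim_dominant[OF fin_h])
        show "x (h e2 e1) > 0" using xh[OF e2(2)] \<alpha>[of e2] by simp
        fix e assume "e \<noteq> e1"
        show "x (h e2 e) < x (h e2 e1)"
        proof (cases "\<exists>l. e = e2 + int k *s \<Phi> l")
          case True
          then obtain l where l: "e = e2 + int k *s \<Phi> l" by blast
          have "e = e1 + int k *s \<Phi> (l - l2)"
            unfolding l e2(2) \<Phi>_diff by (simp add: vec_eq_iff algebra_simps)
          then have "W e < W e1" using \<open>e \<noteq> e1\<close> by (rule W_less)
          then show ?thesis using xh[OF l] xh[OF e2(2)] \<alpha>[of e2] by (simp add: divide_strict_right_mono)
        next
          case False
          then show ?thesis using xh0[OF False] \<open>x (h e2 e1) > 0\<close> by simp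
        qed
      qed
      then show ?thesis using xh[OF e2(2)] \<alpha>[of e2] by (simp add: V_def)
    qed
    have "Max (V ` S) = exp (W e1)"
      by (rule Max_eqI) (use finite_representatives[OF bd k] V_le V_eq e2(1) in \<open>auto simp: image_iff intro!: bexI[of _ e2]\<close>)
    then have "na_balanced a b \<Phi> k ak S m x = W e1 / real k"
      by (simp add: na_balanced_def V_def[abs_def] \<alpha>_def)
    \<comment> \<open>In \<open>W\<close> the defect \<open>d e1\<close> already carries the factor
      \<open>1 / (2 * k)\<close>; the division by \<open>k\<close> in the metric supplies the second
      power.\<close>
    also have "\<dots> = A - d e1 / 2 / (real k)\<^sup>2"
      using k by (simp add: W_def field_simps power2_eq_square)
    finally have "\<bar>na_balanced a b \<Phi> k ak S m x - A_dual b \<Phi> (trop x)\<bar> = d e1 / 2 / (real k)\<^sup>2"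
      using B_nonneg by (simp add: A d_def)
    also have "\<dots> \<le> R / 2 / (real k)\<^sup>2" using e1(1) by (simp add: divide_right_mono)
    finally show ?thesis .
  qed
  show ?thesis
    by (rule exI[of _ "R / 2"], rule exI[of _ k0]) (use main in \<open>auto simp: k0_def\<close>)
qed

end

text \<open>The order of quantifiers expresses uniformity: \<open>C\<close> and
  \<open>k\<^sub>0\<close> precede the level, the base change and all auxiliary choices, and only
  the radius \<open>r\<close> comes after them. The supremum over the cone is the supremum over the
  fiber, as the difference is constant on orbits; taken in \<open>ereal\<close>, its bound includes
  boundedness.\<close>

theorem theorem4:
  fixes w :: "'n::finite \<Rightarrow> nat"
    and I :: "'n coordpoly set"
    and a :: "int ^ 'g::finite \<Rightarrow> complex fls"
    and b :: "int ^ 'g \<Rightarrow> int ^ 'g \<Rightarrow> complex fls"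
    and \<Phi> :: "int ^ 'g \<Rightarrow> int ^ 'g"
    and \<tau> :: "'n \<Rightarrow> 'g laurent_series"
    and \<phi>CY :: "complex \<Rightarrow> complex ^ 'n \<Rightarrow> real"
  assumes family: "totally_degenerating_family w I a b \<Phi> \<tau>"
    and CY: "calabi_yau_metrics w I b \<Phi> \<tau> \<phi>CY"
  shows "\<exists>C::real. \<exists>k\<^sub>0>0. \<forall>k\<ge>k\<^sub>0.
    \<forall>(ak :: int ^ 'g \<Rightarrow> complex fls alg_closure) bk S (m::nat) (\<rho>::real) \<phi>hyb.
      balanced_data a b \<Phi> k ak bk S \<and> m \<ge> 1 \<and> 0 < \<rho> \<and> \<rho> \<le> exp (-1) \<and>
      hybrid_balanced w I a b \<Phi> \<tau> k ak S m \<rho> \<phi>hyb \<longrightarrow>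
      (\<exists>r. 0 < r \<and> r \<le> \<rho> \<and>
        (\<forall>s. s \<noteq> 0 \<and> s \<in> disc m r \<longrightarrow>
          (SUP z \<in> ccone I (s ^ m). ereal (cfun (s ^ m) *
             \<bar>\<phi>CY (s ^ m) z - \<phi>hyb (cpoint w m \<rho> s z) / cfun (s ^ m)\<bar>))
          \<le> ereal (C / (real k)\<^sup>2)))"
proof -
  note fam = family[unfolded totally_degenerating_family_def]
  have w: "w i \<ge> 1" for i using fam[THEN conjunct1] by blast
  have I: "homog_ideal w (Aring 1 (exp (-1))) I"
    and gcd: "\<forall>v \<in> hspace w I 1 (exp (-1)). Gcd {w i | i. v (pvar i) \<noteq> 0} = 1"
    and dd: "degeneration_data a b \<Phi>" and unif: "uniformization w I a b \<Phi> \<tau>"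
    by (rule fam[THEN conjunct2, THEN conjunct1],
      rule fam[THEN conjunct2, THEN conjunct2, THEN conjunct1],
      rule fam[THEN conjunct2, THEN conjunct2, THEN conjunct2, THEN conjunct2, THEN conjunct1],
      rule fam[THEN conjunct2, THEN conjunct2, THEN conjunct2, THEN conjunct2, THEN conjunct2])
  interpret degeneration a b \<Phi> by unfold_locales (rule dd)
  have unif_in: "unif_map w \<tau> m \<rho> x \<in> hcone w I m \<rho> 0"
    if "m \<ge> 1" "0 < \<rho>" "\<rho> \<le> exp (-1)" "x \<in> torus_an m" for m \<rho> x
    using unif that unfolding uniformization_def by (elim conjE) blast
  have unif_surj: "\<exists>x \<in> torus_an m. \<exists>r>0. rescaled w (Aring m \<rho>) r (unif_map w \<tau> m \<rho> x) v"
    if "m \<ge> 1" "0 < \<rho>" "\<rho> \<le> exp (-1)" "v \<in> hcone w I m \<rho> 0" for m \<rho> v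
    using unif that unfolding uniformization_def by (elim conjE) blast
  obtain \<phi>1 where \<phi>1: "hyb_cpsh_metric w I 1 (exp (-1)) \<phi>1"
    and \<phi>1_CY: "\<And>t z. \<lbrakk>0 < norm t; norm t < exp (-1); z \<in> ccone I t\<rbrakk> \<Longrightarrow> \<phi>1 (cpoint w 1 (exp (-1)) t z) = cfun t * \<phi>CY t z"
    and \<phi>1_0: "restricts_to_NACY w b \<Phi> \<tau> \<phi>1"
    using CY unfolding calabi_yau_metrics_def by blast
  have c1: "hyb_cont_metric w I 1 (exp (-1)) \<phi>1" using \<phi>1 by (simp add: hyb_cpsh_metric_def)
  obtain C k\<^sub>0 where k\<^sub>0: "k\<^sub>0 > 0" and est: "\<And>k ak bk S m x. \<lbrakk>k \<ge> k\<^sub>0; balanced_data a b \<Phi> k ak bk S; m \<ge> 1; x \<in> torus_an m\<rbrakk> \<Longrightarrow>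
     \<bar>na_balanced a b \<Phi> k ak S m x - A_dual b \<Phi> (trop x)\<bar> \<le> C / (real k)\<^sup>2"
    using na_balanced_estimate by blast
  have main: "\<exists>r. 0 < r \<and> r \<le> \<rho> \<and>
        (\<forall>s. s \<noteq> 0 \<and> s \<in> disc m r \<longrightarrow>
          (SUP z \<in> ccone I (s ^ m). ereal (cfun (s ^ m) *
             \<bar>\<phi>CY (s ^ m) z - \<phi>hyb (cpoint w m \<rho> s z) / cfun (s ^ m)\<bar>))
          \<le> ereal ((C + 1) / (real k)\<^sup>2))"
    if k: "k \<ge> k\<^sub>0" and bd: "balanced_data a b \<Phi> k ak bk S" and m: "m \<ge> 1" and \<rho>: "0 < \<rho>" "\<rho> \<le> exp (-1)"
      and hb: "hybrid_balanced w I a b \<Phi> \<tau> k ak S m \<rho> \<phi>hyb" for k ak bk S m \<rho> \<phi>hyb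
  proof -
    have c2: "hyb_cont_metric w I m \<rho> \<phi>hyb"
      and \<phi>hyb_0: "\<And>x. x \<in> torus_an m \<Longrightarrow> \<phi>hyb (unif_map w \<tau> m \<rho> x) = na_balanced a b \<Phi> k ak S m x"
      using hb unfolding hybrid_balanced_def hyb_cpsh_metric_def by blast+
    have d0: "(0::complex) \<in> disc m \<rho>" using m \<rho> by (simp add: disc_def power_0_left)
    have central: "\<bar>\<phi>1 (restrict_pt w m v) - \<phi>hyb v\<bar> \<le> C / (real k)\<^sup>2" if v: "v \<in> hcone w I m \<rho> 0" for v
    proof -
      obtain x r where x: "x \<in> torus_an m" and r: "r > 0" "rescaled w (Aring m \<rho>) r (unif_map w \<tau> m \<rho> x) v"
        using unif_surj[OF m \<rho> v] by blast
      have "\<phi>1 (restrict_pt w m v) - \<phi>hyb v =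
          \<phi>1 (restrict_pt w m (unif_map w \<tau> m \<rho> x)) - \<phi>hyb (unif_map w \<tau> m \<rho> x)"
        by (rule hcone_rescale_invariant[OF c1 c2 m \<rho> d0 unif_in[OF m \<rho> x] v r])
      also have "\<dots> = A_dual b \<Phi> (trop x) - na_balanced a b \<Phi> k ak S m x"
        using \<phi>1_0 torus_an_base_change[OF m x] unfolding restricts_to_NACY_def
        by (simp add: restrict_pt_unif_map[OF m \<rho>] \<phi>hyb_0[OF x] del: One_nat_def)
      finally show ?thesis using est[OF k bd m x] by simp
    qed
    \<comment> \<open>The loss allowed in passing to nearby fibers is of the same order as the
      central error, which turns \<open>C\<close> into \<open>C + 1\<close>.\<close>
    have "0 < 1 / (real k)\<^sup>2" using k k\<^sub>0 by simp
    from metric_difference_near_central_fiber[OF w I gcd m \<rho> c1 c2 central this]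
    obtain r where r: "0 < r" "r \<le> \<rho>" and near: "\<And>s z. \<lbrakk>s \<noteq> 0; s \<in> disc m r; z \<in> ccone I (s ^ m)\<rbrakk> \<Longrightarrow>
      \<bar>\<phi>1 (cpoint w 1 (exp (-1)) (s ^ m) z) - \<phi>hyb (cpoint w m \<rho> s z)\<bar> \<le> C / (real k)\<^sup>2 + 1 / (real k)\<^sup>2"
      by blast
    have "(SUP z \<in> ccone I (s ^ m). ereal (cfun (s ^ m) *
             \<bar>\<phi>CY (s ^ m) z - \<phi>hyb (cpoint w m \<rho> s z) / cfun (s ^ m)\<bar>)) \<le> ereal ((C + 1) / (real k)\<^sup>2)"
      if s: "s \<noteq> 0" "s \<in> disc m r" for s
    proof (rule SUP_least)
      fix z assume z: "z \<in> ccone I (s ^ m)"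
      have t: "s ^ m \<noteq> 0" "norm (s ^ m) < exp (-1)"
        using s r \<rho> by (auto simp: disc_def norm_power)
      have c: "cfun (s ^ m) > 0" using cfun_bounds[OF t] by simp
      have "cfun (s ^ m) * \<bar>\<phi>CY (s ^ m) z - \<phi>hyb (cpoint w m \<rho> s z) / cfun (s ^ m)\<bar> =
          \<bar>cfun (s ^ m) * (\<phi>CY (s ^ m) z - \<phi>hyb (cpoint w m \<rho> s z) / cfun (s ^ m))\<bar>"
        using c by (simp add: abs_mult)
      also have "cfun (s ^ m) * (\<phi>CY (s ^ m) z - \<phi>hyb (cpoint w m \<rho> s z) / cfun (s ^ m)) =
          \<phi>1 (cpoint w 1 (exp (-1)) (s ^ m) z) - \<phi>hyb (cpoint w m \<rho> s z)"
        using c t z by (subst \<phi>1_CY) (auto simp: right_diff_distrib)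
      also have "\<bar>\<dots>\<bar> \<le> (C + 1) / (real k)\<^sup>2" using near[OF s z] by (simp add: add_divide_distrib)
      finally show "ereal (cfun (s ^ m) * \<bar>\<phi>CY (s ^ m) z - \<phi>hyb (cpoint w m \<rho> s z) / cfun (s ^ m)\<bar>)
          \<le> ereal ((C + 1) / (real k)\<^sup>2)" by simp
    qed
    then show ?thesis using r by blast
  qed
  show ?thesis
    by (rule exI[of _ "C + 1"], rule exI[of _ k\<^sub>0]) (use k\<^sub>0 main in blast)
qed

end
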